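(* Let $\eta,\mu>0$ be real numbers with $\eta>\max(\mu,1)$. Let $\chi$ be a real primitive Dirichlet character modulo $q$ with $\chi(-1)=-1$, put $\ell=(\log\log q)^{-\mu}$, and define $$H(\ell,q)=\left\{s=\sigma+it:\ |1-s|\ge(\log q)^{-4},\ \tfrac12+\ell\le\sigma\le 1,\ |s|\le q^{\ell/10}\right\}.$$ If $$h(-q)\le\frac{\log q}{(\log\log q)^{\eta}},$$ then for each $s\in H(\ell,q)$ the relation $$L(s,\chi)=\frac{\zeta(2s)}{\zeta(s)}\prod_{p\mid q}\left(1+\frac1{p^{s}}\right)\left[1+O\left(\exp\left\{-\tfrac13(\log\log q)^{\eta-\mu}\right\}\right)\right]$$ holds.
   Context: $L(s,\chi)$ is the Dirichlet $L$-function of $\chi$, $\zeta$ is the Riemann zeta function, and $h(-q)$ is the class number of the imaginary quadratic field $\mathbb{Q}(\sqrt{-q})$. Products over $p\mid q$ run over the primes dividing $q$. The $O$-estimate is understood for $q$ sufficiently large (in terms of $\eta,\mu$), uniformly in $s\in H(\ell,q)$, with implied constant depending only on $\eta,\mu$. *)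

theory Defs
  imports "HOL-Complex_Analysis.Complex_Analysis" "HOL-Algebra.Ideal"
begin

definition dirichlet_character :: "nat \<Rightarrow> (int \<Rightarrow> complex) \<Rightarrow> bool" where
  "dirichlet_character q chi \<longleftrightarrow>
     q > 0 \<and>
     (\<forall>a b. chi (a * b) = chi a * chi b) \<and>
     (\<forall>a. chi (a + int q) = chi a) \<and>
     (\<forall>a. chi a \<noteq> 0 \<longleftrightarrow> coprime a (int q))"

definition principal_character :: "nat \<Rightarrow> (int \<Rightarrow> complex) \<Rightarrow> bool" where
  "principal_character q chi \<longleftrightarrow>
     dirichlet_character q chi \<and> (\<forall>a. coprime a (int q) \<longrightarrow> chi a = 1)"

definition primitive_character :: "nat \<Rightarrow> (int \<Rightarrow> complex) \<Rightarrow> bool" where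
  "primitive_character q chi \<longleftrightarrow>
     dirichlet_character q chi \<and>
     \<not> (\<exists>d \<psi>. d dvd q \<and> d < q \<and> dirichlet_character d \<psi> \<and>
            (\<forall>a. coprime a (int q) \<longrightarrow> chi a = \<psi> a))"

definition real_character :: "(int \<Rightarrow> complex) \<Rightarrow> bool" where
  "real_character chi \<longleftrightarrow> (\<forall>a. chi a \<in> \<real>)"

(* The value at s of the analytic continuation of the Dirichlet series
   sum a(n) n^(-z) (n >= 1), assumed convergent for Re z > 1, to some right half-plane
   containing s, with the points of P removed. For finite P the value does not depend on the
   half-plane, by the identity theorem. It is unspecified if s lies in P or if there is
   no such continuation. *)
definition dirichlet_series_continuation :: "complex set \<Rightarrow> (nat \<Rightarrow> complex) \<Rightarrow> complex \<Rightarrow> complex"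
where
  "dirichlet_series_continuation P a s =
     (THE w. \<exists>c f. s \<in> {z. c < Re z} - P \<and>
                   f holomorphic_on ({z. c < Re z} - P) \<and>
                   (\<forall>z. 1 < Re z \<longrightarrow> (\<lambda>n. a (Suc n) / of_nat (Suc n) powr z) sums f z) \<and>
                   w = f s)"

definition zeta :: "complex \<Rightarrow> complex" where
  "zeta = dirichlet_series_continuation {1} (\<lambda>n. 1)"

definition dirichlet_L :: "nat \<Rightarrow> (int \<Rightarrow> complex) \<Rightarrow> complex \<Rightarrow> complex" where
  "dirichlet_L q chi =
     dirichlet_series_continuation (if principal_character q chi then {1} else {}) (\<lambda>n. chi (int n))"

definition imaginary_quadratic_field :: "nat \<Rightarrow> complex set" where
  "imaginary_quadratic_field q = {x + y * csqrt (- of_nat q) | x y. x \<in> \<rat> \<and> y \<in> \<rat>}"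

definition ring_of_integers :: "complex set \<Rightarrow> complex ring" where
  "ring_of_integers K =
     \<lparr>carrier = {x \<in> K. algebraic_int x}, mult = (*), one = 1, zero = 0, add = (+)\<rparr>"

definition nonzero_ideals :: "complex set \<Rightarrow> complex set set" where
  "nonzero_ideals K = {I. ideal I (ring_of_integers K) \<and> I \<noteq> {0}}"

definition ideal_class_rel :: "complex set \<Rightarrow> (complex set \<times> complex set) set" where
  "ideal_class_rel K =
     {(I, J). I \<in> nonzero_ideals K \<and> J \<in> nonzero_ideals K \<and>
        (\<exists>a \<in> carrier (ring_of_integers K) - {0}. \<exists>b \<in> carrier (ring_of_integers K) - {0}.
            (*) a ` I = (*) b ` J)}"

definition class_number :: "complex set \<Rightarrow> nat" where
  "class_number K = card (nonzero_ideals K // ideal_class_rel K)"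

definition ell :: "real \<Rightarrow> nat \<Rightarrow> real" where
  "ell \<mu> q = ln (ln (real q)) powr (- \<mu>)"

definition region_H :: "real \<Rightarrow> nat \<Rightarrow> complex set" where
  "region_H l q =
     {s. cmod (1 - s) \<ge> ln (real q) powr (- 4) \<and>
         1 / 2 + l \<le> Re s \<and> Re s \<le> 1 \<and>
         cmod s \<le> real q powr (l / 10)}"

end

theory Submission
  imports Defs "HOL-Number_Theory.Number_Theory" "HOL-Real_Asymp.Real_Asymp"
begin

text \<open>Write \<open>h\<close> for the class number. The product \<open>\<zeta>(s) L(s, \<chi>)\<close> is the sum of \<open>Q\<^sub>C(x, y)\<close> to the power \<open>-s\<close> over
  the reduced binary quadratic forms \<open>Q\<^sub>C = a x\<^sup>2 + b x y + c y\<^sup>2\<close> of discriminant \<open>-q\<close>, one for each ideal class \<open>C\<close>,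
  and over half of the lattice points. The points with \<open>y = 0\<close> contribute \<open>\<zeta>(2s) a\<close> to the power
  \<open>-s\<close>. For \<open>y > 0\<close>, comparing the sum over \<open>x\<close> with an integral continues the contribution of the other points to
  \<open>Re s > 1/2\<close> and bounds it by a power of \<open>1/c\<close>, where \<open>c \<ge> \<surd>q/2\<close>.
  Hence \<open>\<zeta>(s) L(s, \<chi>)\<close> is close to \<open>\<zeta>(2s)\<close> times the sum of \<open>a\<close> to the power \<open>-s\<close> over the classes.

  The classes with \<open>a < \<surd>q/2\<close> correspond to the primitive ideals of norm \<open>a\<close>. If only ramified
  primes divide \<open>a\<close>, then \<open>a\<close> is squarefree and gives one term of the expanded product over the primes
  dividing \<open>q\<close>. Otherwise \<open>a\<close> has a split prime factor \<open>p\<close>. The powers of a prime above \<open>p\<close> lie in distinct classes as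
  long as their norms are below \<open>\<surd>q/2\<close>, so that \<open>p\<close> is at least about \<open>q\<close> to the power \<open>1/(2h)\<close>, which is large when
  \<open>h\<close> is small.\<close>

section \<open>Real primitive characters\<close>

text \<open>The obstacle is that \<open>chi\<close> is an abstract function with a primitivity
  condition, while the class number speaks of ideals made of complex numbers. The bridge is
  arithmetic: \<open>-q\<close> must be shown to be a fundamental discriminant and
  \<open>chi\<close> its Kronecker symbol, so that the divisor sums of \<open>chi\<close> count the
  ideals of a given norm. At odd primes this is the Gauss sum proof of quadratic reciprocity; the
  prime 2 needs separate arguments, among them a comparison with a character modulo 8. On the
  analytic side, dividing by \<open>zeta s\<close> presupposes that it does not vanish, which is
  obtained along the way: zeta(2s) and the product over the ramified primes are bounded away from 0,
  the latter because the class number also controls the number of ramified primes, and the relative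
  error is below 1. Hence the product of \<open>zeta s\<close> and the L-value is not 0. With
  \<open>h\<close> the class number, the errors are about \<open>q\<close> to the powers
  \<open>- 3 * ell / 20\<close> and \<open>- 1 / (4 * h)\<close>, up to powers of
  \<open>ln q\<close>, \<open>h\<close> and \<open>1 / ell\<close>. The bound on \<open>h\<close>
  makes the second at most \<open>exp (- (ln ln q) powr \<eta> / 8)\<close>, which leaves room for
  those factors.\<close>

lemma frobenius_sum:
  fixes f :: "'b \<Rightarrow> 'a :: comm_ring_1"
  assumes p: "prime p" and A: "finite A"
  shows "\<exists>R. (\<Sum>a\<in>A. f a) ^ p = (\<Sum>a\<in>A. f a ^ p) + of_nat p * R"
  using A
proof (induction A)
  case empty
  then show ?case using p prime_gt_0_nat[of p] by (auto simp: zero_power intro!: exI[of _ 0])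
next
  case (insert x A)
  then obtain R where R: "(\<Sum>a\<in>A. f a) ^ p = (\<Sum>a\<in>A. f a ^ p) + of_nat p * R" by blast
  have two: "\<exists>R. (u + v) ^ p = u ^ p + v ^ p + of_nat p * R" for u v :: 'a
  proof -
    have p0: "p > 0" using p prime_gt_0_nat by blast
    have "(u + v) ^ p = (\<Sum>k\<le>p. of_nat (p choose k) * u ^ k * v ^ (p - k))"
      by (rule binomial_ring)
    also have "{..p} = insert 0 (insert p {1..<p})" using p0 by auto
    also have "(\<Sum>k\<in>\<dots>. of_nat (p choose k) * u ^ k * v ^ (p - k)) =
        u ^ p + v ^ p + (\<Sum>k=1..<p. of_nat (p choose k) * u ^ k * v ^ (p - k))"
      using p0 by (subst sum.insert) (auto simp: algebra_simps)
    also have "(\<Sum>k=1..<p. of_nat (p choose k) * u ^ k * v ^ (p - k)) =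
        of_nat p * (\<Sum>k=1..<p. of_nat ((p choose k) div p) * u ^ k * v ^ (p - k))"
      unfolding sum_distrib_left
    proof (rule sum.cong[OF refl])
      fix k assume "k \<in> {1..<p}"
      then have "p dvd (p choose k)" using p by (intro dvd_choose_prime) auto
      then have "(of_nat (p choose k) :: 'a) = of_nat p * of_nat ((p choose k) div p)"
        by (metis dvd_mult_div_cancel of_nat_mult)
      then show "of_nat (p choose k) * u ^ k * v ^ (p - k) =
          of_nat p * (of_nat ((p choose k) div p) * u ^ k * v ^ (p - k))"
        by (simp add: mult.assoc)
    qed
    finally show ?thesis by blast
  qed
  obtain R' where R': "(f x + (\<Sum>a\<in>A. f a)) ^ p = f x ^ p + (\<Sum>a\<in>A. f a) ^ p + of_nat p * R'"
    using two by blast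
  show ?case using insert R R'
    by (auto simp: algebra_simps intro!: exI[of _ "R + R'"])
qed

locale odd_real_character =
  fixes q :: nat and chi :: "int \<Rightarrow> complex"
  assumes prim: "primitive_character q chi" and real: "real_character chi" and odd: "chi (-1) = -1"
begin

text \<open>The values as integers, so that they can enter congruences modulo a prime and serve as
  coefficients of integer polynomials.\<close>

definition X :: "int \<Rightarrow> int" where
  "X a = (if chi a = 1 then 1 else if chi a = -1 then -1 else 0)"

lemma dc: "dirichlet_character q chi"
  using prim by (simp add: primitive_character_def)

lemma q_pos: "q > 0" using dc by (simp add: dirichlet_character_def)

lemma chi_mult: "chi (a * b) = chi a * chi b" using dc by (simp add: dirichlet_character_def)

lemma chi_nz: "chi a \<noteq> 0 \<longleftrightarrow> coprime a (int q)" using dc by (simp add: dirichlet_character_def)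

lemma chi_shift_nat: "chi (a + int q * int k) = chi a"
proof (induction k)
  case (Suc k)
  have "chi ((a + int q * int k) + int q) = chi (a + int q * int k)"
    using dc by (simp add: dirichlet_character_def)
  then show ?case using Suc by (simp add: algebra_simps)
qed auto

lemma chi_cong: "[a = b] (mod int q) \<Longrightarrow> chi a = chi b"
proof -
  assume "[a = b] (mod int q)"
  then obtain k where k: "b = a + int q * k" by (auto simp: cong_iff_lin)
  show ?thesis
  proof (cases "k \<ge> 0")
    case True
    then show ?thesis using chi_shift_nat[of a "nat k"] k by simp
  next
    case False
    then show ?thesis using chi_shift_nat[of b "nat (-k)"] k by (simp add: algebra_simps)
  qed
qed

lemma chi_one: "chi 1 = 1"
  using chi_mult[of 1 1] chi_nz[of 1] by simp

lemma chi_power: "chi (a ^ n) = chi a ^ n"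
  by (induction n) (auto simp: chi_one chi_mult)

text \<open>By Euler's theorem a nonzero value is a root of unity, and the only real ones are 1 and
  -1.\<close>

lemma chi_cases: "coprime a (int q) \<Longrightarrow> chi a = 1 \<or> chi a = -1"
proof -
  assume cop: "coprime a (int q)"
  define b where "b = nat (a mod int q)"
  have b: "int b = a mod int q" using q_pos by (simp add: b_def)
  then have ba: "[int b = a] (mod int q)" by (simp add: cong_def)
  then have "coprime (int b) (int q)" using cop by (metis cong_imp_coprime cong_sym)
  then have "[b ^ totient q = 1] (mod q)" by (intro euler_theorem) simp
  then have "[int b ^ totient q = 1] (mod int q)" by (metis cong_int_iff of_nat_1 of_nat_power)
  then have "chi (int b ^ totient q) = 1"
    using chi_cong[of "int b ^ totient q" 1] chi_one by simp
  then have pw: "chi a ^ totient q = 1" using chi_power chi_cong[OF ba] by simp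
  have n1: "norm (chi a) = 1"
  proof (rule power_eq_imp_eq_base)
    show "norm (chi a) ^ totient q = 1 ^ totient q" using pw by (metis norm_one norm_power power_one)
    show "totient q > 0" using q_pos by simp
  qed auto
  have "chi a \<in> \<real>" using real by (simp add: real_character_def)
  then obtain r where r: "chi a = of_real r" by (auto elim: Reals_cases)
  then have "\<bar>r\<bar> = 1" using n1 by simp
  then show ?thesis using r by (auto simp: abs_if split: if_splits)
qed

lemma X_chi: "of_int (X a) = chi a"
  using chi_cases[of a] chi_nz[of a] by (auto simp: X_def)

lemma X_eq_iff: "X a = X b \<longleftrightarrow> chi a = chi b"
  by (metis X_chi of_int_eq_iff)

lemma X_mult: "X (a * b) = X a * X b"
  by (metis X_chi chi_mult of_int_eq_iff of_int_mult)

lemma X_cong: "[a = b] (mod int q) \<Longrightarrow> X a = X b"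
  using chi_cong X_eq_iff by blast

lemma X_1: "X 1 = 1" by (simp add: X_def chi_one)

lemma X_m1: "X (-1) = -1" using odd by (simp add: X_def)

lemma X_power: "X (a ^ n) = X a ^ n"
  by (induction n) (auto simp: X_1 X_mult)

lemma X_eq_0_iff: "X a = 0 \<longleftrightarrow> \<not> coprime a (int q)"
  using chi_nz[of a] X_chi[of a] by (metis of_int_0 of_int_eq_0_iff)

lemma X_cases: "coprime a (int q) \<Longrightarrow> X a = 1 \<or> X a = -1"
  using chi_cases[of a] by (auto simp: X_def)

lemma q_ge_3: "q \<ge> 3"
proof (rule ccontr)
  assume "\<not> q \<ge> 3"
  then have "q = 1 \<or> q = 2" using q_pos by auto
  then have "[-1 = (1::int)] (mod int q)" by (auto simp: cong_iff_dvd_diff)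
  then show False using X_cong X_1 X_m1 by fastforce
qed

text \<open>Otherwise \<open>chi\<close> would be 1 on all units congruent to 1 modulo
  \<open>q div p\<close>, hence would be induced from that smaller modulus, against primitivity. All
  facts about the shape of \<open>q\<close> are drawn from such witnesses.\<close>

lemma primitive_witness:
  assumes p: "prime p" "p dvd q"
  shows "\<exists>c. [c = 1] (mod int (q div p)) \<and> coprime c (int q) \<and> X c = -1"
proof (rule ccontr)
  assume neg: "\<not> ?thesis"
  define d where "d = q div p"
  have q: "q = d * p" using p by (simp add: d_def)
  have d0: "d > 0" using q q_pos by auto
  have dq: "d < q" using q d0 prime_gt_1_nat[OF p(1)] by simp
  have triv: "chi c = 1" if "[c = 1] (mod int d)" "coprime c (int q)" for c
    using neg that X_cases[of c] X_chi[of c] unfolding d_def by auto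
  have inv: "\<exists>a'. [a * a' = 1] (mod int q)" if "coprime a (int q)" for a
    using that cong_solve_coprime_int by blast
  have "\<exists>\<psi>. dirichlet_character d \<psi> \<and> (\<forall>a. coprime a (int q) \<longrightarrow> chi a = \<psi> a)"
  proof (cases "p dvd d")
    \<comment> \<open>Here coprimality to \<open>q\<close> and to \<open>d\<close> are the same
      condition, so \<open>chi\<close> itself is a character modulo \<open>d\<close>.\<close>
    case True
    have cop: "coprime x (int q) \<longleftrightarrow> coprime x (int d)" for x
    proof
      assume "coprime x (int d)"
      moreover have "coprime x (int p)"
        using calculation True by (meson coprime_divisors dvd_refl int_dvd_int_iff)
      ultimately show "coprime x (int q)" unfolding q by simp
    qed (auto simp: q)
    have "chi (a + int d) = chi a" for a
    proof (cases "coprime a (int d)")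
      case T: True
      obtain a' where a': "[a * a' = 1] (mod int q)" using inv T cop by blast
      have 1: "[1 + int d * a' = 1] (mod int d)" by (simp add: cong_def)
      have "coprime (1 + int d * a') (int d)"
        using 1 by (metis cong_imp_coprime cong_sym coprime_1_left)
      then have "chi (1 + int d * a') = 1" using triv 1 cop by blast
      moreover have "[a * (1 + int d * a') = a + int d] (mod int q)"
        using cong_add[OF cong_refl[of a] cong_scalar_left[OF a', of "int d"]]
        by (simp add: algebra_simps)
      ultimately show ?thesis using chi_cong chi_mult by (metis mult.right_neutral)
    next
      case False
      then have "\<not> coprime (a + int d) (int d)" 
        by (metis cong_add_rcancel_0 cong_imp_coprime cong_iff_dvd_diff dvd_refl add_diff_cancel_left')
      then show ?thesis using False chi_nz cop by metis
    qed
    then have "dirichlet_character d chi" unfolding dirichlet_character_def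
      using d0 chi_mult chi_nz cop by auto
    then show ?thesis by blast
  next
    case False
    then have cpd: "coprime (int d) (int p)" using p
      by (metis coprime_commute coprime_int_iff prime_imp_coprime)
    obtain u where u: "[u = 1] (mod int d)" "[u = 0] (mod int p)"
      using binary_chinese_remainder_int[OF cpd] by blast
    \<comment> \<open>By the Chinese remainder theorem \<open>lift a\<close> is \<open>a\<close>
      modulo \<open>d\<close> and 1 modulo \<open>p\<close>. The inducing character is
      \<open>chi\<close> after \<open>lift\<close>, which no longer depends on \<open>a\<close>
      modulo \<open>p\<close>.\<close>
    define lift where "lift a = a * u + (1 - u)" for a
    have ld: "[lift a = a] (mod int d)" for a
      using cong_add[OF cong_scalar_left[OF u(1), of a] cong_diff[OF cong_refl[of 1] u(1)]]
      by (simp add: lift_def)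
    have lp: "[lift a = 1] (mod int p)" for a
      using cong_add[OF cong_scalar_left[OF u(2), of a] cong_diff[OF cong_refl[of 1] u(2)]]
      by (simp add: lift_def)
    have both: "[x = y] (mod int q)" if "[x = y] (mod int d)" "[x = y] (mod int p)" for x y
      using coprime_cong_mult[OF that cpd] by (simp add: q)
    have lc: "coprime (lift a) (int q) \<longleftrightarrow> coprime a (int d)" for a
    proof -
      have "coprime (lift a) (int p)" using lp by (metis cong_imp_coprime cong_sym coprime_1_left)
      moreover have "coprime (lift a) (int d) \<longleftrightarrow> coprime a (int d)"
        using ld by (metis cong_imp_coprime cong_sym)
      ultimately show ?thesis by (simp add: q)
    qed
    have lm: "chi (lift (a * b)) = chi (lift a) * chi (lift b)" for a b
    proof -
      have "[lift (a * b) = lift a * lift b] (mod int d)"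
        using ld cong_mult[OF ld[of a] ld[of b]] by (metis cong_sym cong_trans)
      moreover have "[lift (a * b) = lift a * lift b] (mod int p)"
        using lp cong_mult[OF lp[of a] lp[of b]] by (metis cong_sym cong_trans mult_1)
      ultimately show ?thesis using both chi_cong chi_mult by metis
    qed
    have lper: "chi (lift (a + int d)) = chi (lift a)" for a
    proof (intro chi_cong both)
      have "[a + int d = a] (mod int d)" by (simp add: cong_def)
      then show "[lift (a + int d) = lift a] (mod int d)"
        using ld by (metis cong_sym cong_trans)
      show "[lift (a + int d) = lift a] (mod int p)"
        using lp by (metis cong_sym cong_trans)
    qed
    have "dirichlet_character d (\<lambda>a. chi (lift a))"
      unfolding dirichlet_character_def using d0 lm lper lc chi_nz by auto
    moreover have "chi a = chi (lift a)" if a: "coprime a (int q)" for a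
    proof -
      obtain a' where a': "[a * a' = 1] (mod int q)" using inv a by blast
      have a'd: "[a * a' = 1] (mod int d)" using a' q by (metis cong_modulus_mult int_ops(7))
      have 1: "[lift a * a' = 1] (mod int d)"
        using cong_trans[OF cong_scalar_right[OF ld[of a]] a'd] .
      have "coprime a' (int q)" using a' by (metis cong_imp_coprime cong_sym coprime_1_left coprime_mult_left_iff)
      moreover have "coprime (lift a) (int q)" using lc a q by simp
      ultimately have "chi (lift a * a') = 1" using triv[OF 1] by simp
      moreover have "chi (a * a') = 1" using chi_cong[OF a'] chi_one by simp
      ultimately show ?thesis by (metis chi_mult mult_cancel_right mult_zero_right zero_neq_one)
    qed
    ultimately show ?thesis by blast
  qed
  moreover have "d dvd q" using q by simp
  ultimately show False using prim dq unfolding primitive_character_def by blast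
qed

text \<open>If \<open>p ^ 2\<close> divides \<open>q\<close>, the binomial theorem shows that the
  \<open>p\<close>-th power of the witness is 1 modulo \<open>q\<close>, whereas an odd power of its
  value -1 is -1.\<close>

lemma odd_prime_sq_not_dvd:
  assumes p: "prime p" "odd p" shows "\<not> p ^ 2 dvd q"
proof
  assume "p ^ 2 dvd q"
  then obtain e where e: "q = p ^ 2 * e" by blast
  have p0: "p > 0" using p prime_gt_0_nat by blast
  then have d: "q div p = p * e" using e by (simp add: power2_eq_square)
  obtain c where c: "[c = 1] (mod int (p * e))" "X c = -1"
    using primitive_witness[OF p(1)] e d by (metis dvd_mult2 dvd_power dvd_refl zero_less_numeral)
  then obtain k where k: "c = 1 + int (p * e) * k" by (metis cong_iff_lin cong_sym)
  have pow: "\<exists>m. (1 + x) ^ n = 1 + int n * x + x ^ 2 * m" for x :: int and n :: nat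
  proof (induction n)
    case (Suc n)
    then obtain m where "(1 + x) ^ n = 1 + int n * x + x ^ 2 * m" by blast
    then have "(1 + x) ^ Suc n = 1 + int (Suc n) * x + x ^ 2 * (int n + m + x * m)"
      by (simp add: algebra_simps power2_eq_square)
    then show ?case by blast
  qed (auto intro: exI[of _ 0])
  obtain m where "c ^ p = 1 + int p * (int (p * e) * k) + (int (p * e) * k) ^ 2 * m"
    using pow k by metis
  then have "c ^ p = 1 + int q * (k + int e * k ^ 2 * m)"
    by (simp add: e algebra_simps power2_eq_square)
  then have "[c ^ p = 1] (mod int q)" by (simp add: cong_def)
  then have "X c ^ p = 1" using X_cong X_1 X_power by metis
  then show False using c p by simp
qed

text \<open>Modulo \<open>q\<close> only 1 and \<open>1 + q div 2\<close> are congruent to 1 modulo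
  \<open>q div 2\<close>, so the witness must be the second one.\<close>

lemma two_dvd_witness:
  assumes "even q" shows "X (1 + int (q div 2)) = -1"
proof -
  obtain c where c: "[c = 1] (mod int (q div 2))" "X c = -1"
    using primitive_witness[of 2] assms by auto
  then obtain k where k: "c = 1 + int (q div 2) * k" by (metis cong_iff_lin cong_sym)
  have "\<not> even k"
  proof
    assume "even k"
    then obtain j where "k = 2 * j" by blast
    then have "c = 1 + int q * j" using k assms by (auto elim!: evenE)
    then have "[c = 1] (mod int q)" by (simp add: cong_def)
    then show False using c X_cong X_1 by fastforce
  qed
  then obtain j where "k = 2 * j + 1" by (elim oddE)
  then have "c = 1 + int (q div 2) + int q * j" using k assms by (auto elim!: evenE simp: algebra_simps)
  then have "[c = 1 + int (q div 2)] (mod int q)" by (simp add: cong_def)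
  then show ?thesis using c X_cong by fastforce
qed

text \<open>If 16 divides \<open>q\<close>, then \<open>1 + q div 2\<close> is the square of
  \<open>1 + q div 4\<close> modulo \<open>q\<close>, so its value could not be -1.\<close>

lemma not_16_dvd: "\<not> 16 dvd q"
proof
  assume "16 dvd q"
  then obtain e where e: "q = 16 * e" by blast
  have "[1 + int (q div 2) = (1 + int (4 * e)) * (1 + int (4 * e))] (mod int q)"
    unfolding cong_iff_dvd_diff e by (simp add: algebra_simps)
  then have "X (1 + int (q div 2)) = X (1 + int (4 * e)) * X (1 + int (4 * e))"
    using X_cong X_mult by metis
  then show False using two_dvd_witness e zero_le_square[of "X (1 + int (4 * e))"] by simp
qed

text \<open>For \<open>q = 4 * m + 2\<close> the witness \<open>1 + q div 2\<close> would be even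
  and hence not coprime to \<open>q\<close>.\<close>

lemma q_mod_4_ne_2: "q mod 4 \<noteq> 2"
proof
  assume "q mod 4 = 2"
  then obtain m where m: "q = 4 * m + 2" by (metis mult_div_mod_eq)
  have "X (1 + int (q div 2)) = -1" using two_dvd_witness m by simp
  moreover have "X (1 + int (q div 2)) = 0"
    unfolding X_eq_0_iff using m by (auto simp: coprime_iff_gcd_eq_1[symmetric] dest!: coprime_common_divisor[of _ _ 2])
  ultimately show False by simp
qed

end

section \<open>Gauss sums and the values of the character at odd primes\<close>

lemma map_poly_of_int_mult:
  "map_poly of_int (P * Q) = (map_poly of_int P * map_poly of_int Q :: 'a :: comm_ring_1 poly)"
  by (intro poly_eqI) (simp add: coeff_map_poly coeff_mult)

lemma map_poly_of_int_add:
  "map_poly of_int (P + Q) = (map_poly of_int P + map_poly of_int Q :: 'a :: comm_ring_1 poly)"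
  by (intro poly_eqI) (simp add: coeff_map_poly)

lemma map_poly_of_int_power:
  "map_poly of_int (P ^ n) = (map_poly of_int P ^ n :: 'a :: comm_ring_1 poly)"
  by (induction n) (simp_all add: map_poly_of_int_mult)

lemma map_poly_of_int_sum:
  "map_poly of_int (\<Sum>a\<in>A. f a) = (\<Sum>a\<in>A. map_poly of_int (f a) :: 'a :: comm_ring_1 poly)"
  by (induction A rule: infinite_finite_induct) (simp_all add: map_poly_of_int_add)

lemma sum_residues_reindex:
  fixes F :: "int \<Rightarrow> 'a :: comm_monoid_add" and g :: "int \<Rightarrow> int"
  assumes q: "q > 0"
    and F: "\<And>a b. [a = b] (mod q) \<Longrightarrow> F a = F b"
    and g: "\<And>a b. [g a = g b] (mod q) \<Longrightarrow> [a = b] (mod q)"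
  shows "(\<Sum>a\<in>{0..<q}. F (g a)) = (\<Sum>a\<in>{0..<q}. F a)"
proof -
  have inj: "inj_on (\<lambda>a. g a mod q) {0..<q}"
  proof (rule inj_onI)
    fix x y assume "x \<in> {0..<q}" "y \<in> {0..<q}" "g x mod q = g y mod q"
    then show "x = y" using g[of x y] by (simp add: cong_def)
  qed
  have sub: "(\<lambda>a. g a mod q) ` {0..<q} \<subseteq> {0..<q}" using q by auto
  have "(\<lambda>a. g a mod q) ` {0..<q} = {0..<q}"
    using endo_inj_surj[OF _ sub inj] by simp
  then have "(\<Sum>a\<in>{0..<q}. F a) = (\<Sum>a\<in>{0..<q}. F (g a mod q))"
    using sum.reindex[OF inj, of F] by (simp add: o_def)
  also have "\<dots> = (\<Sum>a\<in>{0..<q}. F (g a))"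
    by (intro sum.cong refl F) (simp add: cong_def)
  finally show ?thesis ..
qed

definition unit_root :: "nat \<Rightarrow> int \<Rightarrow> complex" where
  "unit_root q n = cis (2 * pi * of_int n / of_nat q)"

lemma unit_root_add: "unit_root q (m + n) = unit_root q m * unit_root q n"
  by (simp add: unit_root_def cis_mult add_divide_distrib ring_distribs)

lemma unit_root_0 [simp]: "unit_root q 0 = 1"
  by (simp add: unit_root_def)

lemma unit_root_power: "unit_root q n ^ k = unit_root q (n * int k)"
  by (induction k) (simp_all add: unit_root_add[symmetric] algebra_simps)

lemma unit_root_eq_1_iff:
  assumes "q > 0" shows "unit_root q n = 1 \<longleftrightarrow> int q dvd n"
proof
  assume "unit_root q n = 1"
  then have "cos (2 * pi * of_int n / of_nat q) = 1"
    by (metis cis.sel(1) one_complex.sel(1) unit_root_def)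
  then obtain k :: int where "2 * pi * of_int n / of_nat q = k * 2 * pi"
    unfolding cos_one_2pi_int by auto
  then have "(of_int n :: real) = of_int (k * int q)" using assms by (simp add: field_simps)
  then show "int q dvd n" by (metis dvd_triv_right of_int_eq_iff)
next
  assume "int q dvd n"
  then obtain k where "n = int q * k" by blast
  then have "2 * pi * of_int n / of_nat q = 2 * pi * of_int k" using assms by simp
  then show "unit_root q n = 1" by (simp add: unit_root_def)
qed

lemma unit_root_cong:
  assumes "q > 0" "[m = n] (mod int q)" shows "unit_root q m = unit_root q n"
proof -
  obtain k where "n = m + int q * k" using assms(2) by (auto simp: cong_iff_lin)
  then show ?thesis using unit_root_eq_1_iff[OF assms(1), of "int q * k"] by (simp add: unit_root_add)
qed

lemma sum_unit_root:
  assumes q: "q > 0"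
  shows "(\<Sum>n\<in>{0..<int q}. unit_root q (n * k)) = (if int q dvd k then of_nat q else 0)"
proof (cases "int q dvd k")
  case True
  then have "unit_root q (n * k) = 1" for n using unit_root_eq_1_iff[OF q] by simp
  then show ?thesis using True by simp
next
  case False
  let ?S = "\<Sum>n\<in>{0..<int q}. unit_root q (n * k)"
  have "?S = (\<Sum>n\<in>{0..<int q}. unit_root q ((n + 1) * k))"
  proof (rule sum_residues_reindex[symmetric, where F = "\<lambda>n. unit_root q (n * k)"])
    show "unit_root q (a * k) = unit_root q (b * k)" if "[a = b] (mod int q)" for a b
      using that by (intro unit_root_cong[OF q] cong_scalar_right)
  qed (use q in \<open>auto simp: cong_add_rcancel\<close>)
  also have "\<dots> = ?S * unit_root q k"
    by (simp add: unit_root_add ring_distribs sum_distrib_right)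
  finally have "?S * (unit_root q k - 1) = 0" by (simp add: algebra_simps)
  then show ?thesis using False unit_root_eq_1_iff[OF q] by simp
qed

context odd_real_character
begin

abbreviation "e \<equiv> unit_root q"

definition gauss :: "int \<Rightarrow> complex" where
  "gauss n = (\<Sum>a\<in>{0..<int q}. chi a * e (a * n))"

lemma gauss_shift:
  assumes c: "coprime c (int q)"
  shows "gauss n = chi c * gauss (c * n)"
proof -
  have "gauss n = (\<Sum>a\<in>{0..<int q}. chi (c * a) * e (c * a * n))"
    unfolding gauss_def
  proof (rule sum_residues_reindex[symmetric, where F = "\<lambda>a. chi a * e (a * n)"])
    show "chi a * e (a * n) = chi b * e (b * n)" if "[a = b] (mod int q)" for a b
      using chi_cong[OF that] unit_root_cong[OF q_pos cong_scalar_right[OF that, of n]] by simp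
    show "[a = b] (mod int q)" if "[c * a = c * b] (mod int q)" for a b
      using that c cong_mult_lcancel[of c "int q" a b] by simp
  qed (use q_pos in simp)
  then show ?thesis
    by (simp add: gauss_def chi_mult sum_distrib_left mult_ac)
qed

lemma chi_sq: "coprime c (int q) \<Longrightarrow> chi c * chi c = 1"
  using chi_cases[of c] by auto

lemma gauss_cong: "[m = n] (mod int q) \<Longrightarrow> gauss m = gauss n"
  unfolding gauss_def
  by (intro sum.cong refl arg_cong2[where f = "(*)"] unit_root_cong q_pos cong_scalar_left)

text \<open>If a prime \<open>r\<close> divides both \<open>n\<close> and \<open>q\<close>, the
  witness \<open>c\<close> for \<open>r\<close> satisfies \<open>c * n = n\<close> modulo
  \<open>q\<close>, so that shifting by \<open>c\<close> changes only the sign of the sum and the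
  sum vanishes. This is where primitivity enters the theory of Gauss sums.\<close>

lemma gauss_eq: "gauss n = chi n * gauss 1"
proof (cases "coprime n (int q)")
  case True
  show ?thesis using gauss_shift[OF True, of 1] chi_sq[OF True] by (simp add: mult.assoc[symmetric])
next
  case False
  then have "nat (gcd n (int q)) \<noteq> 1"
    by (metis coprime_iff_gcd_eq_1 gcd_ge_0_int int_nat_eq of_nat_1)
  then obtain r where r: "prime r" and rg: "r dvd nat (gcd n (int q))"
    using prime_factor_nat by blast
  then have "int r dvd gcd n (int q)" by (metis gcd_ge_0_int int_dvd_int_iff int_nat_eq)
  then have rn: "int r dvd n" and rq: "r dvd q" by auto
  obtain c where c: "[c = 1] (mod int (q div r))" "coprime c (int q)" "X c = -1"
    using primitive_witness[OF r rq] by blast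
  obtain k where k: "n = int r * k" using rn by blast
  have "int q = int r * int (q div r)" using rq by (metis dvd_mult_div_cancel of_nat_mult)
  moreover have "[int r * c = int r * 1] (mod int r * int (q div r))"
    using c(1) by (metis cong_cmult_leftI)
  ultimately have "[int r * c * k = int r * k] (mod int q)"
    by (metis cong_scalar_right mult.right_neutral)
  then have "[c * n = n] (mod int q)" by (simp add: k mult_ac)
  then have "gauss n = chi c * gauss n" using gauss_shift[OF c(2), of n] gauss_cong by metis
  moreover have "chi c = -1" using c(3) X_chi[of c] by simp
  ultimately have "gauss n = 0" by simp
  moreover have "chi n = 0" using False chi_nz[of n] by blast
  ultimately show ?thesis by simp
qed

lemma sum_chi_unit_root_m1: "(\<Sum>n\<in>{0..<int q}. chi n * e (-n)) = - gauss 1"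
proof -
  have "(\<Sum>n\<in>{0..<int q}. chi n * e (-n)) = gauss (-1)" by (simp add: gauss_def)
  then show ?thesis using gauss_eq[of "-1"] odd by simp
qed

text \<open>Fourier inversion at 1 gives \<open>q\<close>, while \<open>gauss_eq\<close> turns the
  same sum into \<open>gauss 1 * gauss (-1)\<close>. The minus sign is the oddness of
  \<open>chi\<close>.\<close>

lemma gauss_sq: "gauss 1 ^ 2 = - of_nat q"
proof -
  have "(\<Sum>n\<in>{0..<int q}. gauss n * e (-n)) =
      (\<Sum>n\<in>{0..<int q}. \<Sum>a\<in>{0..<int q}. chi a * e (n * (a - 1)))"
    unfolding gauss_def sum_distrib_right
    by (intro sum.cong refl) (simp add: mult.assoc unit_root_add[symmetric] algebra_simps)
  also have "\<dots> = (\<Sum>a\<in>{0..<int q}. chi a * (\<Sum>n\<in>{0..<int q}. e (n * (a - 1))))"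
    by (subst sum.swap) (simp add: sum_distrib_left)
  also have "\<dots> = (\<Sum>a\<in>{0..<int q}. if a = 1 then of_nat q else 0)"
  proof (rule sum.cong[OF refl])
    fix a assume a: "a \<in> {0..<int q}"
    have "int q dvd a - 1 \<longleftrightarrow> a = 1"
    proof
      assume "int q dvd a - 1"
      then have "[a = 1] (mod int q)" by (simp add: cong_iff_dvd_diff)
      then show "a = 1" using a q_ge_3 by (intro cong_less_imp_eq_int) auto
    qed auto
    then show "chi a * (\<Sum>n\<in>{0..<int q}. e (n * (a - 1))) = (if a = 1 then of_nat q else 0)"
      by (simp add: sum_unit_root[OF q_pos] chi_one)
  qed
  also have "\<dots> = of_nat q" using q_ge_3 by simp
  also have "(\<Sum>n\<in>{0..<int q}. gauss n * e (-n)) = gauss 1 * (\<Sum>n\<in>{0..<int q}. chi n * e (-n))"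
    by (subst gauss_eq) (simp add: sum_distrib_left mult_ac)
  finally show ?thesis by (simp add: sum_chi_unit_root_m1 power2_eq_square minus_equation_iff)
qed

text \<open>\<open>fourier_coeff P / q\<close> is the sum of the coefficients of \<open>P\<close> with index \<open>\<equiv> 1 (mod q)\<close>, i.e.\ the
  coefficient of \<open>x\<close> in the image of \<open>P\<close> in the group ring \<open>\<int>[x] / (x\<^sup>q - 1)\<close>. Working in the group
  ring avoids the arithmetic of cyclotomic integers.\<close>

definition fourier_coeff :: "int poly \<Rightarrow> complex" where
  "fourier_coeff P = (\<Sum>n\<in>{0..<int q}. poly (map_poly of_int P) (e n) * e (-n))"

lemma fourier_coeff_add: "fourier_coeff (P + Q) = fourier_coeff P + fourier_coeff Q"
  by (simp add: fourier_coeff_def map_poly_of_int_add ring_distribs sum.distrib)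

lemma fourier_coeff_sum: "fourier_coeff (\<Sum>a\<in>A. f a) = (\<Sum>a\<in>A. fourier_coeff (f a))"
  by (induction A rule: infinite_finite_induct) (simp_all add: fourier_coeff_add, simp_all add: fourier_coeff_def)

lemma fourier_coeff_monom:
  "fourier_coeff (Polynomial.monom c k) = (if int q dvd int k - 1 then of_int c * of_nat q else 0)"
proof -
  have "fourier_coeff (Polynomial.monom c k) = of_int c * (\<Sum>n\<in>{0..<int q}. e (n * (int k - 1)))"
    by (simp add: fourier_coeff_def map_poly_monom poly_monom unit_root_power mult.assoc
        unit_root_add[symmetric] sum_distrib_left algebra_simps)
  then show ?thesis by (simp add: sum_unit_root[OF q_pos])
qed

lemma fourier_coeff_int: "\<exists>m::int. fourier_coeff P = of_nat q * of_int m"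
proof -
  have "fourier_coeff P = (\<Sum>k\<le>degree P. fourier_coeff (Polynomial.monom (Polynomial.coeff P k) k))"
    by (subst poly_as_sum_of_monoms[of P, symmetric]) (rule fourier_coeff_sum)
  also have "\<dots> = of_nat q * of_int (\<Sum>k\<le>degree P. if int q dvd int k - 1 then Polynomial.coeff P k else 0)"
    by (simp add: fourier_coeff_monom sum_distrib_left if_distrib mult_ac cong: if_cong)
  finally show ?thesis by blast
qed

text \<open>The \<open>p\<close>-th power of the Gauss sum is evaluated twice: exactly, by means of
  its square \<open>-q\<close>, and modulo \<open>p\<close>, by the Frobenius map. Comparing Fourier
  coefficients gives a congruence between integers, and Euler's criterion identifies the power of
  \<open>-q\<close>.\<close>

theorem X_eq_Legendre:
  assumes p: "prime p" "odd p" "\<not> p dvd q"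
  shows "X (int p) = Legendre (- int q) (int p)"
proof -
  \<comment> \<open>The polynomial takes at every \<open>q\<close>-th root of unity
    \<open>e n\<close> the value of the Gauss sum at \<open>n\<close>.\<close>
  define T where "T = (\<Sum>a\<in>{0..<int q}. Polynomial.monom (X a) (nat a))"
  have T_ev: "poly (map_poly of_int T) (e n) = chi n * gauss 1" for n
  proof -
    have "poly (map_poly of_int T) (e n) = (\<Sum>a\<in>{0..<int q}. chi a * e (n * a))"
      by (simp add: T_def map_poly_of_int_sum poly_sum map_poly_monom poly_monom X_chi unit_root_power)
    then show ?thesis using gauss_eq[of n] by (simp add: gauss_def mult.commute)
  qed
  have p2: "p > 2" using p prime_ge_2_nat[of p] by (cases "p = 2") auto
  define r where "r = (p - 1) div 2"
  have pr: "p = Suc (2 * r)" using p by (auto simp: r_def elim!: oddE)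
  have chi_p: "chi n ^ p = chi n" for n
  proof (cases "coprime n (int q)")
    case False
    then show ?thesis using chi_nz[of n] p2 by simp
  next
    case True
    then show ?thesis using chi_cases[of n] p by auto
  qed
  have cpq: "coprime (int p) (int q)" using p by (simp add: prime_imp_coprime)
  have "fourier_coeff (T ^ p) = gauss 1 ^ p * (\<Sum>n\<in>{0..<int q}. chi n * e (-n))"
    by (simp add: fourier_coeff_def map_poly_of_int_power T_ev power_mult_distrib chi_p
        sum_distrib_left mult_ac)
  also have "\<dots> = - (gauss 1 ^ (2 * Suc r))"
    by (simp add: sum_chi_unit_root_m1 pr)
  also have "\<dots> = of_nat q * of_int ((- int q) ^ r)"
    by (simp only: power_mult gauss_sq) simp
  finally have 1: "fourier_coeff (T ^ p) = of_nat q * of_int ((- int q) ^ r)" .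
  \<comment> \<open>Frobenius: up to a multiple of \<open>p\<close>, the power of the sum is the sum
    of the powers.\<close>
  obtain R where R: "T ^ p = (\<Sum>a\<in>{0..<int q}. Polynomial.monom (X a) (nat a) ^ p) + of_nat p * R"
    unfolding T_def using frobenius_sum[OF p(1)] by blast
  obtain m where m: "fourier_coeff R = of_nat q * of_int m" using fourier_coeff_int by blast
  have Xp: "X a ^ p = X a" for a
    using chi_p[of a] X_chi[of a] by (metis of_int_eq_iff of_int_power)
  have "fourier_coeff (\<Sum>a\<in>{0..<int q}. Polynomial.monom (X a) (nat a) ^ p) =
      (\<Sum>a\<in>{0..<int q}. if int q dvd a * int p - 1 then of_int (X a) * of_nat q else 0)"
    by (simp add: fourier_coeff_sum monom_power fourier_coeff_monom Xp)
  also obtain b where b: "[int p * b = 1] (mod int q)" using cong_solve_coprime_int cpq by blast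
  \<comment> \<open>Only the exponent \<open>a * p\<close> congruent to 1 modulo \<open>q\<close>
    survives, i.e. the inverse of \<open>p\<close>. Its value under \<open>X\<close> equals that of
    \<open>p\<close> because both are 1 or -1 with product 1.\<close>
  define b' where "b' = b mod int q"
  have b': "b' \<in> {0..<int q}" "[int p * b' = 1] (mod int q)"
    using b q_pos by (auto simp: b'_def cong_def mod_mult_right_eq)
  have "(\<Sum>a\<in>{0..<int q}. if int q dvd a * int p - 1 then of_int (X a) * of_nat q else 0) =
      (\<Sum>a\<in>{0..<int q}. if a = b' then of_int (X a) * of_nat q else (0::complex))"
  proof (rule sum.cong[OF refl])
    fix a assume a: "a \<in> {0..<int q}"
    have "int q dvd a * int p - 1 \<longleftrightarrow> a = b'"
    proof
      assume "int q dvd a * int p - 1"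
      then have "[int p * a = int p * b'] (mod int q)"
        using b' by (metis cong_iff_dvd_diff cong_sym cong_trans mult.commute)
      then have "[a = b'] (mod int q)" using cpq by (simp add: cong_mult_lcancel)
      then show "a = b'" using a b' by (intro cong_less_imp_eq_int) auto
    next
      assume "a = b'"
      then show "int q dvd a * int p - 1" using b'(2) by (simp add: cong_iff_dvd_diff mult.commute)
    qed
    then show "(if int q dvd a * int p - 1 then of_int (X a) * of_nat q else 0) =
        (if a = b' then of_int (X a) * of_nat q else (0::complex))" by simp
  qed
  also have "\<dots> = of_nat q * of_int (X b')" using b'(1) by simp
  finally have 2: "fourier_coeff (\<Sum>a\<in>{0..<int q}. Polynomial.monom (X a) (nat a) ^ p) = of_nat q * of_int (X b')" .
  have "X (int p) * X b' = 1" using X_cong[OF b'(2)] by (simp add: X_mult X_1)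
  then have Xb: "X b' = X (int p)" using X_cases[OF cpq] by auto
  have 3: "fourier_coeff (of_nat p * R) = of_nat q * of_int (int p * m)"
  proof -
    have "of_nat p * R = (\<Sum>i<p. R)" by simp
    then show ?thesis using m by (simp only: fourier_coeff_sum) simp
  qed
  have "(of_nat q :: complex) * of_int ((- int q) ^ r) = of_nat q * of_int (X (int p) + int p * m)"
    using 1 2 3 R Xb by (simp add: fourier_coeff_add ring_distribs)
  then have "(of_nat q :: complex) * (of_int ((- int q) ^ r) - of_int (X (int p) + int p * m)) = 0"
    by (simp only: right_diff_distrib) simp
  moreover have "(of_nat q :: complex) \<noteq> 0" using q_pos by simp
  ultimately have "of_int ((- int q) ^ r) - of_int (X (int p) + int p * m) = (0 :: complex)"
    unfolding mult_eq_0_iff by blast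
  then have "(- int q) ^ r = X (int p) + int p * m"
    unfolding right_minus_eq of_int_eq_iff .
  then have "[X (int p) = (- int q) ^ r] (mod int p)" by (simp add: cong_def)
  moreover have "[Legendre (- int q) (int p) = (- int q) ^ r] (mod int p)"
    using euler_criterion[OF p(1) p2, of "- int q"] by (simp add: r_def)
  ultimately have c: "[X (int p) = Legendre (- int q) (int p)] (mod int p)"
    by (metis cong_sym cong_trans)
  have "\<bar>X (int p)\<bar> \<le> 1" "\<bar>Legendre (- int q) (int p)\<bar> \<le> 1"
    by (auto simp: X_def Legendre_def)
  then have "\<bar>X (int p) - Legendre (- int q) (int p)\<bar> < int p" using p2 by linarith
  moreover have "int p dvd X (int p) - Legendre (- int q) (int p)" using c by (simp add: cong_iff_dvd_diff)
  ultimately have "X (int p) - Legendre (- int q) (int p) = 0"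
    using dvd_imp_le_int[of "X (int p) - Legendre (- int q) (int p)" "int p"] by linarith
  then show ?thesis by simp
qed

end

section \<open>The residue of the modulus modulo powers of 2 and the value of the character at
  2\<close>

definition sign_m2 :: "int \<Rightarrow> int" where
  "sign_m2 n = (if n mod 8 = 1 \<or> n mod 8 = 3 then 1 else if n mod 8 = 5 \<or> n mod 8 = 7 then -1 else 0)"

lemma odd_mod_8: "odd (n::int) \<Longrightarrow> n mod 8 = 1 \<or> n mod 8 = 3 \<or> n mod 8 = 5 \<or> n mod 8 = 7"
  by presburger

lemma sign_m2_mult: "sign_m2 (a * b) = sign_m2 a * sign_m2 b"
proof (cases "odd a \<and> odd b")
  case True
  define x y where "x = a mod 8" and "y = b mod 8"
  have red: "sign_m2 n = sign_m2 (n mod 8)" for n by (simp add: sign_m2_def)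
  have "sign_m2 (x * y) = sign_m2 x * sign_m2 y"
    if "x = 1 \<or> x = 3 \<or> x = 5 \<or> x = 7" "y = 1 \<or> y = 3 \<or> y = 5 \<or> y = 7" for x y
    using that by (elim disjE) (simp_all add: sign_m2_def)
  moreover have "x = 1 \<or> x = 3 \<or> x = 5 \<or> x = 7" "y = 1 \<or> y = 3 \<or> y = 5 \<or> y = 7"
    using True odd_mod_8 unfolding x_def y_def by blast+
  ultimately have "sign_m2 (x * y) = sign_m2 x * sign_m2 y" by blast
  then show ?thesis unfolding x_def y_def red[of "a mod 8 * (b mod 8)"] mod_mult_eq
    by (simp only: red[symmetric])
next
  case False
  then have "even (a * b)" by auto
  moreover have "sign_m2 c = 0" if "even c" for c using that unfolding sign_m2_def by presburger
  ultimately show ?thesis using False by auto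
qed

text \<open>\<open>sign_m2\<close> is the Kronecker symbol of discriminant -8. It is primitive
  because every proper divisor of 8 divides 4, while its values at 1 and 5 differ.\<close>

lemma odd_real_character_m8: "odd_real_character 8 (\<lambda>a. of_int (sign_m2 a))"
proof
  have dc: "dirichlet_character 8 (\<lambda>a. of_int (sign_m2 a))"
    unfolding dirichlet_character_def
  proof (intro conjI allI)
    fix a b :: int
    show "(of_int (sign_m2 (a * b)) :: complex) = of_int (sign_m2 a) * of_int (sign_m2 b)"
      by (simp add: sign_m2_mult)
    show "(of_int (sign_m2 (a + int 8)) :: complex) = of_int (sign_m2 a)" by (simp add: sign_m2_def)
    have "coprime a (int 8) \<longleftrightarrow> odd a"
      using coprime_power_right_iff[of a 2 3] by simp
    moreover have "odd a \<longleftrightarrow> sign_m2 a \<noteq> 0"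
      using odd_mod_8[of a] unfolding sign_m2_def by presburger
    ultimately show "(of_int (sign_m2 a) :: complex) \<noteq> 0 \<longleftrightarrow> coprime a (int 8)" by simp
  qed simp
  have "False" if d: "d dvd 8" "d < 8" "dirichlet_character d \<psi>"
    "\<forall>a. coprime a (int 8) \<longrightarrow> of_int (sign_m2 a) = \<psi> a" for d \<psi>
  proof -
    have "d dvd 4"
    proof -
      have "d \<in> {0,1,2,3,4,5,6,7}" using d(2) by auto
      then show ?thesis using d(1) by auto
    qed
    then obtain k where k: "4 = d * k" by blast
    have per: "\<psi> (1 + int d * int j) = \<psi> 1" for j
    proof (induction j)
      case (Suc j)
      have "\<psi> ((1 + int d * int j) + int d) = \<psi> (1 + int d * int j)"
        using d(3) by (simp add: dirichlet_character_def)
      then show ?case using Suc by (simp add: algebra_simps)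
    qed simp
    have "int d * int k = 4" using k by (metis of_nat_mult of_nat_numeral)
    then have "\<psi> 5 = \<psi> 1" using per[of k] by simp
    moreover have "coprime 5 (int 8)" "coprime 1 (int 8)"
      using coprime_power_right_iff[of "5::int" 2 3] by simp_all
    then have "of_int (sign_m2 5) = \<psi> 5" "of_int (sign_m2 1) = \<psi> 1" using d(4) by blast+
    ultimately show False by (simp add: sign_m2_def)
  qed
  then show "primitive_character 8 (\<lambda>a. of_int (sign_m2 a))"
    unfolding primitive_character_def using dc by blast
qed (simp_all add: real_character_def sign_m2_def)

lemma QuadRes_transfer:
  assumes p: "prime (p::nat)" and c: "coprime c (int p)" and ab: "[a = b * c ^ 2] (mod int p)"
  shows "Legendre a (int p) = Legendre b (int p)"
proof -
  obtain d where d: "[c * d = 1] (mod int p)" using cong_solve_coprime_int c by blast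
  have ba: "[b = a * d ^ 2] (mod int p)"
  proof -
    have "[a * d ^ 2 = b * (c * d) ^ 2] (mod int p)"
      using cong_scalar_right[OF ab, of "d ^ 2"] by (simp add: power_mult_distrib mult_ac)
    moreover have "[b * (c * d) ^ 2 = b * 1 ^ 2] (mod int p)" by (intro cong_scalar_left cong_pow d)
    ultimately show ?thesis by (metis cong_sym cong_trans mult.right_neutral one_power2)
  qed
  have zero: "[y = 0] (mod int p)" if "[y = x * k] (mod int p)" "[x = 0] (mod int p)" for x y k
    using that by (metis cong_scalar_right cong_trans mult_zero_left)
  have res: "QuadRes (int p) y" if yx: "[y = x * k ^ 2] (mod int p)" and qr: "QuadRes (int p) x" for x y k
  proof -
    obtain z where "[z ^ 2 = x] (mod int p)" using qr unfolding QuadRes_def by blast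
    then have "[(z * k) ^ 2 = x * k ^ 2] (mod int p)" by (simp add: power_mult_distrib cong_scalar_right)
    then show ?thesis unfolding QuadRes_def using yx cong_sym cong_trans by blast
  qed
  have "[a = 0] (mod int p) \<longleftrightarrow> [b = 0] (mod int p)" using zero[OF ab] zero[OF ba] by blast
  moreover have "QuadRes (int p) a \<longleftrightarrow> QuadRes (int p) b" using res[OF ab] res[OF ba] by blast
  ultimately show ?thesis by (simp add: Legendre_def)
qed

lemma coprime_2_odd_prime: "prime (p::nat) \<Longrightarrow> odd p \<Longrightarrow> coprime 2 (int p)"
  by simp

text \<open>The theorem on odd primes applied to the character modulo 8, since -8 and -2 differ by a
  square. This supplies the supplementary law for -2.\<close>

lemma Legendre_m2:
  assumes p: "prime p" "odd p"
  shows "Legendre (-2) (int p) = sign_m2 (int p)"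
proof -
  interpret odd_real_character 8 "\<lambda>a. of_int (sign_m2 a)" by (rule odd_real_character_m8)
  have p8: "\<not> p dvd 8"
  proof
    assume "p dvd 8"
    then have "p dvd 2 ^ 3" by simp
    then have "p dvd 2" using p prime_dvd_power by blast
    then show False using p primes_dvd_imp_eq two_is_prime_nat by blast
  qed
  have "X (int p) = Legendre (- int 8) (int p)" using X_eq_Legendre[OF p p8] .
  also have "\<dots> = Legendre (-2) (int p)"
    using coprime_2_odd_prime[OF p] by (intro QuadRes_transfer[OF p(1), of 2]) auto
  finally show ?thesis by (metis X_chi of_int_eq_iff)
qed

context odd_real_character
begin

text \<open>At each prime factor of \<open>n\<close> the two values agree, because \<open>-q\<close>
  and -2 differ by a square there. Choosing an \<open>n\<close> whose residues modulo
  \<open>q\<close> and modulo 8 are both visible then links the character to \<open>q\<close> modulo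
  8.\<close>

lemma X_eq_sign_m2:
  assumes "n > 0" "odd n" "coprime n q" "coprime c (int n)" "[- int q = -2 * c ^ 2] (mod int n)"
  shows "X (int n) = sign_m2 (int n)"
  using assms
proof (induction n rule: less_induct)
  case (less n)
  show ?case
  proof (cases "n = 1")
    case False
    then obtain p where p: "prime p" "p dvd n" using prime_factor_nat by blast
    then obtain m where m: "n = p * m" by blast
    have m0: "m > 0" "m < n" using less.prems m prime_gt_1_nat[OF p(1)] by (auto intro!: Nat.gr0I)
    have cong: "[- int q = -2 * c ^ 2] (mod int p)" "[- int q = -2 * c ^ 2] (mod int m)"
      using less.prems(5) cong_modulus_mult[of _ _ "int p" "int m"] cong_modulus_mult[of _ _ "int m" "int p"]
      unfolding m of_nat_mult by (blast, metis mult.commute)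
    have po: "odd p" using less.prems m by auto
    have "\<not> p dvd q" using coprime_common_divisor_nat[OF less.prems(3) p(2)] p(1) by auto
    then have "X (int p) = Legendre (- int q) (int p)" by (intro X_eq_Legendre p po)
    also have "\<dots> = Legendre (-2) (int p)"
      using less.prems(4) m by (intro QuadRes_transfer[OF p(1) _ cong(1)]) auto
    finally have "X (int p) = sign_m2 (int p)" by (simp add: Legendre_m2[OF p(1) po])
    moreover have "X (int m) = sign_m2 (int m)"
      using less.prems m cong m0 by (intro less.IH) auto
    ultimately show ?thesis by (simp add: m X_mult sign_m2_mult)
  qed (simp add: X_1 sign_m2_def)
qed

text \<open>The auxiliary integer is \<open>n = 2 * q - 1\<close>. It is -1 modulo \<open>q\<close>,
  and modulo \<open>n\<close> one has \<open>q = 2 * q ^ 2\<close>; so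
  \<open>sign_m2 n = -1\<close>, which restricts \<open>q\<close> modulo 4.\<close>

lemma q_mod_4_odd: assumes "odd q" shows "q mod 4 = 3"
proof -
  define n where "n = 2 * q - 1"
  have n: "int n = 2 * int q - 1" "n > 0" "odd n" using q_pos by (auto simp: n_def of_nat_diff)
  have cop: "coprime (int q) (int n)"
  proof -
    have "gcd (int q) (int n) dvd 2 * int q - int n" by (intro dvd_diff dvd_mult) auto
    then show ?thesis using n(1) by (simp add: coprime_iff_gcd_eq_1)
  qed
  have "[- int q = -2 * int q ^ 2] (mod int n)"
    unfolding cong_iff_dvd_diff n(1) by (intro dvdI[of _ _ "int q"]) (simp add: algebra_simps power2_eq_square)
  then have "X (int n) = sign_m2 (int n)"
    by (intro X_eq_sign_m2[where c = "int q"] n(2,3)) (use cop in \<open>simp_all add: coprime_commute\<close>)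
  moreover have "[int n = -1] (mod int q)" unfolding cong_iff_dvd_diff n(1) by simp
  then have "X (int n) = -1" using X_cong X_m1 by metis
  ultimately have "(2 * int q - 1) mod 8 = 5 \<or> (2 * int q - 1) mod 8 = 7"
    using n(1) by (auto simp: sign_m2_def split: if_splits)
  then have "int q mod 4 = 3 \<or> even (int q)" by presburger
  then have "int q mod 4 = 3" using assms by simp
  then show ?thesis by presburger
qed

text \<open>The auxiliary integer is \<open>n = q - 2\<close>, which is -2 modulo \<open>q\<close>
  and modulo which \<open>q\<close> is 2. Thus \<open>X 2\<close> is the negative of
  \<open>sign_m2 n\<close>.\<close>

lemma X_2: assumes "odd q" shows "X 2 = (if q mod 8 = 7 then 1 else -1)"
proof -
  define n where "n = q - 2"
  have n: "int n = int q - 2" "n > 0" "odd n" using q_ge_3 assms by (auto simp: n_def)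
  have cop: "coprime (int n) (int q)"
  proof -
    have "gcd (int n) (int q) dvd int q - int n" by (intro dvd_diff) auto
    then have g2: "gcd (int n) (int q) dvd 2" using n(1) by simp
    have odd_le_2: "x = 1" if "odd x" "x \<le> 2" "x \<ge> 0" for x :: int using that by presburger
    have "gcd (int n) (int q) = 1"
    proof (rule odd_le_2)
      show "odd (gcd (int n) (int q))" using assms by auto
      show "gcd (int n) (int q) \<le> 2" using g2 by (intro zdvd_imp_le) auto
    qed simp
    then show ?thesis by (simp only: coprime_iff_gcd_eq_1)
  qed
  have "[- int q = -2 * 1 ^ 2] (mod int n)"
    unfolding cong_iff_dvd_diff n(1) by (intro dvdI[of _ _ "-1"]) simp
  then have "X (int n) = sign_m2 (int n)"
    by (intro X_eq_sign_m2[where c = 1] n(2,3)) (use cop in \<open>simp_all add: coprime_commute\<close>)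
  moreover have "[int n = (-1) * 2] (mod int q)" unfolding cong_iff_dvd_diff n(1) by simp
  then have "X (int n) = - X 2" using X_cong X_m1 X_mult by (metis mult_minus1)
  ultimately have "X 2 = - sign_m2 (int q - 2)" using n(1) by simp
  moreover have "q mod 8 = 3 \<or> q mod 8 = 7" using q_mod_4_odd[OF assms] by presburger
  then have "(q mod 8 = 3 \<and> (int q - 2) mod 8 = 1) \<or> (q mod 8 = 7 \<and> (int q - 2) mod 8 = 5)" by presburger
  ultimately show ?thesis by (auto simp: sign_m2_def)
qed

text \<open>With \<open>q = 4 * m\<close> the auxiliary integer is \<open>n = 2 * m - 1\<close>:
  modulo \<open>n\<close> one has \<open>q = 2\<close>, and modulo \<open>q\<close> it is the
  negative of \<open>1 + q div 2\<close>, so its value is the product of two values -1.\<close>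

lemma q_div_4_odd: assumes "even q" "odd (q div 4)" shows "q div 4 mod 4 = 1"
proof -
  have "4 dvd q" using assms(1) q_mod_4_ne_2 by presburger
  then obtain m where m: "q = 4 * m" by blast
  have mo: "odd m" using assms m by simp
  then have mp: "m > 0" by (auto intro!: Nat.gr0I)
  define n where "n = 2 * m - 1"
  have n: "int n = 2 * int m - 1" "n > 0" "odd n" using mp by (auto simp: n_def)
  have cop: "coprime (int n) (int q)"
  proof -
    have "gcd (int n) (int m) dvd 2 * int m - int n" by (intro dvd_diff dvd_mult) auto
    then have "coprime (int n) (int m)" using n(1) by (simp add: coprime_iff_gcd_eq_1)
    moreover have "coprime (int n) (2 ^ 2)" using n(3) by (simp only: coprime_power_right_iff) simp
    ultimately show ?thesis unfolding m by simp
  qed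
  have "[- int q = -2 * 1 ^ 2] (mod int n)"
    unfolding cong_iff_dvd_diff n(1) m by (intro dvdI[of _ _ "-2"]) simp
  then have "X (int n) = sign_m2 (int n)"
    by (intro X_eq_sign_m2[where c = 1] n(2,3)) (use cop in \<open>simp_all add: coprime_commute\<close>)
  moreover have "[int n = (-1) * (1 + int (q div 2))] (mod int q)"
    unfolding cong_iff_dvd_diff n(1) m by simp
  then have "X (int n) = X (-1) * X (1 + int (q div 2))" using X_cong X_mult by metis
  then have "X (int n) = 1" by (simp add: X_m1 two_dvd_witness[OF assms(1)])
  ultimately have "(2 * int m - 1) mod 8 = 1 \<or> (2 * int m - 1) mod 8 = 3"
    using n(1) by (auto simp: sign_m2_def split: if_splits)
  then have "m mod 4 = 1" using mo by presburger
  then show ?thesis using m by simp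
qed

end

section \<open>Roots of the norm form\<close>

text \<open>The case \<open>e = 1\<close> describes the divisors of \<open>n\<close>, the case \<open>e = 2\<close> its square divisors.\<close>

lemma bij_betw_power_divisors:
  assumes "coprime m n" "m > 0" "n > 0" "e > 0"
  shows "bij_betw (\<lambda>(c, d). c * d) ({c. c ^ e dvd m} \<times> {d. d ^ e dvd n}) {d. d ^ e dvd m * (n::nat)}"
  unfolding bij_betw_def
proof (intro conjI inj_onI equalityI subsetI)
  have cop: "coprime c d" if "c ^ e dvd m" "d ^ e dvd n" for c d
    using that assms by (metis coprime_divisors coprime_power_left_iff coprime_power_right_iff less_irrefl)
  have gcd: "gcd (c * d) m = c" if "c ^ e dvd m" "d ^ e dvd n" for c d
  proof -
    have "coprime d m" using that assms
      by (metis coprime_commute coprime_divisors coprime_power_left_iff dvd_refl less_irrefl)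
    then have "gcd (c * d) m = gcd c m" by (metis gcd_mult_right_right_cancel coprime_commute gcd.commute)
    also have "\<dots> = c" using that assms by (metis dvd_power dvd_trans gcd_nat.absorb1)
    finally show ?thesis .
  qed
  fix x y assume xy: "x \<in> {c. c ^ e dvd m} \<times> {d. d ^ e dvd n}" "y \<in> {c. c ^ e dvd m} \<times> {d. d ^ e dvd n}"
    "(\<lambda>(c, d). c * d) x = (\<lambda>(c, d). c * d) y"
  then have "fst x = fst y" using gcd by (auto simp: case_prod_beta) metis
  moreover have "fst x > 0" using xy assms by (auto intro!: Nat.gr0I simp: power_0_left)
  ultimately show "x = y" using xy by (auto simp: case_prod_beta prod_eq_iff)
next
  fix d assume "d \<in> (\<lambda>(c, d). c * d) ` ({c. c ^ e dvd m} \<times> {d. d ^ e dvd n})"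
  then show "d \<in> {d. d ^ e dvd m * n}" by (auto simp: power_mult_distrib mult_dvd_mono)
next
  fix d assume "d \<in> {d. d ^ e dvd m * n}"
  then have d: "d ^ e dvd m * n" by simp
  have "d dvd m * n" using d assms by (meson dvd_power dvd_trans)
  then obtain c c' where c: "d = c * c'" "c dvd m" "c' dvd n" using division_decomp by blast
  moreover have "coprime (c ^ e) n" "coprime (c' ^ e) m"
    using assms c by (meson coprime_commute coprime_divisors coprime_power_left_iff dvd_refl)+
  moreover have "c ^ e dvd m * n" "c' ^ e dvd m * n" using d calculation(1)
    by (metis dvd_mult_left dvd_mult_right power_mult_distrib)+
  ultimately have "c ^ e dvd m" "c' ^ e dvd n" by (auto simp: coprime_dvd_mult_left_iff coprime_dvd_mult_right_iff)
  then show "d \<in> (\<lambda>(c, d). c * d) ` ({c. c ^ e dvd m} \<times> {d. d ^ e dvd n})"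
    using \<open>d = c * c'\<close> by (intro image_eqI[of _ _ "(c, c')"]) auto
qed

lemma finite_power_divisors: "n > 0 \<Longrightarrow> e > 0 \<Longrightarrow> finite {d::nat. d ^ e dvd n}"
  by (rule finite_subset[of _ "{d. d dvd n}"]) (auto intro: dvd_trans[OF dvd_power])

lemma power_divisors_prime_power:
  assumes "prime (p::nat)" "e > 0"
  shows "{d. d ^ e dvd p ^ k} = (\<lambda>j. p ^ j) ` {..k div e}"
proof (intro equalityI subsetI)
  fix d assume "d \<in> {d. d ^ e dvd p ^ k}"
  then have d: "d ^ e dvd p ^ k" by simp
  then have "d dvd p ^ k" using assms by (meson dvd_power dvd_trans)
  then obtain j where j: "d = p ^ j" using assms divides_primepow_nat by blast
  then have "j * e \<le> k" using d assms prime_gt_1_nat[OF assms(1)]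
    by (metis power_mult power_dvd_imp_le)
  then show "d \<in> (\<lambda>j. p ^ j) ` {..k div e}"
    using j assms by (auto simp: less_eq_div_iff_mult_less_eq)
next
  fix d assume "d \<in> (\<lambda>j. p ^ j) ` {..k div e}"
  then show "d \<in> {d. d ^ e dvd p ^ k}"
    using assms by (auto simp: less_eq_div_iff_mult_less_eq power_mult[symmetric] le_imp_power_dvd)
qed

lemma sum_power_divisors_prime_power:
  assumes "prime (p::nat)" "e > 0"
  shows "(\<Sum>d | d ^ e dvd p ^ k. f d) = (\<Sum>j\<le>k div e. f (p ^ j))"
proof -
  have "inj_on (\<lambda>j. p ^ j) {..k div e}"
    using prime_gt_1_nat[OF assms(1)] by (intro inj_onI) simp
  then show ?thesis unfolding power_divisors_prime_power[OF assms] by (simp add: sum.reindex)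
qed

context odd_real_character
begin

text \<open>\<open>eps\<close> and \<open>n0\<close> are the trace and the norm of
  (\<open>eps\<close> + sqrt(\<open>-q\<close>)) / 2, the generator of the ring of integers.
  Accordingly \<open>nf t\<close> is the norm of \<open>t\<close> plus this generator, and both
  parities of \<open>q\<close> are treated at once.\<close>

definition eps :: int where "eps = int q mod 2"
definition n0 :: int where "n0 = (int q + eps) div 4"

lemma four_n0: "4 * n0 = int q + eps"
proof (cases "odd q")
  case True
  have "int (q mod 4) = 3" using q_mod_4_odd[OF True] by simp
  then have q4: "int q mod 4 = 3" by (simp only: zmod_int) simp
  then have "eps = 1" unfolding eps_def by presburger
  then show ?thesis unfolding n0_def using q4 by presburger
next
  case False
  then have "int q mod 4 = 0" using q_mod_4_ne_2 by presburger
  then show ?thesis unfolding n0_def eps_def by presburger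
qed

lemma eps_cases: "eps = 0 \<or> eps = 1"
  unfolding eps_def by presburger

lemma eps_sq: "eps * eps = eps"
  using eps_cases by auto

definition nf :: "int \<Rightarrow> int" where "nf t = t ^ 2 + eps * t + n0"

lemma four_nf: "4 * nf t = (2 * t + eps) ^ 2 + int q"
  using four_n0 eps_sq by (simp add: nf_def algebra_simps power2_eq_square)

lemma nf_pos: "nf t > 0"
proof -
  have "4 * nf t > 0" unfolding four_nf using q_pos by (intro add_nonneg_pos) auto
  then show ?thesis by simp
qed

lemma nf_add: "nf (t + j) = nf t + j * (2 * t + eps) + j ^ 2"
  by (simp add: nf_def algebra_simps power2_eq_square)

lemma nf_cong: "[s = t] (mod m) \<Longrightarrow> [nf s = nf t] (mod m)"
  unfolding nf_def by (intro cong_add cong_pow cong_mult cong_refl)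

lemma nf_dvd_cong: "[s = t] (mod m) \<Longrightarrow> m dvd nf s \<longleftrightarrow> m dvd nf t"
  using nf_cong cong_dvd_iff by blast

text \<open>Each root modulo \<open>a\<close> describes one primitive ideal of norm
  \<open>a\<close>, i.e. one not divisible by a rational integer above 1. Hence \<open>rho\<close>
  will count these ideals.\<close>

definition roots :: "nat \<Rightarrow> int set" where
  "roots a = {t \<in> {0..<int a}. int a dvd nf t}"

definition rho :: "nat \<Rightarrow> nat" where "rho a = card (roots a)"

lemma finite_roots [simp]: "finite (roots a)"
  by (rule finite_subset[of _ "{0..<int a}"]) (auto simp: roots_def)

lemma rho_1 [simp]: "rho (Suc 0) = 1"
proof -
  have "roots (Suc 0) = {0}" by (auto simp: roots_def)
  then show ?thesis by (simp add: rho_def)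
qed

lemma mod_mem_roots: "m > 0 \<Longrightarrow> int m dvd nf t \<Longrightarrow> t mod int m \<in> roots m"
  using nf_dvd_cong[of "t mod int m" t "int m"] by (simp add: roots_def)

lemma roots_unique: "s \<in> roots m \<Longrightarrow> t \<in> roots m \<Longrightarrow> [s = t] (mod int m) \<Longrightarrow> s = t"
  by (auto simp: roots_def cong_def)

lemma rho_mult:
  assumes "coprime a b" "a > 0" "b > 0"
  shows "rho (a * b) = rho a * rho b"
proof -
  let ?f = "\<lambda>t. (t mod int a, t mod int b)"
  have "bij_betw ?f (roots (a * b)) (roots a \<times> roots b)"
    unfolding bij_betw_def
  proof (intro conjI inj_onI equalityI subsetI)
    fix s t assume st: "s \<in> roots (a * b)" "t \<in> roots (a * b)" "?f s = ?f t"
    then have "[s = t] (mod int a * int b)"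
      using assms by (intro coprime_cong_mult) (auto simp: cong_def)
    then show "s = t" using st roots_unique by simp
  next
    fix z assume "z \<in> ?f ` roots (a * b)"
    then obtain t where t: "z = ?f t" "int (a * b) dvd nf t" by (auto simp: roots_def)
    then have "int a dvd nf t" "int b dvd nf t" by (auto elim: dvd_mult_left dvd_mult_right)
    then show "z \<in> roots a \<times> roots b" using t mod_mem_roots assms by auto
  next
    fix z assume "z \<in> roots a \<times> roots b"
    then obtain r s where z: "z = (r, s)" "r \<in> roots a" "s \<in> roots b" by blast
    obtain x where x: "[x = r] (mod int a)" "[x = s] (mod int b)"
      using binary_chinese_remainder_int[of "int a" "int b" r s] assms by auto
    have "int a dvd nf x" "int b dvd nf x"
      using z nf_dvd_cong[OF x(1)] nf_dvd_cong[OF x(2)] by (auto simp: roots_def)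
    then have "int (a * b) dvd nf x" using assms by (simp add: divides_mult)
    then have mem: "x mod int (a * b) \<in> roots (a * b)" using assms by (intro mod_mem_roots) auto
    have "x mod int (a * b) mod int a = r" "x mod int (a * b) mod int b = s"
      using x z by (auto simp: mod_mod_cancel cong_def roots_def)
    then show "z \<in> ?f ` roots (a * b)" using mem z by (intro image_eqI[of _ _ "x mod int (a * b)"]) auto
  qed
  from bij_betw_same_card[OF this] show ?thesis by (simp add: rho_def card_cartesian_product)
qed

text \<open>Completing the square makes \<open>2 * t + eps\<close> a square root of
  \<open>-q\<close> modulo \<open>p\<close>. Such roots come in pairs of opposite sign, which
  coincide exactly if \<open>p\<close> divides \<open>q\<close>.\<close>

lemma rho_odd_prime:
  assumes p: "prime p" "odd p" shows "int (rho p) = 1 + X (int p)"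
proof -
  have c2: "coprime 2 (int p)" using p by simp
  then obtain i where i: "[2 * i = 1] (mod int p)" using cong_solve_coprime_int by blast
  have root_iff: "int p dvd nf t \<longleftrightarrow> [(2 * t + eps) ^ 2 = - int q] (mod int p)" for t
  proof -
    have "coprime (int p) 4" using coprime_power_right_iff[of "int p" 2 2] c2 by (simp add: coprime_commute)
    then have "int p dvd nf t \<longleftrightarrow> int p dvd 4 * nf t" by (simp add: coprime_dvd_mult_right_iff)
    then show ?thesis by (simp add: four_nf cong_iff_dvd_diff)
  qed
  define sol where "sol y = i * (y - eps) mod int p" for y
  have sol_iff: "t = sol y \<longleftrightarrow> [2 * t + eps = y] (mod int p)" if "t \<in> {0..<int p}" for t y
  proof
    assume "t = sol y"
    then have "[2 * t = 2 * (i * (y - eps))] (mod int p)" by (simp add: sol_def cong_def mod_mult_right_eq)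
    also have "[2 * (i * (y - eps)) = 1 * (y - eps)] (mod int p)"
      using cong_scalar_right[OF i, of "y - eps"] by (simp add: mult.assoc)
    finally have "[2 * t + eps = 1 * (y - eps) + eps] (mod int p)" by (intro cong_add cong_refl)
    then show "[2 * t + eps = y] (mod int p)" by simp
  next
    assume "[2 * t + eps = y] (mod int p)"
    then have "[2 * t + eps - eps = y - eps] (mod int p)" by (intro cong_diff cong_refl)
    then have "[i * (2 * t) = i * (y - eps)] (mod int p)" by (intro cong_scalar_left) simp
    moreover have "[i * (2 * t) = 1 * t] (mod int p)"
      using cong_scalar_right[OF i, of t] by (simp add: mult_ac)
    ultimately have "[t = i * (y - eps)] (mod int p)" by (metis cong_sym cong_trans mult_1)
    then show "t = sol y" using that by (simp add: cong_def sol_def)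
  qed
  have p0: "int p > 0" using p prime_gt_0_nat by simp
  have sol_range: "sol y \<in> {0..<int p}" for y using p0 by (simp add: sol_def)
  have roots_eq: "roots p = {sol y, sol (-y)}" if y: "[y ^ 2 = - int q] (mod int p)" for y
  proof (intro equalityI subsetI)
    fix t assume t: "t \<in> roots p"
    then have "[(2 * t + eps) ^ 2 = y ^ 2] (mod int p)"
      using root_iff y by (auto simp: roots_def intro: cong_trans cong_sym)
    then have "int p dvd (2 * t + eps - y) * (2 * t + eps + y)"
      by (simp add: cong_iff_dvd_diff algebra_simps power2_eq_square)
    then have "int p dvd (2 * t + eps - y) \<or> int p dvd (2 * t + eps + y)"
      using p by (simp add: prime_dvd_mult_iff)
    then have "[2 * t + eps = y] (mod int p) \<or> [2 * t + eps = -y] (mod int p)"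
      by (simp add: cong_iff_dvd_diff)
    then show "t \<in> {sol y, sol (-y)}" using t sol_iff by (auto simp: roots_def)
  next
    fix t assume t: "t \<in> {sol y, sol (-y)}"
    then have r: "t \<in> {0..<int p}" using sol_range by auto
    then have "[2 * t + eps = y] (mod int p) \<or> [2 * t + eps = -y] (mod int p)"
      using t sol_iff by auto
    then have "[(2 * t + eps) ^ 2 = y ^ 2] (mod int p)" using cong_pow[of _ _ "int p" 2] by fastforce
    then show "t \<in> roots p" using r root_iff y cong_trans by (auto simp: roots_def)
  qed
  have sol_eq: "sol y = sol (-y) \<longleftrightarrow> int p dvd y" for y
  proof -
    have "sol y = sol (-y) \<longleftrightarrow> [2 * sol y + eps = -y] (mod int p)" using sol_iff sol_range by blast
    also have "\<dots> \<longleftrightarrow> [y = -y] (mod int p)"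
      using sol_iff[of "sol y" y] sol_range by (meson cong_sym cong_trans)
    also have "\<dots> \<longleftrightarrow> int p dvd 2 * y" by (simp add: cong_iff_dvd_diff)
    also have "\<dots> \<longleftrightarrow> int p dvd y" using c2 by (simp add: coprime_dvd_mult_right_iff coprime_commute)
    finally show ?thesis .
  qed
  show ?thesis
  proof (cases "p dvd q")
    case True
    then have "[0 ^ 2 = - int q] (mod int p)" by (simp add: cong_iff_dvd_diff)
    then have "roots p = {sol 0}" using roots_eq by fastforce
    moreover have "\<not> coprime (int p) (int q)"
      using True p by (metis coprime_absorb_left coprime_int_iff not_prime_unit)
    then have "X (int p) = 0" by (rule X_eq_0_iff[THEN iffD2])
    ultimately show ?thesis by (simp add: rho_def)
  next
    case False
    then have Xp: "X (int p) = Legendre (- int q) (int p)" using X_eq_Legendre p by blast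
    have n0: "\<not> [- int q = 0] (mod int p)" using False by (simp add: cong_iff_dvd_diff)
    show ?thesis
    proof (cases "QuadRes (int p) (- int q)")
      case True
      then obtain y where y: "[y ^ 2 = - int q] (mod int p)" unfolding QuadRes_def by blast
      have "\<not> int p dvd y"
      proof
        assume "int p dvd y"
        then have "int p dvd y ^ 2" by (simp add: power2_eq_square)
        then have "int p dvd - int q" using y cong_dvd_iff by blast
        then show False using False by simp
      qed
      then have "rho p = 2" using roots_eq[OF y] sol_eq[of y] by (simp add: rho_def)
      moreover have "X (int p) = 1" using Xp n0 True by (simp add: Legendre_def)
      ultimately show ?thesis by simp
    next
      case F: False
      then have "\<not> [(2 * t + eps) ^ 2 = - int q] (mod int p)" for t unfolding QuadRes_def by blast
      then have "roots p = {}" using root_iff by (auto simp: roots_def)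
      then have "rho p = 0" by (simp add: rho_def)
      moreover have "X (int p) = -1" using Xp n0 F by (simp add: Legendre_def)
      ultimately show ?thesis by simp
    qed
  qed
qed

text \<open>For odd \<open>q\<close> the polynomial \<open>nf\<close> is constant modulo 2, with the
  parity of \<open>n0\<close>, which is that of \<open>(q + 1) div 4\<close>. For even
  \<open>q\<close> exactly one residue is a root.\<close>

lemma rho_2: "int (rho 2) = 1 + X 2"
proof -
  have set2: "{0..<2::int} = {0, 1}" by auto
  have r2: "roots 2 = {t \<in> {0, 1}. even (nf t)}" by (simp add: roots_def set2)
  show ?thesis
  proof (cases "odd q")
    case True
    then have e: "eps = 1" unfolding eps_def by presburger
    show ?thesis
    proof (cases "q mod 8 = 7")
      case T: True
      then have "even n0" using four_n0 e by presburger
      then have "roots 2 = {0, 1}" unfolding r2 nf_def e by auto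
      then show ?thesis using X_2[OF True] T by (simp add: rho_def)
    next
      case F: False
      then have "odd n0" using four_n0 e q_mod_4_odd[OF True] by presburger
      then have "roots 2 = {}" unfolding r2 nf_def e by auto
      then show ?thesis using X_2[OF True] F by (simp add: rho_def)
    qed
  next
    case False
    then have e: "eps = 0" unfolding eps_def by presburger
    have "roots 2 = {0} \<or> roots 2 = {1}" unfolding r2 nf_def e by (cases "even n0") auto
    then have "rho 2 = 1" by (elim disjE) (simp_all add: rho_def)
    moreover have "\<not> coprime 2 (int q)" using False by simp
    then have "X 2 = 0" by (rule X_eq_0_iff[THEN iffD2])
    ultimately show ?thesis by simp
  qed
qed

lemma rho_prime: "prime p \<Longrightarrow> int (rho p) = 1 + X (int p)"
  using rho_2 rho_odd_prime[of p] primes_dvd_imp_eq[of 2 p] by (cases "p = 2") auto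

text \<open>The square of a ramified prime divides no value of \<open>nf\<close>. For odd
  \<open>p\<close> it would divide \<open>q\<close>; for \<open>p = 2\<close> the sum
  \<open>t ^ 2 + n0\<close> is never 0 modulo 4, because \<open>n0\<close> is 1 or 2 modulo
  4.\<close>

lemma rho_ramified:
  assumes p: "prime p" "p dvd q" and k: "k \<ge> 2" shows "rho (p ^ k) = 0"
proof -
  have "\<not> int (p ^ 2) dvd nf t" for t
  proof
    assume d: "int (p ^ 2) dvd nf t"
    show False
    proof (cases "p = 2")
      case True
      then have "even q" using p by simp
      then have e: "eps = 0" unfolding eps_def by presburger
      have "4 dvd q" using \<open>even q\<close> q_mod_4_ne_2 by presburger
      then obtain m where m: "q = 4 * m" by blast
      then have n: "n0 = int m" using four_n0 e by auto
      have "m mod 4 = 1 \<or> m mod 4 = 2"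
      proof (cases "odd m")
        case True
        then show ?thesis using q_div_4_odd[OF \<open>even q\<close>] m by simp
      next
        case False
        moreover have "\<not> 4 dvd m" using not_16_dvd unfolding m by auto
        ultimately show ?thesis by presburger
      qed
      then have "n0 mod 4 = 1 \<or> n0 mod 4 = 2" unfolding n by presburger
      moreover have "4 dvd t ^ 2 + n0" using d True e by (simp add: nf_def)
      moreover have "t ^ 2 mod 4 = 0 \<or> t ^ 2 mod 4 = 1"
      proof (cases "even t")
        case True
        then obtain u where "t = 2 * u" by blast
        then show ?thesis by (simp add: power_mult_distrib)
      next
        case False
        then obtain u where "t = 2 * u + 1" by (elim oddE)
        then have "t ^ 2 = 4 * (u ^ 2 + u) + 1" by (simp add: power2_eq_square algebra_simps)
        then show ?thesis by presburger
      qed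
      ultimately show False by presburger
    next
      case False
      then have po: "odd p" using p primes_dvd_imp_eq two_is_prime_nat by blast
      have d4: "int p ^ 2 dvd (2 * t + eps) ^ 2 + int q"
        using d four_nf[of t] by (metis dvd_mult of_nat_power)
      have "int p dvd int p ^ 2" by simp
      then have "int p dvd (2 * t + eps) ^ 2" using d4 p
        by (meson dvd_add_left_iff dvd_trans int_dvd_int_iff)
      then have "int p dvd 2 * t + eps" using p by (simp add: prime_dvd_power_iff)
      then have "int p ^ 2 dvd (2 * t + eps) ^ 2" by (rule dvd_power_same)
      then have "int p ^ 2 dvd int q" using d4 dvd_add_right_iff by blast
      then have "p ^ 2 dvd q" by (metis int_dvd_int_iff of_nat_power)
      then show False using odd_prime_sq_not_dvd[OF p(1) po] by blast
    qed
  qed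
  moreover have "int (p ^ 2) dvd int (p ^ k)" using k by (simp add: le_imp_power_dvd)
  ultimately have "roots (p ^ k) = {}" unfolding roots_def by (auto dest: dvd_trans)
  then show ?thesis by (simp add: rho_def)
qed

text \<open>Hensel lifting: the derivative \<open>2 * t + eps\<close> is a unit at every root,
  because its square plus \<open>q\<close> is \<open>4 * nf t\<close>. So each root lifts in exactly
  one way.\<close>

lemma rho_unramified_Suc:
  assumes p: "prime p" "\<not> p dvd q" and k: "k \<ge> 1" shows "rho (p ^ Suc k) = rho (p ^ k)"
proof -
  have p0: "p > 0" using p prime_gt_0_nat by blast
  have unit: "\<not> int p dvd 2 * t + eps" if "int (p ^ k) dvd nf t" for t
  proof
    assume a: "int p dvd 2 * t + eps"
    have "int p dvd int (p ^ k)" using k by (simp add: dvd_power)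
    then have "int p dvd 4 * nf t" using that by (meson dvd_mult dvd_trans)
    then have "int p dvd int q" using a unfolding four_nf
      by (metis dvd_add_right_iff dvd_mult2 power2_eq_square)
    then show False using p by simp
  qed
  let ?m = "int (p ^ k)"
  have mm: "int (p ^ Suc k) = int p * ?m" by simp
  have m0: "?m > 0" using p0 by simp
  have "bij_betw (\<lambda>t. t mod ?m) (roots (p ^ Suc k)) (roots (p ^ k))"
    unfolding bij_betw_def
  proof (intro conjI inj_onI equalityI subsetI)
    fix s t assume st: "s \<in> roots (p ^ Suc k)" "t \<in> roots (p ^ Suc k)" "s mod ?m = t mod ?m"
    obtain j where j: "t = s + ?m * j" using st(3) by (metis cong_def cong_iff_lin)
    have ds: "int p * ?m dvd nf s" and dt: "int p * ?m dvd nf t" using st by (auto simp: roots_def)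
    have "nf t = nf s + ?m * (j * (2 * s + eps) + ?m * j ^ 2)"
      unfolding j nf_add by (simp add: algebra_simps power2_eq_square)
    then have "int p * ?m dvd ?m * (j * (2 * s + eps) + ?m * j ^ 2)"
      using ds dt by (metis dvd_add_right_iff)
    then have "?m * int p dvd ?m * (j * (2 * s + eps) + ?m * j ^ 2)" by (simp only: mult.commute)
    then have "int p dvd j * (2 * s + eps) + ?m * j ^ 2"
      unfolding dvd_mult_cancel_left using m0 by (metis less_irrefl)
    moreover have "int p dvd ?m * j ^ 2" using k by (simp add: dvd_power)
    ultimately have "int p dvd j * (2 * s + eps)" by (meson dvd_add_left_iff)
    moreover have "\<not> int p dvd 2 * s + eps" using unit ds by (meson dvd_mult_right)
    ultimately have "int p dvd j" using p by (simp add: prime_dvd_mult_iff)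
    then have "[s = t] (mod int (p ^ Suc k))" unfolding j mm cong_iff_dvd_diff by (simp add: mult.commute[of _ j])
    then show "s = t" using st roots_unique by blast
  next
    fix z assume "z \<in> (\<lambda>t. t mod ?m) ` roots (p ^ Suc k)"
    then obtain t where "z = t mod ?m" "int p * ?m dvd nf t" by (auto simp: roots_def)
    then show "z \<in> roots (p ^ k)" using mod_mem_roots[of "p ^ k" t] p0 by (metis dvd_mult_right zero_less_power)
  next
    fix s assume s: "s \<in> roots (p ^ k)"
    then have ds: "?m dvd nf s" by (simp add: roots_def)
    then obtain u where u: "nf s = ?m * u" by blast
    have "coprime (2 * s + eps) (int p)" using unit[OF ds] p by (metis coprime_commute prime_imp_coprime prime_nat_int_transfer)
    then obtain w where w: "[(2 * s + eps) * w = 1] (mod int p)" using cong_solve_coprime_int by blast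
    \<comment> \<open>The Newton correction, which makes \<open>u + j * (2 * s + eps)\<close>
      divisible by \<open>p\<close>.\<close>
    define j where "j = - u * w"
    have "[u + j * (2 * s + eps) = u + (- u) * 1] (mod int p)"
      using cong_add[OF cong_refl[of u] cong_scalar_left[OF w, of "-u"]] by (simp add: j_def mult_ac)
    then have "int p dvd u + j * (2 * s + eps)" by (simp add: cong_0_iff)
    moreover have "int p dvd ?m * j ^ 2" using k by (simp add: dvd_power)
    ultimately have "int p dvd u + j * (2 * s + eps) + ?m * j ^ 2" by (rule dvd_add)
    moreover have "nf (s + ?m * j) = ?m * (u + j * (2 * s + eps) + ?m * j ^ 2)"
      unfolding nf_add u by (simp add: algebra_simps power2_eq_square)
    ultimately have "int (p ^ Suc k) dvd nf (s + ?m * j)" unfolding mm by (simp add: mult_dvd_mono mult.commute[of "int p"])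
    then have mem: "(s + ?m * j) mod int (p ^ Suc k) \<in> roots (p ^ Suc k)" using p0 by (intro mod_mem_roots) auto
    have "(s + ?m * j) mod int (p ^ Suc k) mod ?m = (s + ?m * j) mod ?m"
      by (rule mod_mod_cancel) simp
    also have "\<dots> = s" using s by (simp add: roots_def)
    finally show "s \<in> (\<lambda>t. t mod ?m) ` roots (p ^ Suc k)" using mem by (metis image_eqI)
  qed
  then show ?thesis unfolding rho_def by (rule bij_betw_same_card)
qed

lemma rho_prime_power:
  assumes p: "prime p" shows "int (rho (p ^ Suc k)) = X (int p) ^ k * (1 + X (int p))"
proof (cases "p dvd q")
  case True
  then have "\<not> coprime (int p) (int q)"
    using p by (metis coprime_absorb_left coprime_int_iff not_prime_unit)
  then have X0: "X (int p) = 0" by (rule X_eq_0_iff[THEN iffD2])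
  show ?thesis
  proof (cases k)
    case 0
    then show ?thesis using rho_prime[OF p] by simp
  next
    case (Suc j)
    then show ?thesis using rho_ramified[OF p True, of "Suc k"] X0 by simp
  qed
next
  case False
  then have "coprime (int p) (int q)" using p by (simp add: prime_imp_coprime)
  then have Xc: "X (int p) = 1 \<or> X (int p) = -1" using X_cases by blast
  have "rho (p ^ Suc k) = rho p"
    by (induction k) (simp, metis False p rho_unramified_Suc Suc_le_eq One_nat_def zero_less_Suc)
  then show ?thesis using rho_prime[OF p] Xc by auto
qed

text \<open>The left side is the coefficient of the product of zeta and the L-function; the right
  side counts ideals of norm \<open>n\<close> by their largest rational integer factor
  \<open>g\<close>. Both are multiplicative, so prime powers suffice.\<close>

lemma sum_X_divisors_eq_sum_rho:
  assumes "n > 0"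
  shows "(\<Sum>d | d dvd n. X (int d)) = (\<Sum>g | g ^ 2 dvd n. int (rho (n div g ^ 2)))"
  using assms
proof (induction n rule: less_induct)
  case (less n)
  define B where "B n = (\<Sum>d | d ^ 1 dvd n. X (int d))" for n
  define A where "A n = (\<Sum>g | g ^ 2 dvd n. int (rho (n div g ^ 2)))" for n
  have B_mult: "B (m * n) = B m * B n" if "coprime m n" "m > 0" "n > 0" for m n
  proof -
    have "B m * B n = (\<Sum>(c, d)\<in>{c. c ^ 1 dvd m} \<times> {d. d ^ 1 dvd n}. X (int (c * d)))"
      unfolding B_def sum_product sum.cartesian_product by (simp add: X_mult)
    also have "\<dots> = B (m * n)" unfolding B_def
      using sum.reindex_bij_betw[OF bij_betw_power_divisors[OF that, of 1], of "\<lambda>d. X (int d)"]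
      by (simp add: case_prod_unfold)
    finally show ?thesis ..
  qed
  have A_mult: "A (m * n) = A m * A n" if mn: "coprime m n" "m > 0" "n > 0" for m n
  proof -
    have "A m * A n = (\<Sum>(c, d)\<in>{c. c ^ 2 dvd m} \<times> {d. d ^ 2 dvd n}. int (rho (m * n div (c * d) ^ 2)))"
      unfolding A_def sum_product sum.cartesian_product
    proof (rule sum.cong[OF refl], clarify)
      fix c d assume cd: "c ^ 2 dvd m" "d ^ 2 dvd n"
      obtain m' n' where m'n': "m = c ^ 2 * m'" "n = d ^ 2 * n'" using cd by (auto elim!: dvdE)
      then have pos: "c > 0" "d > 0" "m' > 0" "n' > 0" using mn by (auto intro!: Nat.gr0I)
      have "m * n = (c * d) ^ 2 * (m' * n')" by (simp add: m'n' power_mult_distrib)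
      then have "m * n div (c * d) ^ 2 = m' * n'" using pos by simp
      moreover have "m div c ^ 2 = m'" "n div d ^ 2 = n'" using m'n' pos by simp_all
      moreover have "coprime m' n'" using mn(1) m'n' by simp
      moreover note pos
      ultimately show "int (rho (m div c ^ 2)) * int (rho (n div d ^ 2)) = int (rho (m * n div (c * d) ^ 2))"
        by (simp add: rho_mult)
    qed
    also have "\<dots> = A (m * n)" unfolding A_def
      using sum.reindex_bij_betw[OF bij_betw_power_divisors[OF mn, of 2], of "\<lambda>d. int (rho (m * n div d ^ 2))"]
      by (simp add: case_prod_unfold)
    finally show ?thesis ..
  qed
  have prime_power: "B (p ^ k) = A (p ^ k)" if p: "prime p" for p k
  proof (induction k rule: induct_nat_012)
    case 0
    then show ?case by (simp add: A_def B_def X_1 )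
  next
    case 1
    have "B p = 1 + X (int p)"
      using sum_power_divisors_prime_power[OF p, of 1 "\<lambda>d. X (int d)" 1] by (simp add: B_def X_1)
    moreover have "A p = int (rho p)"
      using sum_power_divisors_prime_power[OF p, of 2 "\<lambda>d. int (rho (p div d ^ 2))" 1] by (simp add: A_def)
    ultimately show ?case using rho_prime[OF p] by simp
  next
    case (ge2 k)
    have p0: "p > 0" using p prime_gt_0_nat by blast
    have "B (p ^ j) = (\<Sum>i\<le>j. X (int p) ^ i)" for j
      using sum_power_divisors_prime_power[OF p, of 1 "\<lambda>d. X (int d)" j] by (simp add: B_def X_power)
    then have "B (p ^ Suc (Suc k)) = B (p ^ k) + X (int p) ^ Suc k + X (int p) ^ Suc (Suc k)"
      by (simp only: sum.atMost_Suc)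
    \<comment> \<open>Only the term with \<open>g = 1\<close> is new; the others are those for the
      exponent \<open>k\<close>. This is why the induction goes in steps of two.\<close>
    moreover have "A (p ^ Suc (Suc k)) = int (rho (p ^ Suc (Suc k))) + A (p ^ k)"
    proof -
      have "A (p ^ Suc (Suc k)) = (\<Sum>j\<le>Suc (k div 2). int (rho (p ^ Suc (Suc k) div (p ^ j) ^ 2)))"
        using sum_power_divisors_prime_power[OF p, of 2 "\<lambda>d. int (rho (p ^ Suc (Suc k) div d ^ 2))" "Suc (Suc k)"]
        by (simp add: A_def)
      also have "\<dots> = int (rho (p ^ Suc (Suc k))) + (\<Sum>j\<le>k div 2. int (rho (p ^ Suc (Suc k) div (p ^ Suc j) ^ 2)))"
        by (subst sum.atMost_Suc_shift) simp
      also have "(\<Sum>j\<le>k div 2. int (rho (p ^ Suc (Suc k) div (p ^ Suc j) ^ 2))) =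
          (\<Sum>j\<le>k div 2. int (rho (p ^ k div (p ^ j) ^ 2)))"
        using p0 by (intro sum.cong refl) (simp add: power2_eq_square mult_ac)
      also have "\<dots> = A (p ^ k)"
        using sum_power_divisors_prime_power[OF p, of 2 "\<lambda>d. int (rho (p ^ k div d ^ 2))" k] by (simp add: A_def)
      finally show ?thesis .
    qed
    ultimately show ?case using ge2 rho_prime_power[OF p, of "Suc k"] by (simp add: algebra_simps)
  qed
  have "B n = A n"
  proof (cases "n = 1")
    case True
    then show ?thesis using prime_power[OF two_is_prime_nat, of 0] by simp
  next
    case False
    then obtain p where p: "prime p" "p dvd n" using prime_factor_nat by blast
    define k where "k = multiplicity p n"
    obtain m where m: "n = p ^ k * m" "\<not> p dvd m"
      using multiplicity_decompose'[of n p] less.prems p not_prime_unit unfolding k_def by (metis less_irrefl)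
    have k: "k > 0" using p less.prems by (simp add: k_def prime_multiplicity_gt_zero_iff)
    have m0: "m > 0" using less.prems m by (auto intro!: Nat.gr0I)
    have "p ^ k > 1" using prime_gt_1_nat[OF p(1)] k by (rule one_less_power)
    then have "m < n" using m m0 by simp
    then have "B m = A m" using less.IH m0 by (simp add: A_def B_def)
    moreover have "coprime (p ^ k) m" using p m by (simp add: prime_imp_coprime)
    ultimately show ?thesis using A_mult B_mult m m0 prime_power[OF p(1)] prime_gt_0_nat[OF p(1)] by simp
  qed
  then show ?case by (simp add: A_def B_def)
qed

end

section \<open>Ideals of the imaginary quadratic field\<close>

text \<open>Gauss's lemma: the primitive integer quadratic with root \<open>z\<close> divides the
  monic polynomial \<open>P\<close> over the integers, so its leading coefficient is 1 or -1, and
  the trace and the norm have no denominators.\<close>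

lemma quadratic_algebraic_int_coeffs:
  fixes z :: complex
  assumes z: "algebraic_int z" "Im z \<noteq> 0" and T: "2 * Re z \<in> \<rat>" and N: "cmod z ^ 2 \<in> \<rat>"
  shows "2 * Re z \<in> \<int>" "cmod z ^ 2 \<in> \<int>"
proof -
  obtain P :: "int poly" where P: "poly (map_poly of_int P) z = 0" "lead_coeff P = 1"
    using z(1) by (auto simp: algebraic_int_altdef_ipoly)
  obtain a d where a: "2 * Re z = of_int a / of_int d" "d > 0"
    using T by (metis Rats_cases' )
  obtain b e where b: "cmod z ^ 2 = of_int b / of_int e" "e > 0"
    using N by (metis Rats_cases')
  \<comment> \<open>The quadratic with roots \<open>z\<close> and its conjugate, with the
    denominators \<open>d\<close> and \<open>e\<close> cleared.\<close>
  define p1 where "p1 = [: b * d, - (a * e), d * e :]"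
  define p0 where "p0 = primitive_part p1"
  define g where "g = content p1"
  have p1: "p1 = Polynomial.smult g p0" by (simp add: p0_def g_def)
  have de: "d * e > 0" using a b by simp
  then have p1_nz: "p1 \<noteq> 0" using a(2) b(2) by (simp add: p1_def)
  have deg1: "degree p1 = 2" using de a(2) b(2) by (simp add: p1_def)
  have c0: "content p0 = 1" using p1_nz by (simp add: p0_def)
  have "\<bar>g\<bar> = g" using normalize_content[of p1] by (simp add: g_def normalize_int_def)
  moreover have "g \<noteq> 0" using p1_nz by (simp add: g_def)
  ultimately have g0: "g > 0" by linarith
  have quad: "z ^ 2 - of_real (2 * Re z) * z + of_real (cmod z ^ 2) = 0"
    by (simp add: complex_eq_iff power2_eq_square cmod_def algebra_simps)
  have "poly (map_poly of_int p1) z = of_int (d * e) * (z ^ 2 - of_real (2 * Re z) * z + of_real (cmod z ^ 2))"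
    unfolding a(1) b(1) using a(2) b(2)
    by (simp add: p1_def map_poly_pCons power2_eq_square field_simps)
  then have "poly (map_poly of_int p1) z = 0" by (simp only: quad) simp
  then have p0z: "poly (map_poly of_int p0) z = 0"
    using g0 by (simp add: p1 map_poly_smult)
  \<comment> \<open>The remainder has degree at most 1 and vanishes at the nonreal \<open>z\<close>,
    so it is 0.\<close>
  define R where "R = pseudo_mod P p0"
  have p0_nz: "p0 \<noteq> 0" using c0 by auto
  obtain c Q where cQ: "c \<noteq> 0" "Polynomial.smult c P = p0 * Q + R" and degR: "R = 0 \<or> degree R < degree p0"
    using pseudo_mod[OF p0_nz, of P] unfolding R_def by blast
  have "poly (map_poly of_int (Polynomial.smult c P)) z = poly (map_poly of_int R) z"
    by (simp add: cQ(2) map_poly_of_int_add map_poly_of_int_mult p0z)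
  then have Rz: "poly (map_poly of_int R) z = 0" using P by (simp add: map_poly_smult)
  have "degree p0 = 2" using deg1 by (simp add: p0_def)
  then have "degree R \<le> 1" using degR by auto
  then have "R = [:Polynomial.coeff R 0, Polynomial.coeff R 1:]"
    by (intro poly_eqI) (auto simp: coeff_pCons coeff_eq_0 split: nat.splits)
  then obtain r s where rs: "R = [:r, s:]" by blast
  have "of_int r + z * of_int s = 0" using Rz by (simp add: rs map_poly_pCons)
  then have "Im z * of_int s = 0" "of_int r + Re z * of_int s = 0" by (auto simp: complex_eq_iff)
  then have "R = 0" using z(2) by (simp add: rs)
  then have eq: "Polynomial.smult c P = p0 * Q" using cQ by simp
  \<comment> \<open>Comparing contents, the factor \<open>c\<close> introduced by the
    pseudo-division divides \<open>Q\<close> and can be cancelled.\<close>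
  have "content P dvd 1" using content_dvd_coeff[of P "degree P"] P(2) by simp
  then have "content P = 1" by (metis is_unit_normalize normalize_content)
  then have "\<bar>c\<bar> = content Q" using arg_cong[OF eq, of content] c0 by (simp add: content_mult)
  then have "c dvd Polynomial.coeff Q n" for n by (metis abs_dvd_iff content_dvd_coeff)
  then have "[:c:] dvd Q" by (simp add: const_poly_dvd_iff)
  then obtain Q' where Q': "Q = Polynomial.smult c Q'" by (auto elim!: dvdE)
  then have "Polynomial.smult c P = Polynomial.smult c (p0 * Q')" using eq by simp
  then have "P = p0 * Q'" using cQ(1) by (metis smult_cancel)
  then have "lead_coeff p0 * lead_coeff Q' = 1" using P(2) by (simp add: lead_coeff_mult)
  then have lead: "\<bar>lead_coeff p0\<bar> = 1" using zmult_eq_1_iff by fastforce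
  have "lead_coeff p1 = d * e" using a(2) b(2) by (simp add: p1_def)
  then have "d * e = g * lead_coeff p0" by (metis p1 lead_coeff_smult)
  then have g: "g = d * e" using lead g0 de by (auto simp: abs_if split: if_splits)
  have "g dvd a * e" using content_dvd_coeff[of p1 1] by (simp add: g_def p1_def)
  then have "d dvd a" using b(2) unfolding g by simp
  then show "2 * Re z \<in> \<int>" unfolding a using a(2) by (auto elim!: dvdE)
  have "g dvd b * d" using content_dvd_coeff[of p1 0] by (simp add: g_def p1_def)
  then have "e dvd b" using a(2) unfolding g by (simp add: mult.commute)
  then show "cmod z ^ 2 \<in> \<int>" unfolding b using b(2) by (auto elim!: dvdE)
qed

lemma monic_quadratic_algebraic_int:
  fixes z :: complex
  assumes "z ^ 2 + of_int b * z + of_int c = 0"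
  shows "algebraic_int z"
proof -
  have "lead_coeff [:of_int c, of_int b, 1 :: complex:] = 1" by simp
  moreover have "Polynomial.coeff [:of_int c, of_int b, 1 :: complex:] i \<in> \<int>" for i
    by (auto simp: coeff_pCons split: nat.splits)
  moreover have "poly [:of_int c, of_int b, 1:] z = 0"
    using assms by (simp add: algebra_simps power2_eq_square)
  ultimately show ?thesis using algebraic_int.intros by blast
qed

lemma squarefree_mult_sq_int:
  fixes r :: real
  assumes F: "\<And>p. prime p \<Longrightarrow> \<not> p ^ 2 dvd F" and r: "r \<in> \<rat>" and "of_nat F * r ^ 2 \<in> \<int>"
  shows "r \<in> \<int>"
proof -
  obtain u v where uv: "r = of_int u / of_int v" "v > 0" "coprime u v"
    using r by (metis Rats_cases')
  obtain m where "of_nat F * r ^ 2 = of_int m" using assms(3) by (auto elim: Ints_cases)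
  then have "of_nat F * of_int u ^ 2 = (of_int m * of_int v ^ 2 :: real)"
    using uv(2) by (simp add: uv(1) field_simps)
  then have "of_int (int F * u ^ 2) = (of_int (m * v ^ 2) :: real)" by simp
  then have "int F * u ^ 2 = m * v ^ 2" by (simp only: of_int_eq_iff)
  then have "v ^ 2 dvd int F * u ^ 2" by simp
  moreover have "coprime (v ^ 2) (u ^ 2)" using uv(3) by (simp add: coprime_commute)
  ultimately have d: "v ^ 2 dvd int F" by (simp add: coprime_dvd_mult_left_iff)
  have "nat v = 1"
  proof (rule ccontr)
    assume "nat v \<noteq> 1"
    then obtain p where p: "prime p" "p dvd nat v" using prime_factor_nat by blast
    then have "int p dvd v" using uv(2) by (metis int_dvd_int_iff int_nat_eq less_imp_le)
    then have "int p ^ 2 dvd int F" using d by (meson dvd_power_same dvd_trans)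
    then have "p ^ 2 dvd F" by (metis int_dvd_int_iff of_nat_power)
    then show False using F p by blast
  qed
  then have "v = 1" using uv(2) by simp
  then show ?thesis by (simp add: uv(1))
qed

lemma int_subgroup:
  fixes S :: "int set"
  assumes diff: "\<And>x y. x \<in> S \<Longrightarrow> y \<in> S \<Longrightarrow> x - y \<in> S" and pos: "x \<in> S" "x > 0"
  shows "\<exists>g > 0. S = range (\<lambda>k. g * k)"
proof -
  define g where "g = (LEAST n::nat. n > 0 \<and> int n \<in> S)"
  have ex: "nat x > 0 \<and> int (nat x) \<in> S" using pos by simp
  have g: "g > 0" "int g \<in> S" using LeastI[of "\<lambda>n. n > 0 \<and> int n \<in> S", OF ex] by (auto simp: g_def)
  have least: "g \<le> n" if "n > 0" "int n \<in> S" for n unfolding g_def using that by (intro Least_le) auto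
  have z: "0 \<in> S" using diff[OF pos(1) pos(1)] by simp
  have neg: "- y \<in> S" if "y \<in> S" for y using diff[OF z that] by simp
  have add: "y + w \<in> S" if "y \<in> S" "w \<in> S" for y w using diff[OF that(1) neg[OF that(2)]] by simp
  have multn: "int g * int n \<in> S" for n by (induction n) (auto simp: z algebra_simps intro: add g)
  have mult: "int g * k \<in> S" for k
    using multn[of "nat k"] neg[OF multn[of "nat (-k)"]] by (cases "k \<ge> 0") auto
  have "y \<in> range (\<lambda>k. int g * k)" if "y \<in> S" for y
  proof -
    have "y mod int g \<in> S" using diff[OF that mult[of "y div int g"]] by (simp add: minus_mult_div_eq_mod)
    then have "nat (y mod int g) = 0" using least[of "nat (y mod int g)"] g
      by (metis bot_nat_0.not_eq_extremum linorder_not_less nat_int nat_less_iff of_nat_0_less_iff pos_mod_bound pos_mod_sign int_nat_eq)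
    then have "y mod int g = 0" using g by (metis nat_0_iff of_nat_0_less_iff pos_mod_sign order_antisym)
    then show ?thesis by (metis mult_div_mod_eq add.right_neutral rangeI)
  qed
  then show ?thesis using g mult by (intro exI[of _ "int g"]) auto
qed

section \<open>The ring of integers in coordinates\<close>

context odd_real_character
begin

definition omega :: complex where "omega = Complex (of_int eps / 2) (sqrt (of_nat q) / 2)"

definition lat :: "int \<Rightarrow> int \<Rightarrow> complex" where "lat x y = of_int x + of_int y * omega"

abbreviation "K \<equiv> imaginary_quadratic_field q"
abbreviation "\<O> \<equiv> carrier (ring_of_integers K)"

lemma sqrt_q_pos: "sqrt (of_nat q) > 0" using q_pos by simp

lemma Re_lat: "Re (lat x y) = of_int x + of_int y * of_int eps / 2"
  and Im_lat: "Im (lat x y) = of_int y * (sqrt (of_nat q) / 2)"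
  by (simp_all add: lat_def omega_def)

lemma lat_inject [simp]: "lat x y = lat u v \<longleftrightarrow> x = u \<and> y = v"
  using sqrt_q_pos by (auto simp: complex_eq_iff Re_lat Im_lat)

lemma of_int_lat: "of_int x = lat x 0" by (simp add: lat_def)

lemma lat_eq_0 [simp]: "lat x y = 0 \<longleftrightarrow> x = 0 \<and> y = 0"
  using lat_inject[of x y 0 0] by (simp add: lat_def)

lemma omega_sq: "omega * omega = of_int eps * omega - of_int n0"
proof -
  have "of_int (4 * n0) = (of_int (int q + eps) :: real)" by (simp only: four_n0)
  then have "4 * of_int n0 = (of_nat q + of_int eps :: real)" by simp
  moreover have "of_int eps * of_int eps = (of_int eps :: real)" by (metis eps_sq of_int_mult)
  ultimately show ?thesis using q_pos by (auto simp: complex_eq_iff omega_def field_simps)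
qed

lemma lat_add: "lat x y + lat u v = lat (x + u) (y + v)"
  and lat_diff: "lat x y - lat u v = lat (x - u) (y - v)"
  and lat_uminus: "- lat x y = lat (- x) (- y)"
  and lat_scale: "of_int k * lat x y = lat (k * x) (k * y)"
  by (simp_all add: lat_def algebra_simps)

lemma lat_mult: "lat x y * lat u v = lat (x * u - n0 * y * v) (x * v + y * u + eps * y * v)"
proof -
  have "lat x y * lat u v = of_int (x * u) + of_int (x * v + y * u) * omega + of_int (y * v) * (omega * omega)"
    by (simp add: lat_def algebra_simps)
  then show ?thesis unfolding omega_sq by (simp add: lat_def algebra_simps)
qed

lemma cnj_lat: "cnj (lat x y) = lat (x + eps * y) (- y)"
  by (simp add: complex_eq_iff Re_lat Im_lat field_simps)

lemma norm_lat: "cmod (lat x y) ^ 2 = of_int (x ^ 2 + eps * x * y + n0 * y ^ 2)"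
proof -
  have "of_real (cmod (lat x y) ^ 2) = lat x y * cnj (lat x y)" by (rule complex_norm_square)
  also have "\<dots> = of_int (x ^ 2 + eps * x * y + n0 * y ^ 2)"
    unfolding cnj_lat lat_mult of_int_lat by (simp add: algebra_simps power2_eq_square)
  finally show ?thesis by (metis of_real_of_int_eq of_real_eq_iff)
qed

lemma norm_lat_ge: "cmod (lat x y) ^ 2 \<ge> of_int (y ^ 2) * of_nat q / 4"
proof -
  have "cmod (lat x y) ^ 2 \<ge> Im (lat x y) ^ 2"
    by (simp add: cmod_power2)
  then show ?thesis using q_pos by (simp add: Im_lat power_mult_distrib power_divide)
qed

lemma csqrt_q: "csqrt (- of_nat q) = \<i> * of_real (sqrt (of_nat q))"
  using csqrt_of_real_nonpos[of "- of_nat q"] by simp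

lemma K_iff: "z \<in> K \<longleftrightarrow> Re z \<in> \<rat> \<and> Im z / sqrt (of_nat q) \<in> \<rat>"
proof
  assume "z \<in> K"
  then obtain x y where xy: "z = x + y * csqrt (- of_nat q)" "x \<in> \<rat>" "y \<in> \<rat>"
    unfolding imaginary_quadratic_field_def by blast
  obtain a b c d :: int where "x = of_int a / of_int b" "y = of_int c / of_int d"
    using xy(2,3) by (metis Rats_cases')
  then have "x = of_real (of_int a / of_int b)" "y = of_real (of_int c / of_int d)" by simp_all
  then show "Re z \<in> \<rat> \<and> Im z / sqrt (of_nat q) \<in> \<rat>"
    using sqrt_q_pos by (simp add: xy csqrt_q)
next
  assume a: "Re z \<in> \<rat> \<and> Im z / sqrt (of_nat q) \<in> \<rat>"
  define r s where "r = Re z" and "s = Im z / sqrt (of_nat q)"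
  have rat: "complex_of_real u \<in> \<rat>" if "u \<in> \<rat>" for u
    using that by (auto elim!: Rats_cases')
  have "z = of_real r + of_real s * csqrt (- of_nat q)"
    using sqrt_q_pos by (simp add: csqrt_q complex_eq_iff r_def s_def)
  moreover have "r \<in> \<rat>" "s \<in> \<rat>" using a by (simp_all add: r_def s_def)
  then have "complex_of_real r \<in> \<rat>" "complex_of_real s \<in> \<rat>" using rat by blast+
  ultimately show "z \<in> K" unfolding imaginary_quadratic_field_def by blast
qed

lemma lat_div_in_K: "lat x y / of_int a \<in> K"
  using sqrt_q_pos by (simp add: K_iff Re_lat Im_lat)

lemma lat_algebraic_int: "algebraic_int (lat x y)"
proof (rule monic_quadratic_algebraic_int)
  show "lat x y ^ 2 + of_int (- (2 * x + eps * y)) * lat x y + of_int (x ^ 2 + eps * x * y + n0 * y ^ 2) = 0"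
    unfolding power2_eq_square lat_mult lat_scale of_int_lat lat_add by (simp add: algebra_simps)
qed

text \<open>Trace and norm of an algebraic integer are integers. As \<open>q\<close>, or
  \<open>q div 4\<close> for even \<open>q\<close>, is squarefree, the coefficient of the square
  root then has no further denominator, and a parity argument finishes.\<close>

lemma carrier_eq_lat: "\<O> = range (\<lambda>(x, y). lat x y)"
proof (intro equalityI subsetI)
  fix z assume "z \<in> range (\<lambda>(x, y). lat x y)"
  then obtain x y where "z = lat x y" by auto
  then show "z \<in> \<O>" using lat_algebraic_int lat_div_in_K[of x y 1] by (simp add: ring_of_integers_def)
next
  fix z assume z: "z \<in> \<O>"
  then have alg: "algebraic_int z" and K: "Re z \<in> \<rat>" "Im z / sqrt (of_nat q) \<in> \<rat>"
    by (auto simp: ring_of_integers_def K_iff)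
  define Y where "Y = 2 * (Im z / sqrt (of_nat q))"
  have Yr: "Y \<in> \<rat>" unfolding Y_def by (rule Rats_mult) (use K in auto)
  have Im_z: "Im z = Y / 2 * sqrt (of_nat q)" using sqrt_q_pos by (simp add: Y_def)
  have four_norm: "4 * cmod z ^ 2 = (2 * Re z) ^ 2 + of_nat q * Y ^ 2"
    by (simp add: cmod_power2 Im_z power_mult_distrib power_divide)
  have ints: "2 * Re z \<in> \<int> \<and> cmod z ^ 2 \<in> \<int>"
  proof (cases "Im z = 0")
    case True
    then have zr: "z = of_real (Re z)" by (simp add: complex_eq_iff)
    then have "algebraic_int (Re z)" using alg by (metis algebraic_int_of_real_iff)
    then have "Re z \<in> \<int>" using K rational_algebraic_int_is_int by blast
    then show ?thesis using True by (simp add: cmod_power2)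
  next
    case False
    have "cmod z ^ 2 = ((2 * Re z) ^ 2 + of_nat q * Y ^ 2) / 4" using four_norm by simp
    moreover have "((2 * Re z) ^ 2 + of_nat q * Y ^ 2) / 4 \<in> \<rat>"
      using K Yr by (intro Rats_divide Rats_add Rats_mult Rats_power) auto
    ultimately have "cmod z ^ 2 \<in> \<rat>" by (simp only:)
    then show ?thesis using quadratic_algebraic_int_coeffs[OF alg False] K by simp
  qed
  then obtain T N where T: "2 * Re z = of_int T" and N: "cmod z ^ 2 = of_int N" by (auto elim!: Ints_cases)
  have TN: "of_nat q * Y ^ 2 = of_int (4 * N - T ^ 2)" using four_norm by (simp add: T N)
  show "z \<in> range (\<lambda>(x, y). lat x y)"
  proof (cases "odd q")
    case True
    then have e: "eps = 1" unfolding eps_def by presburger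
    have sqf: "\<not> p ^ 2 dvd q" if "prime p" for p
      using odd_prime_sq_not_dvd that True by (metis dvd_trans dvd_triv_left even_power power2_eq_square)
    have "Y \<in> \<int>" by (rule squarefree_mult_sq_int[OF sqf Yr]) (simp_all only: TN Ints_of_int)
    then obtain y where y: "Y = of_int y" by (auto elim: Ints_cases)
    have "of_int (int q * y ^ 2) = (of_int (4 * N - T ^ 2) :: real)" using TN by (simp add: y)
    then have "int q * y ^ 2 = 4 * N - T ^ 2" by (simp only: of_int_eq_iff)
    moreover have "even (int q * y ^ 2) \<longleftrightarrow> even y" using True by simp
    moreover have "even (4 * N - T ^ 2) \<longleftrightarrow> even T" by simp
    ultimately have "even (T - y)" by simp
    then obtain x where "T - y = 2 * x" by blast
    then have "T = 2 * x + y" by simp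
    then have "z = lat x y" using T by (simp add: complex_eq_iff Re_lat Im_lat Im_z y e)
    then show ?thesis by auto
  next
    case False
    then have e: "eps = 0" unfolding eps_def by presburger
    have q4: "int q = 4 * n0" using four_n0 e by simp
    define m where "m = nat n0"
    have n0m: "n0 = int m" using q4 by (simp add: m_def)
    have qm: "q = 4 * m" using q4 n0m by linarith
    have sqf: "\<not> p ^ 2 dvd m" if "prime p" for p
    proof
      assume d: "p ^ 2 dvd m"
      show False
      proof (cases "p = 2")
        case True
        then have "4 * 4 dvd 4 * m" using d by (intro mult_dvd_mono) auto
        then show False using not_16_dvd qm by simp
      next
        case False
        then have "odd p" using that primes_dvd_imp_eq two_is_prime_nat by blast
        then show False using odd_prime_sq_not_dvd[OF that] d qm by (metis dvd_mult)
      qed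
    qed
    have TNm: "of_nat m * (2 * Y) ^ 2 = of_int (4 * N - T ^ 2)" using TN by (simp add: qm power_mult_distrib)
    have "2 * Y \<in> \<int>"
    proof (rule squarefree_mult_sq_int[OF sqf])
      show "2 * Y \<in> \<rat>" by (intro Rats_mult Yr Rats_number_of)
      show "of_nat m * (2 * Y) ^ 2 \<in> \<int>" by (simp only: TNm Ints_of_int)
    qed
    then obtain w where w: "2 * Y = of_int w" by (auto elim: Ints_cases)
    have "of_int (int m * w ^ 2) = (of_int (4 * N - T ^ 2) :: real)" using TNm by (simp add: w)
    then have eq: "T ^ 2 + int m * w ^ 2 = 4 * N" unfolding of_int_eq_iff by linarith
    have m4: "m mod 4 = 1 \<or> m mod 4 = 2"
    proof (cases "odd m")
      case True
      then show ?thesis using q_div_4_odd False qm by simp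
    next
      case F: False
      moreover have "\<not> 4 dvd m" using sqf[of 2] by simp
      ultimately show ?thesis by presburger
    qed
    have sq: "even t \<and> t ^ 2 mod 4 = 0 \<or> odd t \<and> t ^ 2 mod 4 = 1" for t :: int
    proof (cases "even t")
      case True
      then obtain u where "t = 2 * u" by blast
      then show ?thesis by (simp add: power_mult_distrib)
    next
      case False
      then obtain u where "t = 2 * u + 1" by (elim oddE)
      then have "t ^ 2 = 4 * (u ^ 2 + u) + 1" by (simp add: power2_eq_square algebra_simps)
      then show ?thesis using False by presburger
    qed
    have "(T ^ 2 + int m * w ^ 2) mod 4 = 0" using eq by simp
    then have r: "(T ^ 2 mod 4 + (int m mod 4) * (w ^ 2 mod 4)) mod 4 = 0"
      by (metis mod_add_eq mod_mod_trivial mod_mult_eq)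
    have m4': "int m mod 4 = 1 \<or> int m mod 4 = 2" using m4 by presburger
    \<comment> \<open>Squares are 0 or 1 modulo 4, and \<open>m\<close> is 1 or 2 modulo 4, so
      \<open>T ^ 2 + m * w ^ 2\<close> is divisible by 4 only in this case.\<close>
    have "even T \<and> even w"
      using sq[of T] sq[of w] m4' r by (elim disjE conjE) simp_all
    then obtain x y where "T = 2 * x" "w = 2 * y" by blast
    then have "z = lat x y" using T w by (simp add: complex_eq_iff Re_lat Im_lat Im_z e)
    then show ?thesis by auto
  qed
qed

lemma lat_in_carrier [simp]: "lat x y \<in> \<O>"
  by (auto simp: carrier_eq_lat)

lemma carrierE: assumes "z \<in> \<O>" obtains x y where "z = lat x y"
  using assms by (auto simp: carrier_eq_lat)

lemma ring_of_integers_simps: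
  "x \<otimes>\<^bsub>ring_of_integers K\<^esub> y = x * y" "x \<oplus>\<^bsub>ring_of_integers K\<^esub> y = x + y"
  "\<one>\<^bsub>ring_of_integers K\<^esub> = 1" "\<zero>\<^bsub>ring_of_integers K\<^esub> = 0"
  by (simp_all add: ring_of_integers_def)

lemma ring_of_integers_ring: "ring (ring_of_integers K)"
proof -
  have one: "1 \<in> \<O>" and zero: "0 \<in> \<O>" using lat_in_carrier[of 1 0] lat_in_carrier[of 0 0] by (simp_all add: lat_def)
  have add: "x + y \<in> \<O>" and mult: "x * y \<in> \<O>" and neg: "- x \<in> \<O>" if "x \<in> \<O>" "y \<in> \<O>" for x y
    using that by (auto elim!: carrierE simp: lat_add lat_mult lat_uminus)
  show ?thesis
    by (intro ringI abelian_groupI monoidI)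
      (use one zero add mult neg in \<open>auto simp: ring_of_integers_simps algebra_simps intro: bexI[of _ "- _"]\<close>)
qed

text \<open>The ring is generated by \<open>omega\<close> over the integers, so an ideal is just an
  additive group stable under multiplication by \<open>omega\<close>.\<close>

lemma nonzero_ideals_iff:
  "I \<in> nonzero_ideals K \<longleftrightarrow>
     I \<subseteq> \<O> \<and> I \<noteq> {} \<and> I \<noteq> {0} \<and> (\<forall>x\<in>I. \<forall>y\<in>I. x - y \<in> I) \<and> (\<forall>x\<in>I. omega * x \<in> I)"
  (is "_ \<longleftrightarrow> ?P I")
proof
  assume "I \<in> nonzero_ideals K"
  then have I: "ideal I (ring_of_integers K)" and nz: "I \<noteq> {0}" by (auto simp: nonzero_ideals_def)
  interpret ideal I "ring_of_integers K" by (rule I)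
  have sub: "I \<subseteq> \<O>" using a_subset by simp
  have om: "omega = lat 0 1" by (simp add: lat_def)
  have mult: "r * x \<in> I" if "x \<in> I" "r \<in> \<O>" for x r using I_l_closed[OF that] by (simp add: ring_of_integers_simps)
  have neg: "- x \<in> I" if "x \<in> I" for x using mult[OF that lat_in_carrier[of "-1" 0]] by (simp add: lat_def)
  have "x - y \<in> I" if "x \<in> I" "y \<in> I" for x y
    using additive_subgroup.a_closed[OF is_additive_subgroup that(1) neg[OF that(2)]] by (simp add: ring_of_integers_simps)
  moreover have "omega * x \<in> I" if "x \<in> I" for x using mult[OF that, of omega] om by simp
  moreover have "0 \<in> I" using additive_subgroup.zero_closed[OF is_additive_subgroup] by (simp add: ring_of_integers_simps)
  ultimately show "?P I" using sub nz by blast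
next
  assume P: "?P I"
  then obtain z where "z \<in> I" by blast
  have diff: "x - y \<in> I" if "x \<in> I" "y \<in> I" for x y using P that by blast
  have zero: "0 \<in> I" using diff[OF \<open>z \<in> I\<close> \<open>z \<in> I\<close>] by simp
  have neg: "- x \<in> I" if "x \<in> I" for x using diff[OF zero that] by simp
  have add: "x + y \<in> I" if "x \<in> I" "y \<in> I" for x y using diff[OF that(1) neg[OF that(2)]] by simp
  have multn: "of_nat n * x \<in> I" if "x \<in> I" for n x using that by (induction n) (auto simp: zero algebra_simps intro: add)
  have multi: "of_int k * x \<in> I" if "x \<in> I" for k x
    using multn[OF that, of "nat k"] neg[OF multn[OF that, of "nat (-k)"]] by (cases "k \<ge> 0") auto
  have mult: "r * x \<in> I" if "x \<in> I" "r \<in> \<O>" for r x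
  proof -
    obtain a b where "r = lat a b" using \<open>r \<in> \<O>\<close> by (rule carrierE)
    then have "r * x = of_int a * x + of_int b * (omega * x)" by (simp add: lat_def algebra_simps)
    then show ?thesis using that P multi add by auto
  qed
  interpret ring "ring_of_integers K" by (rule ring_of_integers_ring)
  have inv: "\<ominus>\<^bsub>ring_of_integers K\<^esub> x = - x" if "x \<in> \<O>" for x
  proof (rule minus_equality)
    show "- x \<in> \<O>" using that by (auto elim!: carrierE simp: lat_uminus)
  qed (use that in \<open>simp_all add: ring_of_integers_simps\<close>)
  have "ideal I (ring_of_integers K)"
  proof (rule idealI)
    show "subgroup I (add_monoid (ring_of_integers K))"
    proof (rule add.subgroupI)
      show "\<ominus>\<^bsub>ring_of_integers K\<^esub> x \<in> I" if "x \<in> I" for x using that P inv neg by auto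
    qed (use P add in \<open>auto simp: ring_of_integers_simps\<close>)
  qed (use mult in \<open>auto simp: ring_of_integers_simps mult.commute ring_of_integers_ring\<close>)
  then show "I \<in> nonzero_ideals K" using P by (simp add: nonzero_ideals_def)
qed

end

section \<open>Normal form and covolume of an ideal\<close>

lemma equiv_int_multiples:
  fixes c d :: real
  assumes "c > 0" "d > 0" "range (\<lambda>k::int. of_int k * c) = range (\<lambda>k::int. of_int k * d)"
  shows "c = d"
proof -
  have le: "c \<le> d" if c: "c > 0" "d > 0" and eq: "range (\<lambda>k::int. of_int k * c) = range (\<lambda>k::int. of_int k * d)" for c d :: real
  proof -
    have "of_int 1 * d \<in> range (\<lambda>k::int. of_int k * c)" unfolding eq by (rule rangeI)
    then obtain k :: int where k: "d = of_int k * c" by auto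
    then have "k > 0" using c by (metis of_int_0_less_iff zero_less_mult_pos2)
    then have "of_int k \<ge> (1::real)" by simp
    then show ?thesis using c k by simp
  qed
  show ?thesis using le[OF assms] le[OF assms(2,1) assms(3)[symmetric]] by simp
qed

context odd_real_character
begin

text \<open>The lattice spanned by \<open>a\<close> and \<open>t + omega\<close>, multiplied by
  \<open>g\<close>: the Hermite normal form. It is an ideal when \<open>a\<close> divides
  \<open>nf t\<close>, and its norm is then \<open>g ^ 2 * a\<close>.\<close>

definition J :: "int \<Rightarrow> int \<Rightarrow> int \<Rightarrow> complex set" where
  "J g a t = range (\<lambda>(x, y). lat (g * (x * a + y * t)) (g * y))"

lemma J_memE:
  assumes "z \<in> J g a t" obtains x y where "z = lat (g * (x * a + y * t)) (g * y)"
  using assms by (auto simp only: J_def split: prod.splits)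

lemma J_memI: "lat (g * (x * a + y * t)) (g * y) \<in> J g a t"
  unfolding J_def by (rule range_eqI[of _ _ "(x, y)"]) simp

lemma lat_in_J_iff: "lat u v \<in> J 1 a t \<longleftrightarrow> a dvd u - v * t"
proof
  assume "a dvd u - v * t"
  then obtain x where "u - v * t = a * x" by blast
  then have "lat u v = lat (1 * (x * a + v * t)) (1 * v)" by (simp add: algebra_simps)
  then show "lat u v \<in> J 1 a t" using J_memI by metis
next
  assume "lat u v \<in> J 1 a t"
  then obtain x y where "lat u v = lat (1 * (x * a + y * t)) (1 * y)" by (rule J_memE)
  then show "a dvd u - v * t" by simp
qed

lemma J_subset: "J g a t \<subseteq> \<O>" by (auto elim: J_memE)

lemma J_cong: assumes "[s = t] (mod a)" shows "J 1 a s = J 1 a t"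
proof -
  have "a dvd u - v * s \<longleftrightarrow> a dvd u - v * t" for u v
    using assms by (intro cong_dvd_iff cong_diff cong_mult cong_refl)
  then have "lat u v \<in> J 1 a s \<longleftrightarrow> lat u v \<in> J 1 a t" for u v by (simp add: lat_in_J_iff)
  then show ?thesis using J_subset[of 1 a s] J_subset[of 1 a t] by (blast elim: carrierE)
qed

lemma J_scale: "J g a t = (*) (of_int g) ` J 1 a t"
  unfolding J_def image_image by (simp add: lat_scale case_prod_unfold)

lemma J_ideal:
  assumes "g \<noteq> 0" "a > 0" "a dvd nf t"
  shows "J g a t \<in> nonzero_ideals K"
  unfolding nonzero_ideals_iff
proof (intro conjI ballI)
  show "J g a t \<subseteq> \<O>" by (auto simp: J_def)
  have m: "lat (g * (1 * a + 0 * t)) (g * 0) \<in> J g a t" unfolding J_def by (rule range_eqI[of _ _ "(1, 0)"]) simp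
  then show "J g a t \<noteq> {}" by blast
  have "lat (g * (1 * a + 0 * t)) (g * 0) \<noteq> 0" using assms by simp
  then show "J g a t \<noteq> {0}" using m by blast
next
  fix x y assume "x \<in> J g a t" "y \<in> J g a t"
  then obtain u v u' v' where "x = lat (g * (u * a + v * t)) (g * v)" "y = lat (g * (u' * a + v' * t)) (g * v')"
    by (auto simp: J_def)
  then have "x - y = lat (g * ((u - u') * a + (v - v') * t)) (g * (v - v'))" by (simp add: lat_diff algebra_simps)
  then show "x - y \<in> J g a t" unfolding J_def by (intro range_eqI[of _ _ "(u - u', v - v')"]) simp
next
  fix x assume "x \<in> J g a t"
  then obtain u v where x: "x = lat (g * (u * a + v * t)) (g * v)" by (auto simp: J_def)
  obtain c where c: "nf t = a * c" using assms(3) by blast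
  have n0: "n0 = a * c - t ^ 2 - eps * t" using c by (simp add: nf_def)
  have "omega * x = lat 0 1 * x" by (simp add: lat_def)
  also have "\<dots> = lat (g * ((- u * t - v * c) * a + (u * a + v * t + eps * v) * t)) (g * (u * a + v * t + eps * v))"
    unfolding x lat_mult lat_inject n0 by (simp add: algebra_simps power2_eq_square)
  finally show "omega * x \<in> J g a t" unfolding J_def
    by (intro range_eqI[of _ _ "(- u * t - v * c, u * a + v * t + eps * v)"]) simp
qed

text \<open>\<open>A\<close> generates the rational integers in the ideal and \<open>g\<close> the
  second coordinates. Stability under \<open>omega\<close> shows that \<open>g\<close> divides
  \<open>A\<close> and the first coordinate of an element with second coordinate
  \<open>g\<close>.\<close>

lemma ideal_eq_J:
  assumes "I \<in> nonzero_ideals K"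
  shows "\<exists>g a t. g > 0 \<and> a > 0 \<and> t \<in> {0..<a} \<and> a dvd nf t \<and> I = J g a t"
proof -
  have I: "I \<subseteq> \<O>" "I \<noteq> {}" "I \<noteq> {0}" and diff: "\<And>x y. x \<in> I \<Longrightarrow> y \<in> I \<Longrightarrow> x - y \<in> I"
    and om: "\<And>x. x \<in> I \<Longrightarrow> omega * x \<in> I" using assms by (auto simp: nonzero_ideals_iff)
  have om': "lat (- n0 * y) (x + eps * y) \<in> I" if "lat x y \<in> I" for x y
  proof -
    have "omega * lat x y = lat 0 1 * lat x y" by (simp add: lat_def)
    then show ?thesis using om[OF that] by (simp add: lat_mult)
  qed
  obtain z where z: "z \<in> I" using I by blast
  have zero: "0 \<in> I" using diff[OF z z] by simp
  have neg: "- x \<in> I" if "x \<in> I" for x using diff[OF zero that] by simp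
  have add: "x + y \<in> I" if "x \<in> I" "y \<in> I" for x y using diff[OF that(1) neg[OF that(2)]] by simp
  have multn: "of_nat n * x \<in> I" if "x \<in> I" for n x using that by (induction n) (auto simp: zero algebra_simps intro: add)
  have multi: "of_int k * x \<in> I" if "x \<in> I" for k x
    using multn[OF that, of "nat k"] neg[OF multn[OF that, of "nat (-k)"]] by (cases "k \<ge> 0") auto
  have cnj_mult: "lat u v * x \<in> I" if "x \<in> I" for u v x
  proof -
    have "lat u v * x = of_int u * x + of_int v * (omega * x)" by (simp add: lat_def algebra_simps)
    then show ?thesis using multi[OF that] multi[OF om[OF that]] add by simp
  qed
  define S where "S = {n. lat n 0 \<in> I}"
  have S_diff: "x - y \<in> S" if "x \<in> S" "y \<in> S" for x y
    using diff[of "lat x 0" "lat y 0"] that by (simp add: S_def lat_diff)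
  obtain w where w: "w \<in> I" "w \<noteq> 0" using I zero by blast
  then obtain wx wy where wxy: "w = lat wx wy" using I(1) by (meson carrierE subsetD)
  define N where "N = wx ^ 2 + eps * wx * wy + n0 * wy ^ 2"
  have "cnj w * w = lat N 0"
    unfolding wxy cnj_lat lat_mult lat_inject N_def by (simp add: algebra_simps power2_eq_square)
  moreover have "cnj w * w \<in> I" using cnj_mult[OF w(1)] wxy cnj_lat by metis
  ultimately have NS: "N \<in> S" by (simp add: S_def)
  have "of_int N = cmod w ^ 2" by (simp only: wxy norm_lat N_def)
  then have "(of_int N :: real) > 0" using w(2) by simp
  then have "N > 0" by simp
  then obtain A where A: "A > 0" "S = range (\<lambda>k. A * k)" using int_subgroup[of S, OF S_diff NS] by blast
  define T where "T = {n. \<exists>x. lat x n \<in> I}"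
  have T_diff: "x - y \<in> T" if "x \<in> T" "y \<in> T" for x y
    using that diff unfolding T_def by (auto simp: lat_diff[symmetric]) (metis lat_diff)
  have "A * 1 \<in> S" using A(2) by blast
  then have "lat A 0 \<in> I" by (simp add: S_def)
  then have "lat 0 A \<in> I" using om'[of A 0] by simp
  then have AT: "A \<in> T" by (auto simp: T_def)
  then obtain g where g: "g > 0" "T = range (\<lambda>k. g * k)" using int_subgroup[of T, OF T_diff AT A(1)] by blast
  obtain a where a: "A = g * a" using AT g(2) by auto
  have a0: "a > 0" using a A(1) g(1) by (simp add: zero_less_mult_iff)
  have "g * 1 \<in> T" using g(2) by blast
  then obtain x0 where x0: "lat x0 g \<in> I" by (auto simp: T_def)
  have "x0 + eps * g \<in> T" using om'[OF x0] by (auto simp: T_def)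
  then obtain k where "x0 + eps * g = g * k" using g(2) by auto
  then have "x0 = g * (k - eps)" by (simp add: algebra_simps)
  then obtain t0 where t0: "x0 = g * t0" by blast
  define t where "t = t0 mod a"
  have tw: "lat (g * t) g \<in> I"
  proof -
    have "g * t = x0 + A * (- (t0 div a))" by (simp add: t0 a t_def minus_mult_div_eq_mod[symmetric] algebra_simps)
    moreover have "A * (- (t0 div a)) \<in> S" using A(2) by blast
    then have "lat (A * (- (t0 div a))) 0 \<in> I" by (simp only: S_def mem_Collect_eq)
    from add[OF x0 this] have "lat (x0 + A * (- (t0 div a))) g \<in> I" by (simp add: lat_add)
    ultimately show ?thesis by simp
  qed
  \<comment> \<open>Multiplying by the conjugate of \<open>t + omega\<close> puts
    \<open>g * nf t\<close> into the ideal, whence \<open>a\<close> divides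
    \<open>nf t\<close>.\<close>
  have "lat (t + eps) (-1) * lat (g * t) g = lat (g * nf t) 0"
    unfolding lat_mult lat_inject nf_def by (simp add: algebra_simps power2_eq_square)
  then have "lat (g * nf t) 0 \<in> I" using cnj_mult[OF tw] by metis
  then have "g * nf t \<in> S" by (simp add: S_def)
  then have "g * a dvd g * nf t" using A(2) a by auto
  then have dvd: "a dvd nf t" using g(1) by simp
  have "I = J g a t"
  proof (intro equalityI subsetI)
    fix z assume z: "z \<in> I"
    then obtain x y where xy: "z = lat x y" using I(1) by (meson carrierE subsetD)
    then have "y \<in> T" using z by (auto simp: T_def)
    then obtain k where k: "y = g * k" using g(2) by auto
    have "z - of_int k * lat (g * t) g \<in> I" using diff[OF z multi[OF tw]] .
    then have "lat (x - k * (g * t)) 0 \<in> I" by (simp add: xy k lat_scale lat_diff)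
    then have "x - k * (g * t) \<in> S" by (simp add: S_def)
    then obtain l where "x - k * (g * t) = g * a * l" using A(2) a by auto
    then have "x = g * (l * a + k * t)" by (simp add: algebra_simps)
    then show "z \<in> J g a t" unfolding J_def xy k by (intro range_eqI[of _ _ "(l, k)"]) simp
  next
    fix z assume "z \<in> J g a t"
    then obtain x y where "z = lat (g * (x * a + y * t)) (g * y)" by (auto simp: J_def)
    then have "z = of_int x * lat A 0 + of_int y * lat (g * t) g" by (simp add: lat_scale lat_add a algebra_simps)
    then show "z \<in> I" using multi[OF \<open>lat A 0 \<in> I\<close>] multi[OF tw] add by simp
  qed
  then show ?thesis using g(1) a0 dvd by (intro exI[of _ g] exI[of _ a] exI[of _ t]) (simp add: t_def)
qed

lemma J_inject:
  assumes eq: "J g a t = J g' a' t'" and pos: "g > 0" "a > 0" "g' > 0" "a' > 0"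
  shows "g = g' \<and> a = a' \<and> [t = t'] (mod a)"
proof -
  have half: "g' dvd g \<and> g' * a' dvd g * a" if eq: "J g a t = J g' a' t'" for g a t g' a' t'
  proof
    have "lat (g * (0 * a + 1 * t)) (g * 1) \<in> J g' a' t'" using J_memI eq by metis
    then obtain x y where "lat (g * (0 * a + 1 * t)) (g * 1) = lat (g' * (x * a' + y * t')) (g' * y)" by (rule J_memE)
    then show "g' dvd g" by simp
    have "lat (g * (1 * a + 0 * t)) (g * 0) \<in> J g' a' t'" using J_memI eq by metis
    then obtain x y where "lat (g * (1 * a + 0 * t)) (g * 0) = lat (g' * (x * a' + y * t')) (g' * y)" by (rule J_memE)
    then show "g' * a' dvd g * a" by auto
  qed
  have gg: "g = g'" using half[OF eq] half[OF eq[symmetric]] pos by (simp add: zdvd_antisym_nonneg)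
  have "g * a = g' * a'" using half[OF eq] half[OF eq[symmetric]] pos by (simp add: zdvd_antisym_nonneg)
  then have aa: "a = a'" using gg pos by simp
  have "lat (g * (0 * a + 1 * t)) (g * 1) \<in> J g a t'" using J_memI eq gg aa by metis
  then obtain x y where "lat (g * (0 * a + 1 * t)) (g * 1) = lat (g * (x * a + y * t')) (g * y)" by (rule J_memE)
  then have "t = x * a + t'" using pos by simp
  then have "[t = t'] (mod a)" by (simp add: cong_def)
  then show ?thesis using gg aa by simp
qed

text \<open>The oriented areas of the parallelograms spanned by two elements of an ideal are the multiples of
  its covolume. The norm of an ideal is its covolume, relative to that of the ring of integers; in this
  form it visibly scales with the square of the modulus under multiplication by a complex number.\<close>

definition areas :: "complex set \<Rightarrow> real set" where
  "areas I = {Im (cnj x * y) | x y. x \<in> I \<and> y \<in> I}"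

lemma areas_J: "areas (J g a t) = range (\<lambda>k::int. of_int k * (of_int (g ^ 2 * a) * (sqrt (of_nat q) / 2)))"
proof -
  have area: "Im (cnj (lat x y) * lat u v) = of_int (x * v - y * u) * (sqrt (of_nat q) / 2)" for x y u v
    unfolding cnj_lat lat_mult Im_lat by (simp add: algebra_simps)
  have area': "Im (cnj (lat (g * (x * a + y * t)) (g * y)) * lat (g * (u * a + v * t)) (g * v)) =
      of_int (x * v - y * u) * (of_int (g ^ 2 * a) * (sqrt (of_nat q) / 2))" for x y u v
    unfolding area by (simp add: algebra_simps power2_eq_square)
  show ?thesis
  proof (intro equalityI subsetI)
    fix r assume "r \<in> areas (J g a t)"
    then show "r \<in> range (\<lambda>k::int. of_int k * (of_int (g ^ 2 * a) * (sqrt (of_nat q) / 2)))"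
      unfolding areas_def J_def using area' by fastforce
  next
    fix r assume "r \<in> range (\<lambda>k::int. of_int k * (of_int (g ^ 2 * a) * (sqrt (of_nat q) / 2)))"
    then obtain k :: int where r: "r = of_int k * (of_int (g ^ 2 * a) * (sqrt (of_nat q) / 2))" by blast
    have "r = Im (cnj (lat (g * (1 * a + 0 * t)) (g * 0)) * lat (g * (0 * a + k * t)) (g * k))"
      unfolding area' r by simp
    moreover have "lat (g * (1 * a + 0 * t)) (g * 0) \<in> J g a t" "lat (g * (0 * a + k * t)) (g * k) \<in> J g a t"
      unfolding J_def by (rule range_eqI[of _ _ "(1, 0)"], simp, rule range_eqI[of _ _ "(0, k)"], simp)
    ultimately show "r \<in> areas (J g a t)" unfolding areas_def by blast
  qed
qed

lemma areas_scale: "areas ((*) c ` I) = (*) (cmod c ^ 2) ` areas I"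
proof -
  have "Im (cnj (c * x) * (c * y)) = cmod c ^ 2 * Im (cnj x * y)" for x y
  proof -
    have "cnj (c * x) * (c * y) = of_real (cmod c ^ 2) * (cnj x * y)"
      unfolding complex_norm_square by (simp add: mult_ac)
    then show ?thesis by (simp only: times_complex.sel Re_complex_of_real Im_complex_of_real)
  qed
  moreover have "areas ((*) c ` I) = {Im (cnj (c * x) * (c * y)) | x y. x \<in> I \<and> y \<in> I}"
    unfolding areas_def by blast
  ultimately show ?thesis unfolding areas_def by auto
qed

text \<open>Multiplication by \<open>c\<close> scales all areas by the square of its modulus, and
  the positive generator of the group of areas is determined by the group.\<close>

lemma J_norm_unique:
  assumes "(*) c ` J g a t = J g' a' t'" "c \<noteq> 0" "g > 0" "a > 0" "g' > 0" "a' > 0"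
  shows "of_int (g' ^ 2 * a') = cmod c ^ 2 * of_int (g ^ 2 * a)"
proof -
  let ?s = "sqrt (of_nat q) / 2"
  have "range (\<lambda>k::int. of_int k * (of_int (g' ^ 2 * a') * ?s)) =
      range (\<lambda>k::int. of_int k * (cmod c ^ 2 * of_int (g ^ 2 * a) * ?s))"
    using areas_scale[of c "J g a t"] unfolding assms(1) areas_J image_image by (simp add: mult_ac)
  then have "of_int (g' ^ 2 * a') * ?s = cmod c ^ 2 * of_int (g ^ 2 * a) * ?s"
    using assms sqrt_q_pos by (intro equiv_int_multiples) (simp_all add: zero_less_power)
  then show ?thesis using sqrt_q_pos by simp
qed

subsection \<open>The ideals in a class\<close>

definition R :: "(complex set \<times> complex set) set" where "R = ideal_class_rel K"

lemma R_iff: "(I, I') \<in> R \<longleftrightarrow> I \<in> nonzero_ideals K \<and> I' \<in> nonzero_ideals K \<and>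
    (\<exists>a\<in>\<O> - {0}. \<exists>b\<in>\<O> - {0}. (*) a ` I = (*) b ` I')"
  by (simp add: R_def ideal_class_rel_def)

lemma carrier_mult_nz: "x \<in> \<O> - {0} \<Longrightarrow> y \<in> \<O> - {0} \<Longrightarrow> x * y \<in> \<O> - {0}"
  by (auto elim!: carrierE simp: lat_mult simp del: lat_eq_0)

lemma R_equiv: "equiv (nonzero_ideals K) R"
proof (rule equivI)
  show "R \<subseteq> nonzero_ideals K \<times> nonzero_ideals K" by (auto simp: R_iff)
  have one: "1 \<in> \<O> - {0}" using lat_in_carrier[of 1 0] by (simp add: lat_def)
  have "(I, I) \<in> R" if "I \<in> nonzero_ideals K" for I unfolding R_iff using that one by blast
  then show "refl_on (nonzero_ideals K) R" by (simp add: refl_on_def)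
  show "sym R" unfolding sym_def R_iff by metis
  show "trans R"
  proof (rule transI)
    fix I1 I2 I3 assume 12: "(I1, I2) \<in> R" and 23: "(I2, I3) \<in> R"
    obtain a b where ab: "a \<in> \<O> - {0}" "b \<in> \<O> - {0}" "(*) a ` I1 = (*) b ` I2"
      using 12 unfolding R_iff by blast
    obtain c d where cd: "c \<in> \<O> - {0}" "d \<in> \<O> - {0}" "(*) c ` I2 = (*) d ` I3"
      using 23 unfolding R_iff by blast
    have I: "I1 \<in> nonzero_ideals K" "I3 \<in> nonzero_ideals K" using 12 23 unfolding R_iff by blast+
    have "(*) (c * a) ` I1 = (*) c ` (*) a ` I1" by (simp add: image_image mult.assoc)
    also have "\<dots> = (*) b ` (*) c ` I2" unfolding ab(3) by (simp add: image_image mult_ac)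
    also have "\<dots> = (*) (b * d) ` I3" unfolding cd(3) by (simp add: image_image mult.assoc)
    finally show "(I1, I3) \<in> R" unfolding R_iff using I carrier_mult_nz[OF cd(1) ab(1)] carrier_mult_nz[OF ab(2) cd(2)] by blast
  qed
qed

text \<open>For the element alpha of \<open>J 1 a t\<close> with coordinates \<open>p\<close>, this
  is the ideal times the conjugate of alpha, divided by its norm \<open>a\<close>. It is a scalar
  multiple, so it stays in the class, and its norm is the norm of alpha divided by \<open>a\<close>,
  which is the form \<open>qform\<close> of discriminant \<open>-q\<close>.\<close>

definition class_ideal :: "int \<Rightarrow> int \<Rightarrow> int \<times> int \<Rightarrow> complex set" where
  "class_ideal a t p = (*) (cnj (lat (fst p * a + snd p * t) (snd p)) / of_int a) ` J 1 a t"

definition qform :: "int \<Rightarrow> int \<Rightarrow> int \<times> int \<Rightarrow> int" where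
  "qform a t p = a * fst p ^ 2 + (2 * t + eps) * fst p * snd p + (nf t div a) * snd p ^ 2"

end

text \<open>One point from each pair of opposite nonzero points, matching the units 1 and
  -1.\<close>

definition half_plane :: "(int \<times> int) set" where
  "half_plane = {(x, y). y > 0 \<or> y = 0 \<and> x > 0}"

context odd_real_character
begin

context
  fixes a t :: int
  assumes a: "a > 0" "a dvd nf t"
begin

lemma n0_eq: "n0 = a * (nf t div a) - t ^ 2 - eps * t"
  using a by (simp add: nf_def)

lemma norm_J_elem: "cmod (lat (x * a + y * t) y) ^ 2 = of_int (a * qform a t (x, y))"
  unfolding norm_lat of_int_eq_iff qform_def
  by (subst n0_eq) (simp add: algebra_simps power2_eq_square)

lemma class_ideal_elem:
  "cnj (lat (x * a + y * t) y) / of_int a * lat (u * a + v * t) v =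
     lat (x * u * a + x * v * t + y * u * (t + eps) + y * v * (nf t div a)) (x * v - y * u)"
proof -
  have "cnj (lat (x * a + y * t) y) * lat (u * a + v * t) v =
      of_int a * lat (x * u * a + x * v * t + y * u * (t + eps) + y * v * (nf t div a)) (x * v - y * u)"
    unfolding cnj_lat lat_mult lat_scale lat_inject by (subst n0_eq) (simp add: algebra_simps power2_eq_square)
  then show ?thesis using a by (simp add: field_simps)
qed

lemma class_ideal_ideal:
  assumes "p \<noteq> (0, 0)"
  shows "class_ideal a t p \<in> nonzero_ideals K"
proof -
  obtain x y where p: "p = (x, y)" by (cases p)
  define c where "c = cnj (lat (x * a + y * t) y) / of_int a"
  have c0: "c \<noteq> 0" using assms a by (auto simp: c_def p)
  have JI: "J 1 a t \<in> nonzero_ideals K" using J_ideal a by simp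
  have "class_ideal a t p = (*) c ` J 1 a t" by (simp add: class_ideal_def c_def p)
  moreover have "(*) c ` J 1 a t \<in> nonzero_ideals K"
    unfolding nonzero_ideals_iff
  proof (intro conjI ballI)
    show "(*) c ` J 1 a t \<subseteq> \<O>"
      using class_ideal_elem[of x y] by (auto elim!: J_memE simp: c_def)
    show "(*) c ` J 1 a t \<noteq> {}" using JI by (auto simp: nonzero_ideals_iff)
    show "(*) c ` J 1 a t \<noteq> {0}"
    proof
      assume e: "(*) c ` J 1 a t = {0}"
      have "J 1 a t \<subseteq> {0}"
      proof
        fix x assume "x \<in> J 1 a t"
        then have "c * x \<in> {0}" using e by blast
        then show "x \<in> {0}" using c0 by simp
      qed
      then show False using JI by (auto simp: nonzero_ideals_iff)
    qed
  next
    fix u v assume "u \<in> (*) c ` J 1 a t" "v \<in> (*) c ` J 1 a t"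
    then obtain u' v' where "u = c * u'" "v = c * v'" "u' \<in> J 1 a t" "v' \<in> J 1 a t" by blast
    moreover have "u' - v' \<in> J 1 a t" using calculation JI by (auto simp: nonzero_ideals_iff)
    ultimately show "u - v \<in> (*) c ` J 1 a t" by (metis image_eqI right_diff_distrib)
  next
    fix u assume "u \<in> (*) c ` J 1 a t"
    then obtain u' where "u = c * u'" "u' \<in> J 1 a t" by blast
    moreover have "omega * u' \<in> J 1 a t" using calculation JI by (auto simp: nonzero_ideals_iff)
    ultimately show "omega * u \<in> (*) c ` J 1 a t" by (metis image_eqI mult.left_commute)
  qed
  ultimately show ?thesis by simp
qed

lemma class_ideal_related:
  assumes "p \<noteq> (0, 0)"
  shows "(J 1 a t, class_ideal a t p) \<in> R"
proof -
  obtain x y where p: "p = (x, y)" by (cases p)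
  have "(*) (cnj (lat (x * a + y * t) y)) ` J 1 a t = (*) (of_int a) ` class_ideal a t p"
    using a by (simp add: class_ideal_def p image_image)
  moreover have "cnj (lat (x * a + y * t) y) \<in> \<O> - {0}" using assms a by (auto simp: cnj_lat p)
  moreover have "of_int a \<in> \<O> - {0}" using a by (simp add: of_int_lat)
  moreover have "J 1 a t \<in> nonzero_ideals K" using J_ideal a by simp
  ultimately show ?thesis unfolding R_iff using class_ideal_ideal[OF assms] by blast
qed

text \<open>If the ideal is \<open>\<theta>\<close> times \<open>J 1 a t\<close>, then the conjugate
  of \<open>\<theta> * a\<close> is the wanted element: integrality of \<open>\<theta>\<close> times
  \<open>t + omega\<close> says exactly that it lies in \<open>J 1 a t\<close>.\<close>

lemma related_class_ideal:
  assumes "(J 1 a t, I) \<in> R"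
  shows "\<exists>p. p \<noteq> (0, 0) \<and> I = class_ideal a t p"
proof -
  obtain \<alpha> \<beta> where ab: "\<alpha> \<in> \<O> - {0}" "\<beta> \<in> \<O> - {0}" "(*) \<alpha> ` J 1 a t = (*) \<beta> ` I" and I: "I \<in> nonzero_ideals K"
    using assms unfolding R_iff by blast
  define \<theta> where "\<theta> = \<alpha> / \<beta>"
  have \<theta>0: "\<theta> \<noteq> 0" using ab by (simp add: \<theta>_def)
  have "I = (*) (1 / \<beta>) ` (*) \<beta> ` I" using ab by (simp add: image_image)
  also have "\<dots> = (*) \<theta> ` J 1 a t" unfolding ab(3)[symmetric] by (simp add: image_image \<theta>_def)
  finally have I\<theta>: "I = (*) \<theta> ` J 1 a t" .
  have IO: "I \<subseteq> \<O>" using I by (simp add: nonzero_ideals_iff)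
  have "lat a 0 \<in> J 1 a t" "lat t 1 \<in> J 1 a t" by (simp_all add: lat_in_J_iff)
  then have O: "\<theta> * lat a 0 \<in> \<O>" "\<theta> * lat t 1 \<in> \<O>" using IO I\<theta> by blast+
  obtain u v where "\<theta> * lat a 0 = lat u v" using O(1) by (rule carrierE)
  define X Y where "X = u + eps * v" and "Y = - v"
  have \<theta>a: "\<theta> * of_int a = cnj (lat X Y)" using \<open>\<theta> * lat a 0 = lat u v\<close> eps_sq
    by (simp add: cnj_lat X_def Y_def of_int_lat)
  obtain m n where mn: "\<theta> * lat t 1 = lat m n" using O(2) by (rule carrierE)
  have "cnj (lat X Y) * lat t 1 = of_int a * lat m n" using \<theta>a mn by (metis mult.assoc mult.commute)
  then have "X + eps * Y - Y * t - Y * eps = a * n"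
    unfolding cnj_lat lat_mult lat_scale lat_inject by (simp add: algebra_simps)
  then have "X - Y * t = a * n" by (simp add: algebra_simps)
  then have X: "X = n * a + Y * t" by (simp add: algebra_simps)
  have "\<theta> = cnj (lat (n * a + Y * t) Y) / of_int a" using \<theta>a a X by (simp add: field_simps)
  then have "I = class_ideal a t (n, Y)" using I\<theta> by (simp add: class_ideal_def)
  moreover have "(n, Y) \<noteq> (0, 0)"
  proof
    assume "(n, Y) = (0, 0)"
    then have "lat X Y = 0" using X by simp
    then have "\<theta> * of_int a = 0" using \<theta>a by (metis complex_cnj_zero)
    then show False using \<theta>0 a by simp
  qed
  ultimately show ?thesis by blast
qed

lemma class_ideal_uminus: "class_ideal a t (- x, - y) = class_ideal a t (x, y)"
proof -
  have "cnj (lat (- x * a + - y * t) (- y)) / of_int a = - (cnj (lat (x * a + y * t) y) / of_int a)"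
  proof -
    have "lat (- x * a + - y * t) (- y) = - lat (x * a + y * t) y" by (simp add: lat_uminus)
    then show ?thesis by (simp only: complex_cnj_minus minus_divide_left)
  qed
  then have "class_ideal a t (- x, - y) = (*) (cnj (lat (x * a + y * t) y) / of_int a) ` uminus ` J 1 a t"
    unfolding class_ideal_def image_image by simp
  moreover have "- lat u v \<in> J 1 a t \<longleftrightarrow> lat u v \<in> J 1 a t" for u v
  proof -
    have "a dvd - u - - v * t \<longleftrightarrow> a dvd - (u - v * t)" by (simp add: algebra_simps)
    then show ?thesis unfolding lat_uminus lat_in_J_iff by (simp only: dvd_minus_iff)
  qed
  then have "uminus ` J 1 a t = J 1 a t" using J_subset[of 1 a t]
    by (auto elim!: carrierE simp: image_iff) (metis carrierE minus_minus subsetD)+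
  ultimately show ?thesis by (simp add: class_ideal_def)
qed

lemma class_ideal_norm:
  assumes "class_ideal a t p = J g' a' t'" "g' > 0" "a' > 0" "p \<noteq> (0, 0)"
  shows "g' ^ 2 * a' = qform a t p"
proof -
  obtain x y where p: "p = (x, y)" by (cases p)
  define c where "c = cnj (lat (x * a + y * t) y) / of_int a"
  have "c \<noteq> 0" using assms a by (auto simp: c_def p)
  moreover have "(*) c ` J 1 a t = J g' a' t'" using assms by (simp add: class_ideal_def c_def p)
  ultimately have "of_int (g' ^ 2 * a') = cmod c ^ 2 * of_int (1 ^ 2 * a)"
    using assms a by (intro J_norm_unique) auto
  also have "cmod c ^ 2 = of_int (a * qform a t (x, y)) / of_int a ^ 2"
    unfolding c_def norm_divide power_divide complex_mod_cnj norm_J_elem by simp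
  finally have "of_int (g' ^ 2 * a') = (of_int (qform a t p) :: real)"
    using a by (simp add: p power2_eq_square)
  then show ?thesis by (simp only: of_int_eq_iff)
qed

text \<open>A multiplier preserving a lattice is an algebraic integer, and preserving the covolume
  forces modulus 1. For \<open>q > 4\<close> a nonreal element of the ring has norm at least
  \<open>q / 4\<close>, which exceeds 1.\<close>

lemma multiplier_unit:
  assumes q: "q > 4" and u: "(*) u ` J 1 a t = J 1 a t"
  shows "u = 1 \<or> u = -1"
proof -
  have "u \<noteq> 0"
  proof
    assume "u = 0"
    moreover have "lat a 0 \<in> (*) u ` J 1 a t" unfolding u by (simp add: lat_in_J_iff)
    ultimately have "lat a 0 = 0" by (metis imageE mult_zero_left)
    then show False using a by simp
  qed
  then have "of_int (1 ^ 2 * a) = cmod u ^ 2 * of_int (1 ^ 2 * a)"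
    using u a by (intro J_norm_unique) auto
  then have norm1: "cmod u ^ 2 = 1" using a by simp
  have "lat a 0 \<in> J 1 a t" "lat t 1 \<in> J 1 a t" by (simp_all add: lat_in_J_iff)
  then have m: "u * lat a 0 \<in> J 1 a t" "u * lat t 1 \<in> J 1 a t" using u by blast+
  obtain x y where xy: "u * lat a 0 = lat (1 * (x * a + y * t)) (1 * y)" using m(1) by (rule J_memE)
  obtain z w where zw: "u * lat t 1 = lat (1 * (z * a + w * t)) (1 * w)" using m(2) by (rule J_memE)
  have e1: "(u - of_int x) * lat a 0 = of_int y * lat t 1"
    using xy by (simp add: left_diff_distrib lat_scale lat_diff)
  have e2: "(u - of_int w) * lat t 1 = of_int z * lat a 0"
    using zw by (simp add: left_diff_distrib lat_scale lat_diff)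
  \<comment> \<open>Multiplying the two relations yields the characteristic polynomial of
    \<open>u\<close> acting on the basis \<open>a\<close>, \<open>t + omega\<close>.\<close>
  have "(u - of_int x) * (u - of_int w) * (lat a 0 * lat t 1) = of_int (y * z) * (lat a 0 * lat t 1)"
    using arg_cong2[OF e1 e2, of "(*)"] by (simp add: mult_ac)
  then have "(u - of_int x) * (u - of_int w) = of_int (y * z)" using a by simp
  then have "u ^ 2 + of_int (- (x + w)) * u + of_int (x * w - y * z) = 0"
    by (simp add: algebra_simps power2_eq_square)
  then have "algebraic_int u" by (rule monic_quadratic_algebraic_int)
  moreover have "u = lat (x * a + y * t) y / of_int a" using xy a by (simp add: field_simps of_int_lat)
  then have "u \<in> K" using lat_div_in_K by metis
  ultimately have "u \<in> \<O>" by (simp add: ring_of_integers_def)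
  then obtain r s where rs: "u = lat r s" by (rule carrierE)
  have "s = 0"
  proof (rule ccontr)
    assume "s \<noteq> 0"
    then have "s ^ 2 \<ge> 1" by (simp add: int_one_le_iff_zero_less)
    then have "of_int (s ^ 2) \<ge> (1 :: real)" by linarith
    then have "of_int (s ^ 2) * real q \<ge> 1 * real q" by (intro mult_right_mono) auto
    moreover have "real q > 4" using q by simp
    ultimately show False using norm_lat_ge[of s r] norm1 unfolding rs by linarith
  qed
  then have "real_of_int (r ^ 2) = 1" using norm1 unfolding rs norm_lat by simp
  then have "r ^ 2 = 1" by (simp only: of_int_eq_1_iff)
  then show ?thesis using \<open>s = 0\<close> rs by (auto simp: power2_eq_1_iff lat_def)
qed

lemma class_ideal_inj:
  assumes q: "q > 4"
  shows "inj_on (class_ideal a t) half_plane"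
proof (rule inj_onI)
  fix p p' assume hp: "p \<in> half_plane" "p' \<in> half_plane" and eq: "class_ideal a t p = class_ideal a t p'"
  obtain x y x' y' where p: "p = (x, y)" "p' = (x', y')" by (cases p, cases p')
  define v v' where "v = cnj (lat (x * a + y * t) y) / of_int a" and "v' = cnj (lat (x' * a + y' * t) y') / of_int a"
  have nz: "v \<noteq> 0" "v' \<noteq> 0" using hp a by (auto simp: v_def v'_def p half_plane_def)
  have e: "(*) v ` J 1 a t = (*) v' ` J 1 a t" using eq by (simp add: class_ideal_def v_def v'_def p)
  have "(*) (v' / v) ` J 1 a t = (*) (1 / v) ` (*) v' ` J 1 a t" by (simp add: image_image)
  also have "\<dots> = J 1 a t" unfolding e[symmetric] using nz by (simp add: image_image)
  finally have "v' / v = 1 \<or> v' / v = -1" by (rule multiplier_unit[OF q])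
  then have "v' = v \<or> v' = - v" using nz by (auto simp: field_simps)
  then have "cnj (lat (x' * a + y' * t) y') = cnj (lat (x * a + y * t) y) \<or>
      cnj (lat (x' * a + y' * t) y') = cnj (- lat (x * a + y * t) y)"
    using a unfolding v_def v'_def minus_divide_left complex_cnj_minus by (simp only: divide_cancel_right) auto
  then have "lat (x' * a + y' * t) y' = lat (x * a + y * t) y \<or>
      lat (x' * a + y' * t) y' = lat (- (x * a + y * t)) (- y)"
    unfolding complex_cnj_cancel_iff lat_uminus .
  then have "(x' = x \<and> y' = y) \<or> (x' = - x \<and> y' = - y)"
  proof
    assume "lat (x' * a + y' * t) y' = lat (x * a + y * t) y"
    then have e: "x' * a + y' * t = x * a + y * t" and y: "y' = y" unfolding lat_inject by blast+
    have "x' * a = x * a" using e unfolding y by simp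
    then show ?thesis using y a by simp
  next
    assume "lat (x' * a + y' * t) y' = lat (- (x * a + y * t)) (- y)"
    then have e: "x' * a + y' * t = - (x * a + y * t)" and y: "y' = - y" unfolding lat_inject by blast+
    have "x' * a = - x * a" using e unfolding y by (simp add: algebra_simps)
    then have "x' = - x" using a by (metis mult_cancel_right less_irrefl)
    then show ?thesis using y by simp
  qed
  then show "p = p'" using hp by (auto simp: p half_plane_def)
qed

lemma bij_class_ideal:
  assumes q: "q > 4"
  shows "bij_betw (class_ideal a t) half_plane (R `` {J 1 a t})"
  unfolding bij_betw_def
proof (intro conjI equalityI subsetI)
  show "inj_on (class_ideal a t) half_plane" by (rule class_ideal_inj[OF q])
next
  fix I assume "I \<in> class_ideal a t ` half_plane"
  then obtain p where "p \<in> half_plane" "I = class_ideal a t p" by blast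
  then show "I \<in> R `` {J 1 a t}" using class_ideal_related[of p] by (auto simp: half_plane_def)
next
  fix I assume "I \<in> R `` {J 1 a t}"
  then obtain p where p: "p \<noteq> (0, 0)" "I = class_ideal a t p" using related_class_ideal by blast
  obtain x y where xy: "p = (x, y)" by (cases p)
  show "I \<in> class_ideal a t ` half_plane"
  proof (cases "p \<in> half_plane")
    case False
    then have "(- x, - y) \<in> half_plane" using p xy by (auto simp: half_plane_def)
    then show ?thesis using p xy class_ideal_uminus by (metis image_eqI)
  qed (use p in blast)
qed

end

text \<open>The element carrying one ideal to the other has norm \<open>a * a' < q / 4\<close>, too
  small for a nonreal element. So the ideals differ by a rational integer, which is trivial because
  both are primitive.\<close>

lemma small_ideals_unique:
  assumes a: "a > 0" "a dvd nf t" "a' > 0" "a' dvd nf t'" and small: "4 * a * a' < int q"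
    and rel: "(J 1 a t, J 1 a' t') \<in> R"
  shows "a = a' \<and> [t = t'] (mod a)"
proof -
  obtain x y where p: "(x, y) \<noteq> (0, 0)" "J 1 a' t' = class_ideal a t (x, y)"
    using related_class_ideal[OF a(1,2) rel] by (metis surj_pair)
  have "1 ^ 2 * a' = qform a t (x, y)" using a p by (intro class_ideal_norm) auto
  then have "cmod (lat (x * a + y * t) y) ^ 2 = of_int (a * a')" using norm_J_elem[OF a(1,2)] by simp
  then have le: "of_int (y ^ 2) * real q / 4 \<le> of_int (a * a')" using norm_lat_ge by metis
  have y: "y = 0"
  proof (rule ccontr)
    assume "y \<noteq> 0"
    then have "y ^ 2 \<ge> 1" by (simp add: int_one_le_iff_zero_less)
    then have "of_int (y ^ 2) \<ge> (1 :: real)" by linarith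
    then have "of_int (y ^ 2) * real q \<ge> 1 * real q" by (intro mult_right_mono) auto
    moreover have "of_int (4 * a * a') < (of_int (int q) :: real)" using small by (simp only: of_int_less_iff)
    ultimately show False using le by simp
  qed
  have x: "x \<noteq> 0" using p y by simp
  have "class_ideal a t (x, y) = J \<bar>x\<bar> a t"
  proof -
    have abs: "class_ideal a t (x, y) = class_ideal a t (\<bar>x\<bar>, 0)"
      using class_ideal_uminus[OF a(1,2), of x 0] by (auto simp: y abs_if)
    have "cnj (lat (\<bar>x\<bar> * a + 0 * t) 0) / of_int a = of_int \<bar>x\<bar>" using a by (simp add: lat_def)
    then have "class_ideal a t (\<bar>x\<bar>, 0) = (*) (of_int \<bar>x\<bar>) ` J 1 a t"
      by (simp only: class_ideal_def fst_conv snd_conv)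
    then show ?thesis unfolding J_scale[of "\<bar>x\<bar>"] using abs by (simp only:)
  qed
  then have "J 1 a' t' = J \<bar>x\<bar> a t" using p by simp
  then show ?thesis using J_inject[of "\<bar>x\<bar>" a t 1 a' t'] a x by auto
qed

text \<open>The element \<open>t + omega\<close> produces an ideal of norm \<open>nf t div a\<close>
  in the same class. Minimality of \<open>a\<close> will therefore give the inequality between the
  outer coefficients of a reduced form.\<close>

lemma conjugate_related:
  assumes a: "a > 0" "a dvd nf t"
  shows "(J 1 a t, J 1 (nf t div a) (- t - eps)) \<in> R"
proof -
  define c where "c = nf t div a"
  have c: "nf t = a * c" using a by (simp add: c_def)
  have "class_ideal a t (0, 1) = J 1 c (- t - eps)"
  proof -
    have e: "cnj (lat (0 * a + 1 * t) 1) / of_int a * lat (u * a + v * t) v = lat (1 * (v * c + (- u) * (- t - eps))) (1 * (- u))" for u v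
      using class_ideal_elem[OF a, of 0 1 u v] by (simp add: c_def algebra_simps)
    show ?thesis
    proof (intro equalityI subsetI)
      fix z assume "z \<in> class_ideal a t (0, 1)"
      then obtain w where w: "w \<in> J 1 a t" "z = cnj (lat (0 * a + 1 * t) 1) / of_int a * w" by (auto simp: class_ideal_def)
      obtain u v where "w = lat (1 * (u * a + v * t)) (1 * v)" using w(1) by (rule J_memE)
      then show "z \<in> J 1 c (- t - eps)" using e[of u v] J_memI[of 1 v c "-u" "- t - eps"] w by (metis mult_1)
    next
      fix z assume "z \<in> J 1 c (- t - eps)"
      then obtain v u where z: "z = lat (1 * (v * c + u * (- t - eps))) (1 * u)" by (rule J_memE)
      then have "z = cnj (lat (0 * a + 1 * t) 1) / of_int a * lat (- u * a + v * t) v"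
        using e[of "-u" v] by simp
      moreover have "lat (- u * a + v * t) v \<in> J 1 a t" using J_memI[of 1 "-u" a v t] by simp
      ultimately show "z \<in> class_ideal a t (0, 1)"
        unfolding class_ideal_def fst_conv snd_conv by (rule image_eqI)
    qed
  qed
  then show ?thesis using class_ideal_related[OF a, of "(0, 1)"] by (simp add: c_def)
qed

text \<open>Gauss reduction phrased as minimality: \<open>a\<close> is the least norm of a primitive
  ideal in the class, and \<open>t\<close> is shifted so that the middle coefficient is at most
  \<open>a\<close> in absolute value. Such a pair need not be unique, hence the choice in
  \<open>class_rep\<close>.\<close>

definition is_rep :: "complex set set \<Rightarrow> int \<times> int \<Rightarrow> bool" where
  "is_rep C = (\<lambda>(a, t). a > 0 \<and> a dvd nf t \<and> J 1 a t \<in> C \<and> \<bar>2 * t + eps\<bar> \<le> a \<and>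
     (\<forall>a' t'. a' > 0 \<longrightarrow> a' dvd nf t' \<longrightarrow> J 1 a' t' \<in> C \<longrightarrow> a \<le> a'))"

definition ideal_classes :: "complex set set set" where "ideal_classes = nonzero_ideals K // R"

lemma class_number_eq: "class_number K = card ideal_classes"
  by (simp add: class_number_def ideal_classes_def R_def)

lemma class_eq: "C \<in> ideal_classes \<Longrightarrow> I \<in> C \<Longrightarrow> C = R `` {I}"
  unfolding ideal_classes_def using R_equiv by (elim quotientE) (simp add: equiv_class_eq)

lemma class_mem: "I \<in> nonzero_ideals K \<Longrightarrow> R `` {I} \<in> ideal_classes \<and> I \<in> R `` {I}"
  unfolding ideal_classes_def using equiv_class_self[OF R_equiv] by (blast intro: quotientI)

lemma J_in_class:
  assumes "C \<in> ideal_classes"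
  shows "\<exists>a t. a > 0 \<and> a dvd nf t \<and> J 1 a t \<in> C"
proof -
  obtain I where I: "I \<in> nonzero_ideals K" "C = R `` {I}" using assms unfolding ideal_classes_def by (elim quotientE)
  obtain g a t where gat: "g > 0" "a > 0" "a dvd nf t" "I = J g a t" using ideal_eq_J[OF I(1)] by blast
  have "(*) (lat 1 0) ` I = (*) (lat g 0) ` J 1 a t"
    unfolding gat(4) J_scale[of g] by (simp add: lat_def)
  moreover have "lat 1 0 \<in> \<O> - {0}" "lat g 0 \<in> \<O> - {0}" using gat by auto
  moreover have "J 1 a t \<in> nonzero_ideals K" using gat by (intro J_ideal) auto
  ultimately have "(I, J 1 a t) \<in> R" unfolding R_iff using I(1) by blast
  then show ?thesis using gat I by blast
qed

lemma rep_exists: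
  assumes C: "C \<in> ideal_classes"
  shows "\<exists>p. is_rep C p"
proof -
  define P where "P n \<longleftrightarrow> (\<exists>t. int n > 0 \<and> int n dvd nf t \<and> J 1 (int n) t \<in> C)" for n
  have ex: "\<exists>n. P n"
  proof -
    obtain a t where "a > 0" "a dvd nf t" "J 1 a t \<in> C" using J_in_class[OF C] by blast
    then have "P (nat a)" by (auto simp: P_def)
    then show ?thesis by blast
  qed
  define n where "n = (LEAST n. P n)"
  have "P n" unfolding n_def using ex by (rule LeastI_ex)
  then obtain t where t: "int n > 0" "int n dvd nf t" "J 1 (int n) t \<in> C" by (auto simp: P_def)
  have least: "int n \<le> a'" if "a' > 0" "a' dvd nf t'" "J 1 a' t' \<in> C" for a' t'
  proof -
    have "P (nat a')" using that by (auto simp: P_def)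
    then have "n \<le> nat a'" unfolding n_def by (rule Least_le)
    then show ?thesis using that(1) by linarith
  qed
  define r where "r = t mod int n"
  \<comment> \<open>The residue of \<open>t\<close> is moved so that \<open>2 * s + eps\<close> lies
    between \<open>- n\<close> and \<open>n\<close>.\<close>
  define s where "s = (if 2 * r + eps \<le> int n then r else r - int n)"
  have r: "0 \<le> r" "r < int n" using t by (simp_all add: r_def)
  have cong: "[s = t] (mod int n)" by (simp add: s_def r_def cong_def mod_diff_left_eq)
  have "\<bar>2 * s + eps\<bar> \<le> int n" using r eps_cases by (auto simp: s_def)
  moreover have "int n dvd nf s" using t(2) nf_dvd_cong[OF cong] by simp
  moreover have "J 1 (int n) s \<in> C" using t(3) J_cong[OF cong] by simp
  ultimately have "is_rep C (int n, s)" unfolding is_rep_def using t least by auto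
  then show ?thesis by blast
qed

definition class_rep :: "complex set set \<Rightarrow> int \<times> int" where
  "class_rep C = (SOME p. is_rep C p)"

definition reps :: "(int \<times> int) set" where "reps = class_rep ` ideal_classes"

lemma class_rep: "C \<in> ideal_classes \<Longrightarrow> is_rep C (class_rep C)"
  unfolding class_rep_def by (rule someI_ex) (rule rep_exists)

lemma is_rep_class: "C \<in> ideal_classes \<Longrightarrow> is_rep C (a, t) \<Longrightarrow> C = R `` {J 1 a t}"
  by (rule class_eq) (auto simp: is_rep_def)

lemma repsE:
  assumes "p \<in> reps"
  obtains a t where "p = (a, t)" "R `` {J 1 a t} \<in> ideal_classes" "is_rep (R `` {J 1 a t}) (a, t)"
    "class_rep (R `` {J 1 a t}) = (a, t)"
proof -
  obtain C where C: "C \<in> ideal_classes" "p = class_rep C" using assms by (auto simp: reps_def)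
  obtain a t where p: "p = (a, t)" by (cases p)
  have "is_rep C (a, t)" using class_rep[OF C(1)] C(2) p by simp
  then have "C = R `` {J 1 a t}" using is_rep_class C by blast
  then show ?thesis using that p C \<open>is_rep C (a, t)\<close> by metis
qed

lemma inj_class_rep: "inj_on class_rep ideal_classes"
proof (rule inj_onI)
  fix C D assume CD: "C \<in> ideal_classes" "D \<in> ideal_classes" "class_rep C = class_rep D"
  obtain a t where p: "class_rep C = (a, t)" by (cases "class_rep C")
  have "C = R `` {J 1 a t}" using is_rep_class[OF CD(1)] class_rep[OF CD(1)] p by simp
  moreover have "D = R `` {J 1 a t}" using is_rep_class[OF CD(2)] class_rep[OF CD(2)] p CD(3) by simp
  ultimately show "C = D" by simp
qed

text \<open>Minimality against the ideal of \<open>conjugate_related\<close> gives the fourth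
  inequality. The last one follows from the discriminant relation, since the square of the middle
  coefficient is at most \<open>a ^ 2\<close>.\<close>

lemma reps_reduced:
  assumes "(a, t) \<in> reps"
  shows "a > 0" "a dvd nf t" "\<bar>2 * t + eps\<bar> \<le> a" "a \<le> nf t div a"
    "4 * a * (nf t div a) = (2 * t + eps) ^ 2 + int q" "3 * a ^ 2 \<le> int q"
proof -
  have r: "is_rep (R `` {J 1 a t}) (a, t)" using assms by (rule repsE) auto
  show a: "a > 0" "a dvd nf t" and b: "\<bar>2 * t + eps\<bar> \<le> a" using r by (auto simp: is_rep_def)
  show eq: "4 * a * (nf t div a) = (2 * t + eps) ^ 2 + int q"
    using four_nf[of t] a by (simp add: mult.assoc)
  have nf: "nf t div a > 0" using nf_pos[of t] a by (metis dvd_div_mult_self zero_less_mult_pos2)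
  have "nf (- t - eps) = nf t" by (simp add: nf_def algebra_simps power2_eq_square)
  then have "nf t div a dvd nf (- t - eps)" using a by (metis dvd_div_mult_self dvd_triv_left)
  moreover have "J 1 (nf t div a) (- t - eps) \<in> R `` {J 1 a t}" using conjugate_related[OF a] by simp
  ultimately show le: "a \<le> nf t div a" using r nf by (auto simp: is_rep_def)
  have "(2 * t + eps) ^ 2 \<le> a ^ 2" using b a by (simp add: abs_le_square_iff[symmetric])
  moreover have "4 * a * a \<le> 4 * a * (nf t div a)" using le a by (intro mult_left_mono) auto
  ultimately show "3 * a ^ 2 \<le> int q" using eq by (simp add: power2_eq_square)
qed

lemma finite_reps: "finite reps"
proof (rule finite_subset)
  show "reps \<subseteq> {0..int q} \<times> {- int q - 1..int q + 1}"
  proof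
    fix p assume p: "p \<in> reps"
    obtain a t where at: "p = (a, t)" by (cases p)
    note r = reps_reduced[of a t, OF p[unfolded at]]
    have "a \<le> a ^ 2" using r(1) by (intro self_le_power) auto
    then have "a \<le> int q" using r(6) r(1) by linarith
    then show "p \<in> {0..int q} \<times> {- int q - 1..int q + 1}" using r(1,3) eps_cases unfolding at by auto
  qed
qed auto

lemma card_reps: "card reps = class_number K"
  unfolding reps_def class_number_eq by (rule card_image) (rule inj_class_rep)

definition small_ideals :: "(int \<times> int) set" where
  "small_ideals = {(a, t). a > 0 \<and> 0 \<le> t \<and> t < a \<and> a dvd nf t \<and> 4 * a ^ 2 < int q}"

text \<open>A class contains at most one primitive ideal of norm below half the square root of
  \<open>q\<close>, and if it has one, that is its ideal of minimal norm. Reduction of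
  \<open>t\<close> modulo \<open>a\<close> bridges the two normalisations of the root.\<close>

lemma bij_small_ideals:
  "bij_betw (\<lambda>(a, t). (a, t mod a)) {p \<in> reps. 4 * fst p ^ 2 < int q} small_ideals"
  unfolding bij_betw_def
proof (intro conjI inj_onI equalityI subsetI)
  fix p p' assume p: "p \<in> {p \<in> reps. 4 * fst p ^ 2 < int q}" "p' \<in> {p \<in> reps. 4 * fst p ^ 2 < int q}"
    "(\<lambda>(a, t). (a, t mod a)) p = (\<lambda>(a, t). (a, t mod a)) p'"
  obtain a t where at: "p = (a, t)" "class_rep (R `` {J 1 a t}) = (a, t)" using p(1) by (auto elim: repsE)
  obtain a' t' where at': "p' = (a', t')" "class_rep (R `` {J 1 a' t'}) = (a', t')" using p(2) by (auto elim: repsE)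
  have "a = a'" "[t = t'] (mod a)" using p(3) by (auto simp: at at' cong_def)
  then have "J 1 a t = J 1 a' t'" using J_cong by simp
  then show "p = p'" unfolding at(1) at'(1) at(2)[symmetric] at'(2)[symmetric] by (simp only:)
next
  fix p assume "p \<in> (\<lambda>(a, t). (a, t mod a)) ` {p \<in> reps. 4 * fst p ^ 2 < int q}"
  then obtain a t where at: "(a, t) \<in> reps" "4 * a ^ 2 < int q" "p = (a, t mod a)" by auto
  note r = reps_reduced[OF at(1)]
  have "a dvd nf (t mod a)" using r(2) nf_dvd_cong[of "t mod a" t a] by simp
  then show "p \<in> small_ideals" using r at by (simp add: small_ideals_def)
next
  fix p assume "p \<in> small_ideals"
  then obtain a t where at: "p = (a, t)" "a > 0" "t \<in> {0..<a}" "a dvd nf t" "4 * a ^ 2 < int q"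
    by (auto simp: small_ideals_def)
  have JI: "J 1 a t \<in> nonzero_ideals K" using at by (intro J_ideal) auto
  define C where "C = R `` {J 1 a t}"
  have C: "C \<in> ideal_classes" "J 1 a t \<in> C" using class_mem[OF JI] by (auto simp: C_def)
  obtain a0 t0 where p0: "class_rep C = (a0, t0)" by (cases "class_rep C")
  have r: "is_rep C (a0, t0)" using class_rep[OF C(1)] p0 by simp
  have le: "a0 \<le> a" and a0: "a0 > 0" "a0 dvd nf t0" "J 1 a0 t0 \<in> C" using r C at by (auto simp: is_rep_def)
  have "4 * a * a0 \<le> 4 * a * a" using le at by (intro mult_left_mono) auto
  then have "4 * a * a0 < int q" using at(5) by (simp add: power2_eq_square)
  moreover have "(J 1 a t, J 1 a0 t0) \<in> R" using a0(3) by (simp add: C_def)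
  ultimately have eq: "a = a0" "[t = t0] (mod a)" using small_ideals_unique[OF at(2,4) a0(1,2)] by auto
  have "(a0, t0) \<in> reps" using C p0 unfolding reps_def by (metis image_eqI)
  moreover have "p = (a0, t0 mod a0)" using at eq by (simp add: cong_def)
  ultimately show "p \<in> (\<lambda>(a, t). (a, t mod a)) ` {p \<in> reps. 4 * fst p ^ 2 < int q}"
    using at eq by (intro image_eqI[of _ _ "(a0, t0)"]) auto
qed

lemma finite_small_ideals: "finite small_ideals"
  using bij_betw_finite[OF bij_small_ideals] finite_reps by simp

text \<open>The later lower bounds for the class number all come from exhibiting primitive ideals of
  small norm and applying this inequality.\<close>

lemma card_small_ideals: "card small_ideals \<le> class_number K"
  using bij_betw_same_card[OF bij_small_ideals] card_mono[OF finite_reps, of "{p \<in> reps. 4 * fst p ^ 2 < int q}"] card_reps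
  by simp

section \<open>Enumeration of all ideals by class\<close>

definition ideal_params :: "(int \<times> int \<times> int) set" where
  "ideal_params = {(g, a, t). g > 0 \<and> a > 0 \<and> 0 \<le> t \<and> t < a \<and> a dvd nf t}"

lemma bij_J: "bij_betw (\<lambda>(g, a, t). J g a t) ideal_params (nonzero_ideals K)"
  unfolding bij_betw_def
proof (intro conjI inj_onI equalityI subsetI)
  fix p p' assume p: "p \<in> ideal_params" "p' \<in> ideal_params" "(\<lambda>(g, a, t). J g a t) p = (\<lambda>(g, a, t). J g a t) p'"
  obtain g a t g' a' t' where gat: "p = (g, a, t)" "p' = (g', a', t')" by (cases p, cases p')
  then have "g = g' \<and> a = a' \<and> [t = t'] (mod a)" using p by (intro J_inject) (auto simp: ideal_params_def)
  then show "p = p'" using p by (auto simp: gat ideal_params_def cong_def)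
next
  fix I assume "I \<in> (\<lambda>(g, a, t). J g a t) ` ideal_params"
  then show "I \<in> nonzero_ideals K" by (auto simp: ideal_params_def intro!: J_ideal)
next
  fix I assume "I \<in> nonzero_ideals K"
  then obtain g a t where "g > 0" "a > 0" "t \<in> {0..<a}" "a dvd nf t" "I = J g a t" using ideal_eq_J by blast
  then show "I \<in> (\<lambda>(g, a, t). J g a t) ` ideal_params"
    by (intro image_eqI[of _ _ "(g, a, t)"]) (auto simp: ideal_params_def)
qed

lemma bij_reps_class_ideal:
  assumes q: "q > 4"
  shows "bij_betw (\<lambda>((a, t), p). class_ideal a t p) (reps \<times> half_plane) (nonzero_ideals K)"
  unfolding bij_betw_def
proof (intro conjI inj_onI equalityI subsetI)
  have cls: "class_ideal a t p \<in> R `` {J 1 a t}" if "(a, t) \<in> reps" "p \<in> half_plane" for a t p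
    using bij_class_ideal[OF reps_reduced(1,2)[OF that(1)] q] that(2) by (auto simp: bij_betw_def)
  fix z z' assume z: "z \<in> reps \<times> half_plane" "z' \<in> reps \<times> half_plane"
    "(\<lambda>((a, t), p). class_ideal a t p) z = (\<lambda>((a, t), p). class_ideal a t p) z'"
  obtain a t p a' t' p' where zz: "z = ((a, t), p)" "z' = ((a', t'), p')" by (metis surj_pair)
  have at: "(a, t) \<in> reps" "(a', t') \<in> reps" "p \<in> half_plane" "p' \<in> half_plane" using z zz by auto
  have r: "R `` {J 1 a t} \<in> ideal_classes" "class_rep (R `` {J 1 a t}) = (a, t)" using at(1) by (auto elim: repsE)
  have r': "R `` {J 1 a' t'} \<in> ideal_classes" "class_rep (R `` {J 1 a' t'}) = (a', t')" using at(2) by (auto elim: repsE)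
  have e: "class_ideal a t p = class_ideal a' t' p'" using z(3) zz by simp
  have "R `` {J 1 a t} = R `` {class_ideal a t p}" using class_eq[OF r(1) cls[OF at(1,3)]] .
  also have "\<dots> = R `` {J 1 a' t'}" unfolding e using class_eq[OF r'(1) cls[OF at(2,4)]] by simp
  finally have at_eq: "(a, t) = (a', t')" unfolding r(2)[symmetric] r'(2)[symmetric] by (simp only:)
  then have "p = p'" using e at class_ideal_inj[OF reps_reduced(1,2)[OF at(1)] q] by (auto dest: inj_onD)
  then show "z = z'" using at_eq zz by simp
next
  fix I assume "I \<in> (\<lambda>((a, t), p). class_ideal a t p) ` (reps \<times> half_plane)"
  then obtain a t p where at: "(a, t) \<in> reps" "p \<in> half_plane" "I = class_ideal a t p" by auto
  then show "I \<in> nonzero_ideals K"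
    using class_ideal_ideal[OF reps_reduced(1,2)[OF at(1)]] by (auto simp: half_plane_def)
next
  fix I assume I: "I \<in> nonzero_ideals K"
  define C where "C = R `` {I}"
  have C: "C \<in> ideal_classes" "I \<in> C" using class_mem[OF I] by (auto simp: C_def)
  obtain a t where at: "class_rep C = (a, t)" by (cases "class_rep C")
  then have mem: "(a, t) \<in> reps" using C unfolding reps_def by (metis image_eqI)
  have "C = R `` {J 1 a t}" using is_rep_class[OF C(1)] class_rep[OF C(1)] at by simp
  then have "I \<in> class_ideal a t ` half_plane"
    using C(2) bij_class_ideal[OF reps_reduced(1,2)[OF mem] q] by (simp add: bij_betw_def)
  then obtain p where "p \<in> half_plane" "I = class_ideal a t p" by blast
  then show "I \<in> (\<lambda>((a, t), p). class_ideal a t p) ` (reps \<times> half_plane)"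
    using mem by (intro image_eqI[of _ _ "((a, t), p)"]) auto
qed

text \<open>Both sides parametrise the nonzero ideals, one by the normal form and the other by a
  class and an element of its representative. Matching norms with values of the forms turns a
  Dirichlet series over ideals into a sum of Epstein zeta functions.\<close>

theorem ideals_by_class:
  assumes q: "q > 4"
  shows "\<exists>\<psi>. bij_betw \<psi> ideal_params (reps \<times> half_plane) \<and>
     (\<forall>(g, a, t) \<in> ideal_params. \<forall>b s p. \<psi> (g, a, t) = ((b, s), p) \<longrightarrow> qform b s p = g ^ 2 * a)"
proof -
  let ?f = "\<lambda>(g, a, t). J g a t" and ?h = "\<lambda>((a, t), p). class_ideal a t p"
  define \<psi> where "\<psi> = the_inv_into (reps \<times> half_plane) ?h \<circ> ?f"
  have bij: "bij_betw \<psi> ideal_params (reps \<times> half_plane)"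
    unfolding \<psi>_def by (rule bij_betw_trans[OF bij_J bij_betw_the_inv_into[OF bij_reps_class_ideal[OF q]]])
  have "qform b s p = g ^ 2 * a" if gat: "(g, a, t) \<in> ideal_params" and \<psi>: "\<psi> (g, a, t) = ((b, s), p)" for g a t b s p
  proof -
    have mem: "((b, s), p) \<in> reps \<times> half_plane" using bij gat \<psi> by (metis bij_betw_apply)
    have "J g a t \<in> nonzero_ideals K" using bij_J gat by (auto simp: bij_betw_def)
    then have "?h (\<psi> (g, a, t)) = J g a t"
      unfolding \<psi>_def using f_the_inv_into_f_bij_betw[OF bij_reps_class_ideal[OF q]] by simp
    then have "class_ideal b s p = J g a t" using \<psi> by simp
    then have "g ^ 2 * a = qform b s p"
      using mem gat reps_reduced(1,2)[of b s] by (intro class_ideal_norm) (auto simp: ideal_params_def half_plane_def)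
    then show ?thesis by simp
  qed
  then show ?thesis using bij by blast
qed

end

section \<open>Zeta and L-functions\<close>

text \<open>Any two continuations agree where the series converges, hence on their common
  half-plane, which stays connected after a single point is removed. So the description in the
  definition is met by one value only.\<close>

lemma dirichlet_series_continuation_eq:
  assumes P: "P \<subseteq> {1}" and f: "f holomorphic_on ({z. c < Re z} - P)"
    and sums: "\<And>z. 1 < Re z \<Longrightarrow> (\<lambda>n. a (Suc n) / of_nat (Suc n) powr z) sums f z"
    and s: "s \<in> {z. c < Re z} - P"
  shows "dirichlet_series_continuation P a s = f s"
  unfolding dirichlet_series_continuation_def
proof (rule the_equality)
  show "\<exists>c f'. s \<in> {z. c < Re z} - P \<and> f' holomorphic_on ({z. c < Re z} - P) \<and>
      (\<forall>z. 1 < Re z \<longrightarrow> (\<lambda>n. a (Suc n) / of_nat (Suc n) powr z) sums f' z) \<and> f s = f' s"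
    using f sums s by blast
next
  fix w
  assume "\<exists>c f'. s \<in> {z. c < Re z} - P \<and> f' holomorphic_on ({z. c < Re z} - P) \<and>
      (\<forall>z. 1 < Re z \<longrightarrow> (\<lambda>n. a (Suc n) / of_nat (Suc n) powr z) sums f' z) \<and> w = f' s"
  then obtain c' f' where f': "s \<in> {z. c' < Re z} - P" "f' holomorphic_on ({z. c' < Re z} - P)"
    "\<And>z. 1 < Re z \<Longrightarrow> (\<lambda>n. a (Suc n) / of_nat (Suc n) powr z) sums f' z" "w = f' s" by blast
  define m where "m = max c c'"
  define M where "M = max 1 m"
  have fin: "finite P" using P finite_subset by blast
  have "f' s = f s"
  proof (rule analytic_continuation_open[where s = "{z. M < Re z}" and s' = "{z. m < Re z} - P" and f = f' and g = f and z = s])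
    show "open {z. M < Re z}" by (rule open_halfspace_Re_gt)
    show "open ({z. m < Re z} - P)" by (intro open_Diff open_halfspace_Re_gt finite_imp_closed fin)
    have "of_real (M + 1) \<in> {z. M < Re z}" by simp
    then show "{z. M < Re z} \<noteq> {}" by blast
    have "connected {z. m < Re z}" by (intro convex_connected convex_halfspace_Re_gt)
    then show "connected ({z. m < Re z} - P)"
      by (intro connected_open_delete_finite open_halfspace_Re_gt fin) auto
    show "{z. M < Re z} \<subseteq> {z. m < Re z} - P" using P by (auto simp: M_def)
    show "f' holomorphic_on ({z. m < Re z} - P)" by (rule holomorphic_on_subset[OF f'(2)]) (auto simp: m_def)
    show "f holomorphic_on ({z. m < Re z} - P)" by (rule holomorphic_on_subset[OF f]) (auto simp: m_def)
    show "f' z = f z" if "z \<in> {z. M < Re z}" for z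
      using that f'(3)[of z] sums[of z] sums_unique2 by (auto simp: M_def)
    show "s \<in> {z. m < Re z} - P" using s f'(1) by (auto simp: m_def)
  qed
  then show "w = f s" using f' by simp
qed

text \<open>The Weierstrass M-test on a small closed disc makes the sum a locally uniform limit of
  finite sums.\<close>

lemma holomorphic_infsum:
  fixes f :: "'i \<Rightarrow> complex \<Rightarrow> complex"
  assumes U: "open U" and hol: "\<And>i. i \<in> A \<Longrightarrow> f i holomorphic_on U"
    and bound: "\<And>z. z \<in> U \<Longrightarrow> \<exists>V M. open V \<and> z \<in> V \<and> M summable_on A \<and> (\<forall>i\<in>A. \<forall>w\<in>V. norm (f i w) \<le> M i)"
  shows "(\<lambda>z. \<Sum>\<^sub>\<infinity>i\<in>A. f i z) holomorphic_on U"
proof (rule holomorphic_on_open[THEN iffD2, OF U], intro ballI)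
  fix z assume z: "z \<in> U"
  obtain V M where V: "open V" "z \<in> V" and M: "M summable_on A" "\<And>i w. i \<in> A \<Longrightarrow> w \<in> V \<Longrightarrow> norm (f i w) \<le> M i"
    using bound[OF z] by blast
  obtain r where r: "r > 0" "cball z r \<subseteq> U \<inter> V"
    using open_contains_cball[of "U \<inter> V"] U V z by blast
  have ul: "uniform_limit (cball z r) (\<lambda>X z. \<Sum>i\<in>X. f i z) (\<lambda>z. \<Sum>\<^sub>\<infinity>i\<in>A. f i z) (finite_subsets_at_top A)"
    using M r by (intro Weierstrass_m_test_general[where M = M]) auto
  have ev: "\<forall>\<^sub>F X in finite_subsets_at_top A. continuous_on (cball z r) (\<lambda>z. \<Sum>i\<in>X. f i z) \<and>
      (\<lambda>z. \<Sum>i\<in>X. f i z) holomorphic_on ball z r"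
  proof (rule eventually_finite_subsets_at_top_weakI)
    fix X assume X: "finite X" "X \<subseteq> A"
    have "(\<lambda>z. \<Sum>i\<in>X. f i z) holomorphic_on U" using X hol by (intro holomorphic_on_sum) auto
    then show "continuous_on (cball z r) (\<lambda>z. \<Sum>i\<in>X. f i z) \<and> (\<lambda>z. \<Sum>i\<in>X. f i z) holomorphic_on ball z r"
      using r by (meson Int_subset_iff ball_subset_cball dual_order.trans holomorphic_on_imp_continuous_on holomorphic_on_subset)
  qed
  have "(\<lambda>z. \<Sum>\<^sub>\<infinity>i\<in>A. f i z) holomorphic_on ball z r"
    using holomorphic_uniform_limit[OF ev ul] by (metis finite_subsets_at_top_neq_bot)
  then show "\<exists>f'. ((\<lambda>z. \<Sum>\<^sub>\<infinity>i\<in>A. f i z) has_field_derivative f') (at z)"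
    using r by (metis centre_in_ball field_differentiable_def holomorphic_on_imp_differentiable_at open_ball)
qed

section \<open>Elementary bounds for complex powers and their sums\<close>

lemma vector_derivative_bound:
  fixes f :: "real \<Rightarrow> complex"
  assumes "\<And>t. t \<in> {a..b} \<Longrightarrow> (f has_vector_derivative f' t) (at t within {a..b})"
    and "\<And>t. t \<in> {a..b} \<Longrightarrow> norm (f' t) \<le> B" and "x \<in> {a..b}" "y \<in> {a..b}"
  shows "norm (f x - f y) \<le> B * \<bar>x - y\<bar>"
proof -
  have "norm (f x - f y) \<le> B * norm (x - y)"
  proof (rule differentiable_bound[where S = "{a..b}" and f' = "\<lambda>t h. h *\<^sub>R f' t"])
    show "(f has_derivative (\<lambda>h. h *\<^sub>R f' t)) (at t within {a..b})" if "t \<in> {a..b}" for t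
      using assms(1)[OF that] by (simp add: has_vector_derivative_def)
    show "onorm (\<lambda>h. h *\<^sub>R f' t) \<le> B" if "t \<in> {a..b}" for t
      using assms(2)[OF that] by (intro onorm_bound) (auto simp: mult.commute[of B] intro: order_trans[OF norm_ge_zero] mult_left_mono)
  qed (use assms in auto)
  then show ?thesis by simp
qed

lemma powr_vector_derivative:
  fixes w :: complex
  assumes "t > 0"
  shows "((\<lambda>t. of_real t powr w) has_vector_derivative w * of_real t powr (w - 1)) (at t within A)"
  using assms by (intro has_vector_derivative_real_field has_field_derivative_powr) (auto simp: complex_nonpos_Reals_iff)

lemma norm_of_real_powr: "t \<ge> 0 \<Longrightarrow> norm (of_real t powr (w::complex)) = t powr Re w"
  by (simp add: norm_powr_real_powr)

lemma norm_of_nat_powr: "norm (of_nat n powr (w::complex)) = of_nat n powr Re w"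
  using norm_of_real_powr[of "of_nat n" w] by simp

lemma powr_diff_bound:
  assumes "0 < x" "x \<le> y" "Re s \<ge> 0"
  shows "norm (of_real x powr (- s) - of_real y powr (- s :: complex)) \<le> norm s * x powr (- Re s - 1) * (y - x)"
proof -
  have "norm (of_real x powr (- s) - of_real y powr (- s)) \<le> norm s * x powr (- Re s - 1) * \<bar>x - y\<bar>"
  proof (rule vector_derivative_bound[where a = x and b = y and f' = "\<lambda>t. - s * of_real t powr (- s - 1)"])
    fix t assume t: "t \<in> {x..y}"
    then show "((\<lambda>t. of_real t powr - s) has_vector_derivative - s * of_real t powr (- s - 1)) (at t within {x..y})"
      using assms by (intro powr_vector_derivative) auto
    have "t powr (- Re s - 1) \<le> x powr (- Re s - 1)" using assms t by (intro powr_mono2') auto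
    then show "norm (- s * of_real t powr (- s - 1)) \<le> norm s * x powr (- Re s - 1)"
      using assms t by (simp add: norm_mult norm_of_real_powr mult_left_mono)
  qed (use assms in auto)
  then show ?thesis using assms by simp
qed

text \<open>The integral test, carried out with the antiderivative \<open>F\<close>: by the mean
  value theorem each term after the first is below a difference of consecutive values of
  \<open>F\<close>, and these telescope to \<open>1 / d\<close>.\<close>

lemma sum_powr_has_sum:
  fixes d :: real
  assumes d: "d > 0"
  shows "(\<lambda>n. real (Suc n) powr (- 1 - d)) summable_on UNIV"
    and "(\<Sum>\<^sub>\<infinity>n. real (Suc n) powr (- 1 - d)) \<le> 1 + 1 / d"
proof -
  define F where "F n = - (real (Suc n) powr (- d)) / d" for n
  have le: "real (Suc (Suc n)) powr (- 1 - d) \<le> F (Suc n) - F n" for n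
  proof -
    have "\<exists>z. real (Suc n) < z \<and> z < real (Suc (Suc n)) \<and>
        real (Suc (Suc n)) powr (- d) - real (Suc n) powr (- d) =
        (real (Suc (Suc n)) - real (Suc n)) * (- d * z powr (- d - 1))"
      by (rule MVT2) (auto intro!: derivative_eq_intros simp: powr_diff)
    then obtain z where z: "real (Suc n) < z" "z < real (Suc (Suc n))"
      "real (Suc (Suc n)) powr (- d) - real (Suc n) powr (- d) = - d * z powr (- d - 1)" by auto
    have "F (Suc n) - F n = - (real (Suc (Suc n)) powr (- d) - real (Suc n) powr (- d)) / d"
      by (simp add: F_def diff_divide_distrib)
    also have "\<dots> = z powr (- 1 - d)" using d unfolding z(3) minus_diff_commute[of 1 d] by simp
    finally have "F (Suc n) - F n = z powr (- 1 - d)" .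
    moreover have "real (Suc (Suc n)) powr (- 1 - d) \<le> z powr (- 1 - d)"
      using z d by (intro powr_mono2') auto
    ultimately show ?thesis by simp
  qed
  have "F \<longlonglongrightarrow> 0" unfolding F_def using d by real_asymp
  from telescope_sums[OF this] have tele: "(\<lambda>n. F (Suc n) - F n) sums (1 / d)" by (simp add: F_def)
  have summ: "summable (\<lambda>n. real (Suc (Suc n)) powr (- 1 - d))"
    by (rule summable_comparison_test'[OF sums_summable[OF tele]]) (use le in auto)
  then have summ': "summable (\<lambda>n. real (Suc n) powr (- 1 - d))"
    using summable_Suc_iff[of "\<lambda>n. real (Suc n) powr (- 1 - d)"] by blast
  have "(\<Sum>n. real (Suc n) powr (- 1 - d)) = 1 + (\<Sum>n. real (Suc (Suc n)) powr (- 1 - d))"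
    using suminf_split_head[OF summ'] by simp
  also have "(\<Sum>n. real (Suc (Suc n)) powr (- 1 - d)) \<le> 1 / d"
    using suminf_le[OF le summ sums_summable[OF tele]] sums_unique[OF tele] by simp
  finally have le2: "(\<Sum>n. real (Suc n) powr (- 1 - d)) \<le> 1 + 1 / d" by simp
  have hs: "((\<lambda>n. real (Suc n) powr (- 1 - d)) has_sum (\<Sum>n. real (Suc n) powr (- 1 - d))) UNIV"
    by (rule sums_nonneg_imp_has_sum) (use summ' in \<open>auto intro: summable_sums\<close>)
  then show "(\<lambda>n. real (Suc n) powr (- 1 - d)) summable_on UNIV" by (rule has_sum_imp_summable)
  show "(\<Sum>\<^sub>\<infinity>n. real (Suc n) powr (- 1 - d)) \<le> 1 + 1 / d" using infsumI[OF hs] le2 by simp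
qed

lemma powr_minus_one_complex: "1 / (w::complex) powr s = w powr (- s)"
  by (simp add: powr_minus inverse_eq_divide)

subsection \<open>The Riemann zeta function\<close>

text \<open>The difference between the term of the series at \<open>n + 1\<close> and the integral
  of the power over the following unit interval. The integrals add up to \<open>1 / (s - 1)\<close>
  for real part above 1, and the differences converge for positive real part.\<close>

definition zeta_term :: "nat \<Rightarrow> complex \<Rightarrow> complex" where
  "zeta_term n s = of_nat (Suc n) powr (- s) -
     (of_nat (Suc n) powr (1 - s) - of_nat (Suc (Suc n)) powr (1 - s)) / (s - 1)"

definition zeta_fun :: "complex \<Rightarrow> complex" where
  "zeta_fun s = 1 / (s - 1) + (\<Sum>\<^sub>\<infinity>n. zeta_term n s)"

lemma zeta_term_bound:
  assumes s: "Re s > 0" "s \<noteq> 1"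
  shows "norm (zeta_term n s) \<le> norm s * real (Suc n) powr (- Re s - 1)"
proof -
  let ?a = "real (Suc n)" and ?b = "real (Suc (Suc n))"
  \<comment> \<open>An antiderivative of the deviation of the integrand from its value at the left
    endpoint, so that the increment of \<open>G\<close> is the term to be bounded.\<close>
  define G where "G t = of_real t * of_real ?a powr (- s) - of_real t powr (1 - s) / (1 - s)" for t :: real
  have "norm (G ?b - G ?a) \<le> (norm s * ?a powr (- Re s - 1)) * \<bar>?b - ?a\<bar>"
  proof (rule vector_derivative_bound[where a = ?a and b = ?b and f' = "\<lambda>t. of_real ?a powr (- s) - of_real t powr (- s)"])
    fix t assume t: "t \<in> {?a..?b}"
    then have t0: "t > 0" by auto
    have "((\<lambda>t. of_real t * of_real ?a powr (- s) - of_real t powr (1 - s) / (1 - s)) has_vector_derivative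
        (1 * of_real ?a powr (- s) - ((1 - s) * of_real t powr ((1 - s) - 1)) / (1 - s))) (at t within {?a..?b})"
      by (intro has_vector_derivative_diff has_vector_derivative_mult_left has_vector_derivative_divide
          powr_vector_derivative t0 has_vector_derivative_of_real[OF DERIV_ident, simplified])
    then show "(G has_vector_derivative of_real ?a powr (- s) - of_real t powr (- s)) (at t within {?a..?b})"
      using s unfolding G_def by simp
    have "norm (of_real ?a powr (- s) - of_real t powr (- s)) \<le> norm s * ?a powr (- Re s - 1) * (t - ?a)"
      using t s by (intro powr_diff_bound) auto
    also have "\<dots> \<le> norm s * ?a powr (- Re s - 1) * 1" using t by (intro mult_left_mono) auto
    finally show "norm (of_real ?a powr (- s) - of_real t powr (- s)) \<le> norm s * ?a powr (- Re s - 1)" by simp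
  qed auto
  moreover have "G ?b - G ?a = zeta_term n s"
  proof -
    have "1 - s \<noteq> 0" "s - 1 \<noteq> 0" using s by auto
    then have "- (B - A) / (1 - s) = - (A - B) / (s - 1)" for A B :: complex by (simp add: field_simps)
    then show ?thesis unfolding G_def zeta_term_def by (simp add: algebra_simps diff_divide_distrib)
  qed
  ultimately show ?thesis by simp
qed

lemma zeta_term_abs_summable:
  assumes "Re s > 0" "s \<noteq> 1"
  shows "(\<lambda>n. norm (zeta_term n s)) summable_on UNIV"
    and "norm (\<Sum>\<^sub>\<infinity>n. zeta_term n s) \<le> norm s * (1 + 1 / Re s)"
proof -
  have sm: "(\<lambda>n. norm s * real (Suc n) powr (- 1 - Re s)) summable_on UNIV"
    using assms by (intro summable_on_cmult_right sum_powr_has_sum) auto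
  have le: "norm (zeta_term n s) \<le> norm s * real (Suc n) powr (- 1 - Re s)" for n
    using zeta_term_bound[OF assms, of n] unfolding minus_diff_commute[of "Re s" 1] .
  show abs: "(\<lambda>n. norm (zeta_term n s)) summable_on UNIV"
    by (rule Infinite_Sum.abs_summable_on_comparison_test'[OF sm]) (use le in auto)
  have "norm (\<Sum>\<^sub>\<infinity>n. zeta_term n s) \<le> (\<Sum>\<^sub>\<infinity>n. norm (zeta_term n s))" by (rule norm_infsum_bound) (rule abs)
  also have "\<dots> \<le> (\<Sum>\<^sub>\<infinity>n. norm s * real (Suc n) powr (- 1 - Re s))"
    by (intro infsum_mono abs sm le)
  also have "\<dots> = norm s * (\<Sum>\<^sub>\<infinity>n. real (Suc n) powr (- 1 - Re s))" by (rule infsum_cmult_right')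
  also have "\<dots> \<le> norm s * (1 + 1 / Re s)" using assms by (intro mult_left_mono sum_powr_has_sum) auto
  finally show "norm (\<Sum>\<^sub>\<infinity>n. zeta_term n s) \<le> norm s * (1 + 1 / Re s)" .
qed

lemma zeta_fun_bound:
  assumes "Re s > 0" "s \<noteq> 1"
  shows "norm (zeta_fun s) \<le> 1 / norm (s - 1) + norm s * (1 + 1 / Re s)"
  unfolding zeta_fun_def using zeta_term_abs_summable(2)[OF assms]
  by (intro order_trans[OF norm_triangle_ineq] add_mono) (auto simp: norm_divide)

lemma bounded_neighbourhood:
  fixes z :: complex
  assumes "Re z > c"
  obtains V e where "open V" "z \<in> V" "e > 0" "\<And>w. w \<in> V \<Longrightarrow> Re w > c + e" "\<And>w. w \<in> V \<Longrightarrow> norm w \<le> norm z + 1"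
proof -
  define e where "e = (Re z - c) / 2"
  have e: "e > 0" "Re z > c + e" using assms by (auto simp: e_def field_simps)
  let ?V = "{w. Re w > c + e} \<inter> ball z 1"
  show thesis
  proof (rule that[of ?V e])
    show "open ?V" by (intro open_Int open_halfspace_Re_gt open_ball)
    show "norm w \<le> norm z + 1" if "w \<in> ?V" for w
    proof -
      have "norm (w - z) < 1" using that by (simp add: dist_norm norm_minus_commute)
      then show ?thesis using norm_triangle_ineq2[of w z] by linarith
    qed
  qed (use e in auto)
qed

lemma zeta_fun_holomorphic: "zeta_fun holomorphic_on ({s. Re s > 0} - {1})"
proof -
  have "(\<lambda>s. \<Sum>\<^sub>\<infinity>n. zeta_term n s) holomorphic_on ({s. Re s > 0} - {1})"
  proof (rule holomorphic_infsum)
    show "open ({s. Re s > 0} - {1 :: complex})" by (intro open_Diff open_halfspace_Re_gt) auto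
    show "zeta_term n holomorphic_on ({s. Re s > 0} - {1})" for n
      unfolding zeta_term_def by (intro holomorphic_intros) auto
  next
    fix z :: complex assume z: "z \<in> {s. Re s > 0} - {1}"
    obtain V e where V: "open V" "z \<in> V" "e > 0" "\<And>w. w \<in> V \<Longrightarrow> Re w > 0 + e" "\<And>w. w \<in> V \<Longrightarrow> norm w \<le> norm z + 1"
      using z bounded_neighbourhood[of 0 z] by auto
    have "norm (zeta_term n w) \<le> (norm z + 1) * real (Suc n) powr (- 1 - e)" if "w \<in> V - {1}" for n w
    proof -
      have w: "Re w > e" "norm w \<le> norm z + 1" "w \<noteq> 1" using V that by auto
      have "norm (zeta_term n w) \<le> norm w * real (Suc n) powr (- Re w - 1)"
        using w V(3) by (intro zeta_term_bound) auto
      also have "\<dots> \<le> (norm z + 1) * real (Suc n) powr (- 1 - e)"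
        using w by (intro mult_mono powr_mono) auto
      finally show ?thesis .
    qed
    then show "\<exists>V M. open V \<and> z \<in> V \<and> M summable_on UNIV \<and> (\<forall>n\<in>UNIV. \<forall>w\<in>V. norm (zeta_term n w) \<le> M n)"
      using V z sum_powr_has_sum(1)[OF V(3)]
      by (intro exI[of _ "V - {1}"] exI[of _ "\<lambda>n. (norm z + 1) * real (Suc n) powr (- 1 - e)"])
        (auto intro: summable_on_cmult_right)
  qed
  then show ?thesis unfolding zeta_fun_def by (intro holomorphic_intros) auto
qed

lemma powr_abs_summable:
  assumes "Re s > 1"
  shows "(\<lambda>n. norm ((of_nat (Suc n) :: complex) powr (- s))) summable_on UNIV"
    and "(\<Sum>\<^sub>\<infinity>n. norm ((of_nat (Suc n) :: complex) powr (- s))) \<le> 1 + 1 / (Re s - 1)"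
proof -
  have e: "norm ((of_nat (Suc n) :: complex) powr (- s)) = real (Suc n) powr (- 1 - (Re s - 1))" for n
    by (subst norm_of_nat_powr) simp
  show "(\<lambda>n. norm ((of_nat (Suc n) :: complex) powr (- s))) summable_on UNIV"
    unfolding e using assms by (intro sum_powr_has_sum) auto
  show "(\<Sum>\<^sub>\<infinity>n. norm ((of_nat (Suc n) :: complex) powr (- s))) \<le> 1 + 1 / (Re s - 1)"
    unfolding e using assms by (intro sum_powr_has_sum) auto
qed

lemma zeta_fun_has_sum:
  assumes s: "Re s > 1"
  shows "((\<lambda>n. of_nat (Suc n) powr (- s)) has_sum zeta_fun s) UNIV"
proof -
  have s0: "Re s > 0" "s \<noteq> 1" using s by auto
  define g where "g n = - ((of_nat (Suc n) :: complex) powr (1 - s)) / (s - 1)" for n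
  have "(\<lambda>n. real (Suc n) powr (- (Re s - 1))) \<longlonglongrightarrow> 0" using s by real_asymp
  then have "(\<lambda>n. norm ((of_nat (Suc n) :: complex) powr (1 - s))) \<longlonglongrightarrow> 0"
    by (simp add: norm_of_nat_powr del: of_nat_Suc)
  then have "(\<lambda>n. (of_nat (Suc n) :: complex) powr (1 - s)) \<longlonglongrightarrow> 0" by (rule tendsto_norm_zero_cancel)
  then have "g \<longlonglongrightarrow> - 0 / (s - 1)" unfolding g_def by (intro tendsto_intros) (use s0 in auto)
  then have "(\<lambda>n. g (Suc n) - g n) sums (0 - g 0)" by (intro telescope_sums) simp
  then have "(\<lambda>n. g (Suc n) - g n) sums (1 / (s - 1))" by (simp add: g_def)
  moreover have "(\<lambda>n. zeta_term n s) sums (\<Sum>\<^sub>\<infinity>n. zeta_term n s)"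
    by (rule has_sum_imp_sums[OF has_sum_infsum[OF abs_summable_summable[OF zeta_term_abs_summable(1)[OF s0]]]])
  ultimately have "(\<lambda>n. (g (Suc n) - g n) + zeta_term n s) sums zeta_fun s"
    unfolding zeta_fun_def by (rule sums_add)
  moreover have "(g (Suc n) - g n) + zeta_term n s = of_nat (Suc n) powr (- s)" for n
    by (simp add: g_def zeta_term_def diff_divide_distrib)
  ultimately have "(\<lambda>n. of_nat (Suc n) powr (- s)) sums zeta_fun s" by simp
  moreover have "((\<lambda>n. of_nat (Suc n) powr (- s)) has_sum (\<Sum>\<^sub>\<infinity>n. of_nat (Suc n) powr (- s))) (UNIV :: nat set)"
    by (rule has_sum_infsum[OF abs_summable_summable[OF powr_abs_summable(1)[OF s]]])
  ultimately show ?thesis using sums_unique2 has_sum_imp_sums by metis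
qed

lemma zeta_eq:
  assumes "Re s > 0" "s \<noteq> 1"
  shows "zeta s = zeta_fun s"
  unfolding zeta_def
proof (rule dirichlet_series_continuation_eq[where c = 0])
  show "(\<lambda>n. 1 / of_nat (Suc n) powr z) sums zeta_fun z" if "1 < Re z" for z
    using has_sum_imp_sums[OF zeta_fun_has_sum[OF that]] by (simp add: powr_minus_one_complex del: of_nat_Suc)
qed (use zeta_fun_holomorphic assms in auto)

lemma has_sum_product:
  fixes f :: "'i \<Rightarrow> 'a :: {real_normed_field, banach}" and g :: "'j \<Rightarrow> 'a"
  assumes f: "(f has_sum x) A" "(\<lambda>a. norm (f a)) summable_on A"
    and g: "(g has_sum y) B" "(\<lambda>b. norm (g b)) summable_on B"
  shows "((\<lambda>(a, b). f a * g b) has_sum x * y) (A \<times> B)"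
proof (rule has_sum_SigmaI)
  show "((\<lambda>b. case (a, b) of (a, b) \<Rightarrow> f a * g b) has_sum f a * y) B" for a
    using has_sum_cmult_right[OF g(1), of "f a"] by simp
  show "((\<lambda>a. f a * y) has_sum x * y) A" by (rule has_sum_cmult_left[OF f(1)])
  have "(\<lambda>p. norm (case p of (a, b) \<Rightarrow> f a * g b)) summable_on A \<times> B"
  proof (rule summable_on_SigmaI)
    show "((\<lambda>b. norm (case (a, b) of (a, b) \<Rightarrow> f a * g b)) has_sum (norm (f a) * (\<Sum>\<^sub>\<infinity>b\<in>B. norm (g b)))) B" for a
      using has_sum_cmult_right[OF has_sum_infsum[OF g(2)], of "norm (f a)"] by (simp add: norm_mult)
    show "(\<lambda>a. norm (f a) * (\<Sum>\<^sub>\<infinity>b\<in>B. norm (g b))) summable_on A"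
      by (rule summable_on_cmult_left[OF f(2)])
  qed auto
  then show "(\<lambda>(a, b). f a * g b) summable_on A \<times> B" by (rule abs_summable_summable)
qed

context odd_real_character
begin

subsection \<open>The L-function\<close>

definition X_sum :: "nat \<Rightarrow> int" where "X_sum m = (\<Sum>k<m. X (int k))"

lemma X_sum_period: "X_sum q = 0"
proof -
  let ?S = "\<Sum>a\<in>{0..<int q}. X a"
  have "?S = (\<Sum>a\<in>{0..<int q}. X (- a))"
    by (rule sum_residues_reindex[symmetric, where F = X])
      (use q_pos X_cong in \<open>auto simp: cong_minus_minus_iff\<close>)
  also have "\<dots> = - ?S"
    using X_mult[of "-1"] by (simp add: X_m1 sum_negf)
  finally have "?S = 0" by simp
  moreover have "X_sum q = ?S"
    unfolding X_sum_def by (rule sum.reindex_bij_witness[of _ nat int]) auto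
  ultimately show ?thesis by simp
qed

lemma X_sum_add_q: "X_sum (m + q) = X_sum m"
proof (induction m)
  case 0
  then show ?case using X_sum_period by (simp add: X_sum_def)
next
  case (Suc m)
  have "X (int (m + q)) = X (int m)" by (rule X_cong) (simp add: cong_def)
  then show ?case using Suc by (simp add: X_sum_def)
qed

lemma X_sum_bound: "\<bar>X_sum m\<bar> \<le> int q"
proof (induction m rule: less_induct)
  case (less m)
  show ?case
  proof (cases "m < q")
    case True
    have "\<bar>X_sum m\<bar> \<le> (\<Sum>k<m. \<bar>X (int k)\<bar>)" unfolding X_sum_def by (rule sum_abs)
    also have "\<dots> \<le> (\<Sum>k<m. 1)" by (intro sum_mono) (auto simp: X_def)
    finally show ?thesis using True by simp
  next
    case False
    then have "X_sum m = X_sum (m - q)" using X_sum_add_q[of "m - q"] by simp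
    then show ?thesis using less[of "m - q"] False q_pos by simp
  qed
qed

text \<open>Abel summation: as the character sums over a full period vanish, the partial sums
  \<open>X_sum\<close> are bounded by \<open>q\<close>, and the series continues to positive real
  part. The shift by two arises because \<open>X_sum m\<close> runs over \<open>k < m\<close> and
  the index 0 stands for the integer 1.\<close>

definition L_term :: "nat \<Rightarrow> complex \<Rightarrow> complex" where
  "L_term n s = of_int (X_sum (Suc (Suc n))) * (of_nat (Suc n) powr (- s) - of_nat (Suc (Suc n)) powr (- s))"

definition L_fun :: "complex \<Rightarrow> complex" where "L_fun s = (\<Sum>\<^sub>\<infinity>n. L_term n s)"

lemma L_term_bound:
  assumes "Re s > 0"
  shows "norm (L_term n s) \<le> real q * (norm s * real (Suc n) powr (- Re s - 1))"
proof -
  have "norm (L_term n s) = \<bar>of_int (X_sum (Suc (Suc n)))\<bar> *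
      norm (complex_of_real (real (Suc n)) powr (- s) - of_real (real (Suc (Suc n))) powr (- s))"
    unfolding L_term_def norm_mult of_real_of_nat_eq norm_of_int ..
  also have "\<dots> \<le> real q * (norm s * real (Suc n) powr (- Re s - 1) * (real (Suc (Suc n)) - real (Suc n)))"
  proof (intro mult_mono powr_diff_bound)
    have "real_of_int \<bar>X_sum (Suc (Suc n))\<bar> \<le> real_of_int (int q)" using X_sum_bound by (simp only: of_int_le_iff)
    then show "\<bar>real_of_int (X_sum (Suc (Suc n)))\<bar> \<le> real q" by simp
  qed (use assms in auto)
  finally show ?thesis by simp
qed

lemma L_fun_holomorphic: "L_fun holomorphic_on {s. Re s > 0}"
  unfolding L_fun_def
proof (rule holomorphic_infsum)
  show "open {s. Re s > 0}" by (rule open_halfspace_Re_gt)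
  show "L_term n holomorphic_on {s. Re s > 0}" for n
    unfolding L_term_def by (intro holomorphic_intros)
next
  fix z :: complex assume z: "z \<in> {s. Re s > 0}"
  obtain V e where V: "open V" "z \<in> V" "e > 0" "\<And>w. w \<in> V \<Longrightarrow> Re w > 0 + e" "\<And>w. w \<in> V \<Longrightarrow> norm w \<le> norm z + 1"
    using z bounded_neighbourhood[of 0 z] by auto
  have "norm (L_term n w) \<le> real q * ((norm z + 1) * real (Suc n) powr (- 1 - e))" if "w \<in> V" for n w
  proof -
    have w: "Re w > e" "norm w \<le> norm z + 1" using V that by auto
    have "norm (L_term n w) \<le> real q * (norm w * real (Suc n) powr (- Re w - 1))"
      using w V(3) by (intro L_term_bound) auto
    also have "\<dots> \<le> real q * ((norm z + 1) * real (Suc n) powr (- 1 - e))"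
      using w by (intro mult_mono powr_mono) auto
    finally show ?thesis .
  qed
  then show "\<exists>V M. open V \<and> z \<in> V \<and> M summable_on UNIV \<and> (\<forall>n\<in>UNIV. \<forall>w\<in>V. norm (L_term n w) \<le> M n)"
    using V sum_powr_has_sum(1)[OF V(3)]
    by (intro exI[of _ V] exI[of _ "\<lambda>n. real q * ((norm z + 1) * real (Suc n) powr (- 1 - e))"])
      (auto intro!: summable_on_cmult_right)
qed

lemma norm_X_powr: "norm (of_int (X (int (Suc n))) * (of_nat (Suc n) :: complex) powr (- s)) \<le> norm ((of_nat (Suc n) :: complex) powr (- s))"
proof -
  have "norm (of_int (X (int (Suc n))) :: complex) \<le> 1" by (simp add: X_def)
  then show ?thesis unfolding norm_mult by (intro mult_left_le_one_le) auto
qed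

lemma L_fun_has_sum:
  assumes s: "Re s > 1"
  shows "((\<lambda>n. of_int (X (int (Suc n))) * of_nat (Suc n) powr (- s)) has_sum L_fun s) UNIV"
    and "(\<lambda>n. norm (of_int (X (int (Suc n))) * (of_nat (Suc n) :: complex) powr (- s))) summable_on UNIV"
proof -
  let ?a = "\<lambda>n. of_int (X (int (Suc n))) * (of_nat (Suc n) :: complex) powr (- s)"
  show abs: "(\<lambda>n. norm (?a n)) summable_on UNIV"
    by (rule Infinite_Sum.abs_summable_on_comparison_test'[OF powr_abs_summable(1)[OF s]]) (rule norm_X_powr)
  have X0: "X 0 = 0" using q_ge_3 by (simp add: X_eq_0_iff)
  have abel: "(\<Sum>n<N. ?a n) = (\<Sum>n<N. L_term n s) + of_int (X_sum (Suc N)) * of_nat (Suc N) powr (- s)" for N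
  proof (induction N)
    case 0
    then show ?case by (simp add: X_sum_def X0)
  next
    case (Suc N)
    have "X_sum (Suc (Suc N)) = X_sum (Suc N) + X (int (Suc N))" by (simp add: X_sum_def)
    then show ?case using Suc unfolding sum.lessThan_Suc L_term_def by (simp add: algebra_simps del: of_nat_Suc)
  qed
  have "(\<lambda>N. real q * real (Suc N) powr (- Re s)) \<longlonglongrightarrow> 0"
    using s by real_asymp
  then have "(\<lambda>N. of_int (X_sum (Suc N)) * (of_nat (Suc N) :: complex) powr (- s)) \<longlonglongrightarrow> 0"
  proof (rule Lim_null_comparison[rotated], intro always_eventually allI)
    fix N
    have "real_of_int \<bar>X_sum (Suc N)\<bar> \<le> real_of_int (int q)" using X_sum_bound by (simp only: of_int_le_iff)
    then have "norm (of_int (X_sum (Suc N)) * (of_nat (Suc N) :: complex) powr (- s)) \<le> real q * norm ((of_nat (Suc N) :: complex) powr (- s))"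
      unfolding norm_mult norm_of_int by (intro mult_right_mono) auto
    then show "norm (of_int (X_sum (Suc N)) * (of_nat (Suc N) :: complex) powr (- s)) \<le> real q * real (Suc N) powr (- Re s)"
      unfolding norm_of_nat_powr by simp
  qed
  moreover have "(\<lambda>n. L_term n s) sums L_fun s"
  proof -
    have s0: "Re s > 0" using s by simp
    have Labs: "(\<lambda>n. norm (L_term n s)) summable_on UNIV"
    proof (rule Infinite_Sum.abs_summable_on_comparison_test')
      show "norm (L_term n s) \<le> real q * (norm s * real (Suc n) powr (- 1 - Re s))" for n
        using L_term_bound[OF s0] minus_diff_commute[of "Re s" 1] by simp
      show "(\<lambda>n. real q * (norm s * real (Suc n) powr (- 1 - Re s))) summable_on UNIV"
        using sum_powr_has_sum(1)[OF s0] by (intro summable_on_cmult_right)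
    qed
    show ?thesis unfolding L_fun_def by (rule has_sum_imp_sums[OF has_sum_infsum[OF abs_summable_summable[OF Labs]]])
  qed
  then have "(\<lambda>N. \<Sum>n<N. L_term n s) \<longlonglongrightarrow> L_fun s" by (simp add: sums_def)
  ultimately have "(\<lambda>N. \<Sum>n<N. ?a n) \<longlonglongrightarrow> L_fun s + 0" unfolding abel by (intro tendsto_add)
  then have a_sums: "?a sums L_fun s" by (simp only: sums_def add_0_right)
  have hs: "(?a has_sum (\<Sum>\<^sub>\<infinity>n. ?a n)) UNIV" by (rule has_sum_infsum[OF abs_summable_summable[OF abs]])
  have "(\<Sum>\<^sub>\<infinity>n. ?a n) = L_fun s" by (rule sums_unique2[OF has_sum_imp_sums[OF hs] a_sums])
  then show "(?a has_sum L_fun s) UNIV" using hs by (simp only:)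
qed

text \<open>An odd character is not principal, so no point is removed and the Abel-summed series is
  the continuation.\<close>

lemma dirichlet_L_eq:
  assumes "Re s > 0"
  shows "dirichlet_L q chi s = L_fun s"
proof -
  have "coprime (-1) (int q)" by simp
  then have "principal_character q chi \<Longrightarrow> chi (-1) = 1" unfolding principal_character_def by blast
  then have np: "\<not> principal_character q chi" using odd by auto
  have "dirichlet_series_continuation {} (\<lambda>n. chi (int n)) s = L_fun s"
  proof (rule dirichlet_series_continuation_eq[where c = 0])
    show "(\<lambda>n. chi (int (Suc n)) / of_nat (Suc n) powr z) sums L_fun z" if "1 < Re z" for z
      using has_sum_imp_sums[OF L_fun_has_sum(1)[OF that]] X_chi
      by (simp add: powr_minus inverse_eq_divide del: of_nat_Suc)
  qed (use L_fun_holomorphic assms in auto)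
  then show ?thesis using np by (simp add: dirichlet_L_def)
qed

subsection \<open>The Dedekind zeta function as a sum over ideal classes\<close>

text \<open>An ideal of norm \<open>n\<close> is an integer \<open>g\<close> times a primitive ideal
  of norm \<open>n div g ^ 2\<close>, and the latter is given by a root.\<close>

lemma bij_ideal_params_norm:
  assumes n: "n > 0"
  shows "bij_betw (\<lambda>(g, t). (int g, int (n div g ^ 2), t)) (Sigma {g. g ^ 2 dvd n} (\<lambda>g. roots (n div g ^ 2)))
     {(g, a, t) \<in> ideal_params. g ^ 2 * a = int n}"
  unfolding bij_betw_def
proof (intro conjI inj_onI equalityI subsetI)
  fix p assume "p \<in> (\<lambda>(g, t). (int g, int (n div g ^ 2), t)) ` (Sigma {g. g ^ 2 dvd n} (\<lambda>g. roots (n div g ^ 2)))"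
  then obtain g t where p: "p = (int g, int (n div g ^ 2), t)" "g ^ 2 dvd n" "t \<in> roots (n div g ^ 2)" by auto
  obtain m where m: "n = g ^ 2 * m" using p(2) by blast
  then have pos: "g > 0" "m > 0" using n by (auto intro!: Nat.gr0I)
  then have "n div g ^ 2 = m" using m by simp
  then show "p \<in> {(g, a, t) \<in> ideal_params. g ^ 2 * a = int n}"
    using p pos m by (auto simp: ideal_params_def roots_def)
next
  fix p assume "p \<in> {(g, a, t) \<in> ideal_params. g ^ 2 * a = int n}"
  then obtain g a t where p: "p = (g, a, t)" "g > 0" "a > 0" "0 \<le> t" "t < a" "a dvd nf t" "g ^ 2 * a = int n"
    by (auto simp: ideal_params_def)
  define g' a' where "g' = nat g" and "a' = nat a"
  have ga: "g = int g'" "a = int a'" using p by (auto simp: g'_def a'_def)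
  have "int (g' ^ 2 * a') = int n" using p(7) by (simp add: ga)
  then have e: "g' ^ 2 * a' = n" by (simp only: of_nat_eq_iff)
  moreover have "n div g' ^ 2 = a'" using e p(2) ga by (metis nonzero_mult_div_cancel_left of_nat_0_less_iff power_eq_0_iff less_irrefl)
  ultimately show "p \<in> (\<lambda>(g, t). (int g, int (n div g ^ 2), t)) ` (Sigma {g. g ^ 2 dvd n} (\<lambda>g. roots (n div g ^ 2)))"
    using p ga by (intro image_eqI[of _ _ "(g', t)"]) (auto simp: roots_def)
qed auto

lemma card_ideal_params_norm:
  assumes n: "n > 0"
  shows "finite {(g, a, t) \<in> ideal_params. g ^ 2 * a = int n}"
    and "int (card {(g, a, t) \<in> ideal_params. g ^ 2 * a = int n}) = (\<Sum>d | d dvd n. X (int d))"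
proof -
  have fin: "finite {g. g ^ 2 dvd n}" by (rule finite_power_divisors[OF n]) simp
  then have fin2: "finite (Sigma {g. g ^ 2 dvd n} (\<lambda>g. roots (n div g ^ 2)))" by (intro finite_SigmaI) auto
  then show "finite {(g, a, t) \<in> ideal_params. g ^ 2 * a = int n}"
    using bij_betw_finite[OF bij_ideal_params_norm[OF n]] by blast
  have "card {(g, a, t) \<in> ideal_params. g ^ 2 * a = int n} = card (Sigma {g. g ^ 2 dvd n} (\<lambda>g. roots (n div g ^ 2)))"
    using bij_betw_same_card[OF bij_ideal_params_norm[OF n]] by simp
  also have "\<dots> = (\<Sum>g | g ^ 2 dvd n. rho (n div g ^ 2))" using fin by (simp add: card_SigmaI rho_def)
  finally show "int (card {(g, a, t) \<in> ideal_params. g ^ 2 * a = int n}) = (\<Sum>d | d dvd n. X (int d))"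
    by (simp add: sum_X_divisors_eq_sum_rho[OF n])
qed

lemma zeta_L_coefficients:
  assumes s: "Re s > 1"
  shows "((\<lambda>n. of_int (\<Sum>d | d dvd n. X (int d)) * of_nat n powr (- s)) has_sum (zeta_fun s * L_fun s)) {1..}"
proof -
  have bij: "bij_betw Suc UNIV {1..}" by (rule bij_betwI[of _ _ _ "\<lambda>n. n - 1"]) auto
  have z: "((\<lambda>n. of_nat n powr (- s)) has_sum zeta_fun s) {1..}" "(\<lambda>n. norm ((of_nat n :: complex) powr (- s))) summable_on {1..}"
    using has_sum_reindex_bij_betw[OF bij, of "\<lambda>n. of_nat n powr (- s)" "zeta_fun s"] zeta_fun_has_sum[OF s]
      summable_on_reindex_bij_betw[OF bij, of "\<lambda>n. norm ((of_nat n :: complex) powr (- s))"] powr_abs_summable(1)[OF s]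
    by auto
  have l: "((\<lambda>n. of_int (X (int n)) * of_nat n powr (- s)) has_sum L_fun s) {1..}"
    "(\<lambda>n. norm (of_int (X (int n)) * (of_nat n :: complex) powr (- s))) summable_on {1..}"
    using has_sum_reindex_bij_betw[OF bij, of "\<lambda>n. of_int (X (int n)) * of_nat n powr (- s)" "L_fun s"] L_fun_has_sum[OF s]
      summable_on_reindex_bij_betw[OF bij, of "\<lambda>n. norm (of_int (X (int n)) * (of_nat n :: complex) powr (- s))"]
    by auto
  have "((\<lambda>(e, d). of_nat e powr (- s) * (of_int (X (int d)) * of_nat d powr (- s))) has_sum (zeta_fun s * L_fun s)) ({1..} \<times> {1..})"
    by (rule has_sum_product[OF z l])
  also have "?this \<longleftrightarrow> ((\<lambda>(n, d). of_int (X (int d)) * of_nat n powr (- s)) has_sum (zeta_fun s * L_fun s)) (Sigma {1..} (\<lambda>n. {d. d dvd n}))"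
  proof (rule has_sum_reindex_bij_witness[where i = "\<lambda>(n, d). (n div d, d)" and j = "\<lambda>(e, d). (e * d, d)"])
    fix b :: "nat \<times> nat" assume "b \<in> Sigma {1..} (\<lambda>n. {d. d dvd n})"
    then obtain n d where b: "b = (n, d)" "n \<ge> 1" "d dvd n" by auto
    then obtain e where e: "n = e * d" by (metis dvd_def mult.commute)
    then have "e \<ge> 1" "d \<ge> 1" using b(2) by (auto simp: Suc_le_eq intro!: Nat.gr0I)
    then show "(case case b of (n, d) \<Rightarrow> (n div d, d) of (e, d) \<Rightarrow> (e * d, d)) = b"
      "(case b of (n, d) \<Rightarrow> (n div d, d)) \<in> {1..} \<times> {1..}" using e b by auto
  next
    fix a :: "nat \<times> nat" assume "a \<in> {1..} \<times> {1..}"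
    then obtain e d where a: "a = (e, d)" "e \<ge> 1" "d \<ge> 1" by auto
    have "of_nat (e * d) powr (- s) = (of_nat e powr (- s) * of_nat d powr (- s) :: complex)"
      using powr_times_real[of "of_nat e" "of_nat d" "-s"] by simp
    then show "(case case a of (e, d) \<Rightarrow> (e * d, d) of (n, d) \<Rightarrow> of_int (X (int d)) * of_nat n powr (- s)) =
        (case a of (e, d) \<Rightarrow> of_nat e powr (- s) * (of_int (X (int d)) * of_nat d powr (- s)))"
      using a by (simp add: mult_ac)
  qed auto
  finally have "((\<lambda>(n, d). of_int (X (int d)) * of_nat n powr (- s)) has_sum (zeta_fun s * L_fun s)) (Sigma {1..} (\<lambda>n. {d. d dvd n}))" .
  then show ?thesis
  proof (rule has_sum_SigmaD)
    fix n :: nat assume "n \<in> {1..}"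
    then have "finite {d. d dvd n}" by simp
    then show "((\<lambda>d. case (n, d) of (n, d) \<Rightarrow> of_int (X (int d)) * of_nat n powr (- s)) has_sum
        of_int (\<Sum>d | d dvd n. X (int d)) * of_nat n powr (- s)) {d. d dvd n}"
      by (intro has_sum_finiteI) (simp_all add: sum_distrib_right)
  qed
qed

lemma zeta_L_ideal_sum:
  assumes s: "Re s > 1"
  shows "((\<lambda>(g, a, t). of_int (g ^ 2 * a) powr (- s)) has_sum (zeta_fun s * L_fun s)) ideal_params"
    and "(\<lambda>(g, a, t). norm (of_int (g ^ 2 * a) powr (- s))) summable_on ideal_params"
proof -
  let ?P = "\<lambda>n. {(g, a, t) \<in> ideal_params. g ^ 2 * a = int n}"
  define r where "r n = (\<Sum>d | d dvd n. X (int d))" for n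
  have r: "r n = int (card (?P n))" "finite (?P n)" if "n \<in> {1..}" for n
    using card_ideal_params_norm[of n] that by (auto simp: r_def)
  have abs: "(\<lambda>p. norm ((\<lambda>(n, p). (of_nat n :: complex) powr (- s)) p)) summable_on Sigma {1..} ?P"
  proof (rule summable_on_SigmaI)
    fix n :: nat assume n: "n \<in> {1..}"
    show "((\<lambda>p. norm ((\<lambda>(n, p). (of_nat n :: complex) powr (- s)) (n, p))) has_sum (of_int (r n) * real n powr (- Re s))) (?P n)"
      using r[OF n] by (intro has_sum_finiteI) (simp_all add: norm_of_nat_powr)
  next
    \<comment> \<open>At the real point \<open>Re s\<close> the terms are the norms of the terms at
      \<open>s\<close>, so convergence there is absolute convergence at \<open>s\<close>.\<close>
    have "Re (of_real (Re s)) > 1" using s by simp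
    from has_sum_imp_summable[OF has_sum_Re[OF zeta_L_coefficients[OF this]]]
    have "(\<lambda>n. Re (of_int (r n) * of_nat n powr (- of_real (Re s)))) summable_on {1..}" by (simp add: r_def)
    moreover have "Re (of_int (r n) * of_nat n powr (- of_real (Re s))) = of_int (r n) * real n powr (- Re s)" for n
    proof -
      have "(of_nat n :: complex) powr (- of_real (Re s)) = of_real (real n powr (- Re s))"
        using powr_of_real[of "real n" "- Re s"] by simp
      then have "of_int (r n) * (of_nat n :: complex) powr (- of_real (Re s)) = of_real (of_int (r n) * real n powr (- Re s))" by simp
      then show ?thesis by (simp only: Re_complex_of_real)
    qed
    ultimately show "(\<lambda>n. of_int (r n) * real n powr (- Re s)) summable_on {1..}" by (simp only:)
  qed simp
  have bij: "bij_betw snd (Sigma {1..} ?P) ideal_params"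
  proof (rule bij_betwI[of _ _ _ "\<lambda>(g, a, t). (nat (g ^ 2 * a), (g, a, t))"])
    show "(\<lambda>(g, a, t). (nat (g ^ 2 * a), (g, a, t))) \<in> ideal_params \<rightarrow> Sigma {1..} ?P"
    proof
      fix p assume p: "p \<in> ideal_params"
      obtain g a t where gat: "p = (g, a, t)" by (metis surj_pair)
      then have "g ^ 2 * a > 0" using p by (simp add: ideal_params_def)
      then show "(\<lambda>(g, a, t). (nat (g ^ 2 * a), (g, a, t))) p \<in> Sigma {1..} ?P" using p gat by auto
    qed
  qed auto
  have hs: "((\<lambda>(n, p). (of_nat n :: complex) powr (- s)) has_sum (zeta_fun s * L_fun s)) (Sigma {1..} ?P)"
  proof (rule has_sum_SigmaI)
    fix n :: nat assume n: "n \<in> {1..}"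
    show "((\<lambda>p. (\<lambda>(n, p). (of_nat n :: complex) powr (- s)) (n, p)) has_sum (of_int (r n) * of_nat n powr (- s))) (?P n)"
      using r[OF n] by (intro has_sum_finiteI) simp_all
  next
    show "((\<lambda>n. of_int (r n) * of_nat n powr (- s)) has_sum (zeta_fun s * L_fun s)) {1..}"
      using zeta_L_coefficients[OF s] by (simp add: r_def)
  qed (rule abs_summable_summable[OF abs])
  let ?f = "\<lambda>(g, a, t). (of_int (g ^ 2 * a) :: complex) powr (- s)"
  have eq: "(\<lambda>(n, p). (of_nat n :: complex) powr (- s)) x = ?f (snd x)" if "x \<in> Sigma {1..} ?P" for x
  proof -
    obtain n g a t where x: "x = (n, (g, a, t))" by (metis surj_pair)
    then have "g ^ 2 * a = int n" using that by auto
    then show ?thesis using x by (simp only: prod.case snd_conv of_int_of_nat_eq)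
  qed
  define F where "F = (\<lambda>(n :: nat, p :: int \<times> int \<times> int). (of_nat n :: complex) powr (- s))"
  define G :: "int \<times> int \<times> int \<Rightarrow> complex" where "G = (\<lambda>(g, a, t). of_int (g ^ 2 * a) powr (- s))"
  have FG: "F x = G (snd x)" if "x \<in> Sigma {1..} ?P" for x
    unfolding F_def G_def by (rule eq[OF that])
  have "(F has_sum (zeta_fun s * L_fun s)) (Sigma {1..} ?P)" using hs unfolding F_def .
  then have "((\<lambda>x. G (snd x)) has_sum (zeta_fun s * L_fun s)) (Sigma {1..} ?P)"
    by (rule has_sum_cong[THEN iffD1, rotated]) (rule FG)
  then have "(G has_sum (zeta_fun s * L_fun s)) ideal_params"
    using has_sum_reindex_bij_betw[OF bij, of G] by simp
  then show "((\<lambda>(g, a, t). of_int (g ^ 2 * a) powr (- s)) has_sum (zeta_fun s * L_fun s)) ideal_params"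
    unfolding G_def .
  have absF: "(\<lambda>p. norm (F p)) summable_on Sigma {1..} ?P" using abs unfolding F_def .
  have neq: "norm (F x) = norm (G (snd x))" if "x \<in> Sigma {1..} ?P" for x
    by (rule arg_cong[OF FG[OF that]])
  have "(\<lambda>x. norm (G (snd x))) summable_on Sigma {1..} ?P"
    using absF by (rule summable_on_cong[THEN iffD1, rotated]) (rule neq)
  then have "(\<lambda>x. norm (G x)) summable_on ideal_params"
    using summable_on_reindex_bij_betw[OF bij, of "\<lambda>x. norm (G x)"] by simp
  then show "(\<lambda>(g, a, t). norm ((of_int (g ^ 2 * a) :: complex) powr (- s))) summable_on ideal_params"
    by (simp add: G_def case_prod_unfold)
qed

lemma zeta_L_class_sum:
  assumes s: "Re s > 1" and q: "q > 4"
  shows "((\<lambda>((a, t), p). of_int (qform a t p) powr (- s)) has_sum (zeta_fun s * L_fun s)) (reps \<times> half_plane)"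
    and "(\<lambda>((a, t), p). norm ((of_int (qform a t p) :: complex) powr (- s))) summable_on (reps \<times> half_plane)"
proof -
  obtain \<psi> where \<psi>: "bij_betw \<psi> ideal_params (reps \<times> half_plane)"
    "\<And>g a t b u p. (g, a, t) \<in> ideal_params \<Longrightarrow> \<psi> (g, a, t) = ((b, u), p) \<Longrightarrow> qform b u p = g ^ 2 * a"
    using ideals_by_class[OF q] by fast
  let ?f = "\<lambda>(g, a, t). (of_int (g ^ 2 * a) :: complex) powr (- s)"
  let ?h = "\<lambda>((a, t), p). (of_int (qform a t p) :: complex) powr (- s)"
  have eq: "?f x = ?h (\<psi> x)" if "x \<in> ideal_params" for x
  proof -
    obtain g a t where x: "x = (g, a, t)" by (metis surj_pair)
    obtain b u p where y: "\<psi> x = ((b, u), p)" by (metis surj_pair)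
    have "qform b u p = g ^ 2 * a" using \<psi>(2) that x y by metis
    then have "?h (\<psi> x) = of_int (g ^ 2 * a) powr (- s)" by (simp only: y prod.case)
    moreover have "?f x = of_int (g ^ 2 * a) powr (- s)" by (simp only: x prod.case)
    ultimately show ?thesis by (simp only:)
  qed
  define F :: "int \<times> int \<times> int \<Rightarrow> complex" where "F = (\<lambda>(g, a, t). of_int (g ^ 2 * a) powr (- s))"
  define G :: "(int \<times> int) \<times> int \<times> int \<Rightarrow> complex" where "G = (\<lambda>((a, t), p). of_int (qform a t p) powr (- s))"
  have FG: "F x = G (\<psi> x)" if "x \<in> ideal_params" for x unfolding F_def G_def by (rule eq[OF that])
  have "(F has_sum (zeta_fun s * L_fun s)) ideal_params" using zeta_L_ideal_sum(1)[OF s] unfolding F_def .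
  then have "((\<lambda>x. G (\<psi> x)) has_sum (zeta_fun s * L_fun s)) ideal_params" by (rule has_sum_cong[THEN iffD1, rotated]) (rule FG)
  then have "(G has_sum (zeta_fun s * L_fun s)) (reps \<times> half_plane)"
    using has_sum_reindex_bij_betw[OF \<psi>(1), of G] by simp
  then show "((\<lambda>((a, t), p). of_int (qform a t p) powr (- s)) has_sum (zeta_fun s * L_fun s)) (reps \<times> half_plane)"
    unfolding G_def .
  have sf: "(\<lambda>x. norm (F x)) summable_on ideal_params"
    using zeta_L_ideal_sum(2)[OF s] by (simp add: F_def case_prod_unfold)
  have neq: "norm (F x) = norm (G (\<psi> x))" if "x \<in> ideal_params" for x
    by (rule arg_cong[OF FG[OF that]])
  have "(\<lambda>x. norm (G (\<psi> x))) summable_on ideal_params"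
    using sf by (rule summable_on_cong[THEN iffD1, rotated]) (rule neq)
  then have "(\<lambda>x. norm (G x)) summable_on (reps \<times> half_plane)"
    using summable_on_reindex_bij_betw[OF \<psi>(1), of "\<lambda>x. norm (G x)"] by simp
  then show "(\<lambda>((a, t), p). norm ((of_int (qform a t p) :: complex) powr (- s))) summable_on (reps \<times> half_plane)"
    by (simp add: G_def case_prod_unfold)
qed

end

section \<open>The sum over a reduced form\<close>

text \<open>The distance from 0 to the interval between \<open>x\<close> and \<open>x + 1\<close>,
  replaced by 1 for the two intervals that touch 0. It bounds the form from below on the whole
  cell.\<close>

definition int_weight :: "int \<Rightarrow> real" where
  "int_weight x = max 1 (of_int (if x \<ge> 0 then x else - x - 1))"

lemma int_weight_ge_1: "int_weight x \<ge> 1"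
  by (simp add: int_weight_def)

lemma int_weight_sum:
  fixes d :: real
  assumes d: "d > 0"
  shows "(\<lambda>x. int_weight x powr (- 1 - d)) summable_on UNIV"
    and "(\<Sum>\<^sub>\<infinity>x. int_weight x powr (- 1 - d)) \<le> 4 + 2 / d"
proof -
  define S where "S = (\<Sum>\<^sub>\<infinity>n. real (Suc n) powr (- 1 - d))"
  have S: "((\<lambda>n. real (Suc n) powr (- 1 - d)) has_sum S) UNIV" unfolding S_def by (rule has_sum_infsum[OF sum_powr_has_sum(1)[OF d]])
  have b1: "bij_betw (\<lambda>n. int (Suc n)) UNIV {1..}" by (rule bij_betwI[of _ _ _ "\<lambda>x. nat (x - 1)"]) auto
  have b2: "bij_betw (\<lambda>n. - int (Suc n) - 1) UNIV {..-2}" by (rule bij_betwI[of _ _ _ "\<lambda>x. nat (- x - 2)"]) auto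
  let ?f = "\<lambda>x. int_weight x powr (- 1 - d)"
  have h1: "(?f has_sum S) {1..}"
    using S has_sum_reindex_bij_betw[OF b1, of ?f S] by (simp add: int_weight_def)
  have h2: "(?f has_sum S) {..-2}"
    using S has_sum_reindex_bij_betw[OF b2, of ?f S] by (simp add: int_weight_def)
  have h3: "(?f has_sum 2) {0, -1}" by (rule has_sum_finiteI) (simp_all add: int_weight_def)
  have "(?f has_sum (S + S + 2)) ({1..} \<union> {..-2} \<union> {0, -1})"
    by (intro has_sum_Un_disjoint h1 h2 h3) auto
  moreover have "{1..} \<union> {..-2} \<union> {0, -1} = (UNIV :: int set)"
  proof -
    have "x \<in> {1..} \<union> {..-2} \<union> {0, -1}" for x :: int by (cases "x \<ge> 1"; cases "x \<le> -2") auto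
    then show ?thesis by blast
  qed
  ultimately have hs: "(?f has_sum (S + S + 2)) UNIV" by simp
  then show "?f summable_on UNIV" by (rule has_sum_imp_summable)
  have "S \<le> 1 + 1 / d" unfolding S_def by (rule sum_powr_has_sum(2)[OF d])
  then show "(\<Sum>\<^sub>\<infinity>x. ?f x) \<le> 4 + 2 / d" using infsumI[OF hs] by (simp add: add_divide_distrib)
qed

text \<open>Decay in the sum of two quantities is shared out between them, which makes double sums
  factor.\<close>

lemma powr_sum_le_product:
  fixes A B p r :: real
  assumes "A > 0" "B > 0" "p \<ge> 0" "r \<ge> 0"
  shows "(A + B) powr (- (p + r)) \<le> A powr (- p) * B powr (- r)"
proof -
  have "(A + B) powr (- (p + r)) = (A + B) powr (- p) * (A + B) powr (- r)" by (simp add: powr_add[symmetric])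
  also have "\<dots> \<le> A powr (- p) * B powr (- r)" using assms by (intro mult_mono powr_mono2') auto
  finally show ?thesis .
qed

lemma mult_sq_powr:
  fixes k w d :: real
  assumes "k > 0" "w > 0"
  shows "(k * w ^ 2) powr (- ((1 + d) / 2)) = k powr (- ((1 + d) / 2)) * w powr (- 1 - d)"
proof -
  have "(w ^ 2) powr (- ((1 + d) / 2)) = (w powr 2) powr (- ((1 + d) / 2))" using assms by simp
  also have "\<dots> = w powr (2 * (- ((1 + d) / 2)))" by (rule powr_powr)
  also have "2 * (- ((1 + d) / 2)) = - 1 - d" by (simp add: field_simps)
  finally show ?thesis using assms by (simp add: powr_mult)
qed

locale reduced_form =
  fixes a b c :: int
  assumes a: "a \<ge> 1" and b: "\<bar>b\<bar> \<le> a" and c: "a \<le> c" and c4: "c \<ge> 4"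
begin

definition u :: "real \<Rightarrow> real \<Rightarrow> real" where
  "u x y = of_int a * x ^ 2 + of_int b * x * y + of_int c * y ^ 2"

lemma reals: "real_of_int a \<ge> 1" "\<bar>real_of_int b\<bar> \<le> of_int a" "real_of_int a \<le> of_int c" "real_of_int c \<ge> 4"
  using a b c c4 by linarith+

lemma u_ge: "u x y \<ge> (of_int a * x ^ 2 + of_int c * y ^ 2) / 2"
proof -
  have "\<bar>of_int b * x * y\<bar> = \<bar>of_int b\<bar> * (\<bar>x\<bar> * \<bar>y\<bar>)" by (simp add: abs_mult)
  also have "\<dots> \<le> of_int a * ((x ^ 2 + y ^ 2) / 2)"
  proof (intro mult_mono)
    have "0 \<le> (\<bar>x\<bar> - \<bar>y\<bar>) ^ 2" by simp
    then show "\<bar>x\<bar> * \<bar>y\<bar> \<le> (x ^ 2 + y ^ 2) / 2" by (simp add: power2_diff)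
  qed (use reals in auto)
  also have "\<dots> \<le> (of_int a * x ^ 2 + of_int c * y ^ 2) / 2"
    using mult_right_mono[OF reals(3), of "y ^ 2"] by (simp add: algebra_simps)
  finally have e: "\<bar>of_int b * x * y\<bar> \<le> (of_int a * x ^ 2 + of_int c * y ^ 2) / 2" .
  have "(P + Q) / 2 \<le> P + E + Q" if "\<bar>E\<bar> \<le> (P + Q) / 2" for P E Q :: real
    using that by (simp add: abs_le_iff field_simps)
  from this[OF e] show ?thesis unfolding u_def .
qed

text \<open>The mixed term takes up at most half of the diagonal part. On the two cells touching 0
  the square of \<open>x\<close> gives nothing, and \<open>a \<le> c * y ^ 2\<close> stands in for
  it; this costs another factor 2.\<close>

lemma u_cell_ge:
  assumes t: "t \<in> {0..1}" and y: "y \<ge> 1"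
  shows "u (of_int x + t) y \<ge> (of_int a * int_weight x ^ 2 + of_int c * y ^ 2) / 4"
proof -
  have y2: "y ^ 2 \<ge> 1" using y by (simp add: one_le_power)
  have "of_int c * y ^ 2 \<ge> of_int c * 1" using y2 reals by (intro mult_left_mono) auto
  then have cy: "of_int a \<le> of_int c * y ^ 2" "0 \<le> of_int c * y ^ 2" using reals by linarith+
  have half: "(P' + Q) / 4 \<le> U" if "(P + Q) / 2 \<le> U" "0 \<le> P" "0 \<le> Q" "P' \<le> P \<or> P' \<le> Q" for P P' Q U :: real
    using that by (auto simp: field_simps)
  show ?thesis
  proof (cases "x = 0 \<or> x = -1")
    case True
    then have w1: "int_weight x = 1" by (auto simp: int_weight_def)
    show ?thesis by (rule half[OF u_ge]) (use reals cy w1 in auto)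
  next
    case False
    have "int_weight x \<le> \<bar>of_int x + t\<bar>"
    proof (cases "x \<ge> 0")
      case True
      then have "x \<ge> 1" using False by auto
      then have "real_of_int x \<ge> 1" by simp
      then show ?thesis using t True by (simp add: int_weight_def)
    next
      case neg: False
      then have "x \<le> -2" using False by auto
      then have "real_of_int x \<le> -2" by simp
      then show ?thesis using t neg by (simp add: int_weight_def)
    qed
    then have "int_weight x ^ 2 \<le> (of_int x + t) ^ 2" using int_weight_ge_1[of x] by (simp add: abs_le_square_iff[symmetric])
    then have "of_int a * int_weight x ^ 2 \<le> of_int a * (of_int x + t) ^ 2" using reals by (intro mult_left_mono) auto
    then show ?thesis by (intro half[OF u_ge]) (use reals cy in auto)
  qed
qed

lemma u_ge_1:
  assumes y: "y \<ge> 1"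
  shows "u x y \<ge> 1"
proof -
  have "y ^ 2 \<ge> 1" using y by (simp add: one_le_power)
  then have "of_int c * y ^ 2 \<ge> 4 * 1" using reals by (intro mult_mono) auto
  moreover have "of_int a * x ^ 2 \<ge> 0" using reals by auto
  moreover have "1 \<le> U" if "4 * 1 \<le> Q" "0 \<le> P" "(P + Q) / 2 \<le> U" for P Q U :: real
    using that by simp
  ultimately show ?thesis using u_ge[of x y] by blast
qed

text \<open>The split of the exponent is free: \<open>p > 1/2\<close> is needed for summation over
  \<open>x\<close>, and what remains decays in \<open>c\<close>. The constant is the square of the 4
  in \<open>u_cell_ge\<close>.\<close>

lemma u_powr_bound:
  assumes t: "t \<in> {0..1}" and y: "y \<ge> 1" and p: "p \<ge> 0" and r: "r \<ge> 0" and pr: "p + r \<le> 2"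
  shows "u (of_int x + t) y powr (- (p + r)) \<le>
    16 * ((of_int a * int_weight x ^ 2) powr (- p) * (of_int c * y ^ 2) powr (- r))"
proof -
  define A B where "A = of_int a * int_weight x ^ 2" and "B = of_int c * y ^ 2"
  have AB: "A > 0" "B > 0" using reals int_weight_ge_1[of x] y by (auto simp: A_def B_def)
  have "u (of_int x + t) y powr (- (p + r)) \<le> ((A + B) / 4) powr (- (p + r))"
    using u_cell_ge[OF t y, of x] AB p r by (intro powr_mono2') (auto simp: A_def B_def)
  also have "\<dots> = 4 powr (p + r) * (A + B) powr (- (p + r))"
    using AB powr_minus_divide[of 4 "p + r"] by (simp only: powr_divide) simp
  also have "\<dots> \<le> 16 * (A powr (- p) * B powr (- r))"
  proof (intro mult_mono powr_sum_le_product AB p r)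
    have "(4::real) powr (p + r) \<le> 4 powr 2" using pr by (intro powr_mono) auto
    then show "(4::real) powr (p + r) \<le> 16" by simp
  qed auto
  finally show ?thesis by (simp add: A_def B_def)
qed

section \<open>Comparison of sums over rows with integrals\<close>

definition f :: "complex \<Rightarrow> real \<Rightarrow> real \<Rightarrow> complex" where
  "f s x y = of_real (u x y) powr (- s)"

text \<open>The mean over one unit interval of row \<open>n + 1\<close>, which replaces the value at
  the left lattice point. Row 0 of the form lies outside this indexing and is summed
  exactly.\<close>

definition cell :: "int \<Rightarrow> nat \<Rightarrow> complex \<Rightarrow> complex" where
  "cell x n s = integral {0..1} (\<lambda>t. f s (of_int x + t) (real (Suc n)))"

definition defect :: "int \<Rightarrow> nat \<Rightarrow> complex \<Rightarrow> complex" where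
  "defect x n s = f s (of_int x) (real (Suc n)) - cell x n s"

lemma u_pos: "y \<ge> 1 \<Longrightarrow> u x y > 0" using u_ge_1[of y x] by linarith

lemma norm_f: "y \<ge> 1 \<Longrightarrow> norm (f s x y) = u x y powr (- Re s)"
  using u_pos[of y x] by (simp add: f_def norm_of_real_powr)

lemma u_cont: "continuous_on A (\<lambda>t. u (x + t) y)"
  unfolding u_def by (intro continuous_intros)

lemma f_cont: "y \<ge> 1 \<Longrightarrow> continuous_on A (\<lambda>t. f s (x + t) y)"
  unfolding f_def using u_pos[of y]
  by (intro continuous_intros u_cont) (auto simp: less_imp_le less_imp_neq[THEN not_sym])

lemma cell_holomorphic: "cell x n holomorphic_on UNIV"
proof -
  define U where "U t = u (of_int x + t) (real (Suc n))" for t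
  have pos: "U t > 0" for t unfolding U_def by (rule u_pos) simp
  have contU: "continuous_on A U" for A unfolding U_def by (rule u_cont)
  have f_exp: "f s (of_int x + t) (real (Suc n)) = exp (- s * of_real (ln (U t)))" for s t
    unfolding f_def U_def[symmetric] using pos[of t] by (simp add: powr_def Ln_of_real)
  have "(\<lambda>s. integral (cbox 0 1) (\<lambda>t. exp (- s * of_real (ln (U t))))) holomorphic_on UNIV"
  proof (rule leibniz_rule_holomorphic[where fx = "\<lambda>s t. - of_real (ln (U t)) * exp (- s * of_real (ln (U t)))"])
    fix s :: complex and t :: real
    show "((\<lambda>s. exp (- s * of_real (ln (U t)))) has_field_derivative
        - of_real (ln (U t)) * exp (- s * of_real (ln (U t)))) (at s within UNIV)"
      by (auto intro!: derivative_eq_intros)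
  next
    fix s :: complex
    show "(\<lambda>t. exp (- s * of_real (ln (U t)))) integrable_on cbox 0 1"
      by (intro integrable_continuous continuous_intros contU) (use pos in \<open>auto simp: less_imp_neq[THEN not_sym]\<close>)
  next
    have c: "continuous_on (UNIV \<times> cbox 0 1) (\<lambda>p :: complex \<times> real. U (snd p))"
      by (rule continuous_on_compose2[OF contU[of UNIV]]) (auto intro: continuous_intros)
    have c1: "continuous_on (UNIV \<times> cbox 0 1) (\<lambda>p :: complex \<times> real. complex_of_real (ln (U (snd p))))"
      by (intro continuous_on_of_real continuous_on_ln c) (use pos in \<open>auto simp: less_imp_neq[THEN not_sym]\<close>)
    have c2: "continuous_on (UNIV \<times> cbox 0 1) (\<lambda>p :: complex \<times> real. exp (- fst p * complex_of_real (ln (U (snd p)))))"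
      by (intro continuous_on_exp continuous_on_mult continuous_on_minus continuous_on_fst continuous_on_id c1)
    show "continuous_on (UNIV \<times> cbox 0 1) (\<lambda>(s :: complex, t). - of_real (ln (U t)) * exp (- s * of_real (ln (U t))))"
      unfolding case_prod_unfold by (intro continuous_on_mult continuous_on_minus c1 c2)
  qed simp
  then show ?thesis unfolding cell_def[abs_def] f_exp by simp
qed

text \<open>The derivative in \<open>x\<close> costs a factor of order sqrt(\<open>a * u\<close>),
  leaving total decay at least \<open>u powr (- 1 - d)\<close>. Halved between the variables, it is
  summable over both, and it yields the saving in \<open>c\<close>.\<close>

lemma defect_bound:
  assumes d: "0 < d" "d \<le> 1" and s: "Re s \<ge> 1 / 2 + d"
  shows "norm (defect x n s) \<le> 32 * norm s * of_int c powr (- (1 / 2)) *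
    (int_weight x powr (- 1 - d) * real (Suc n) powr (- 1 - d))"
proof -
  let ?y = "real (Suc n)"
  define B where "B = 32 * norm s * of_int c powr (- (1 / 2)) * (int_weight x powr (- 1 - d) * ?y powr (- 1 - d))"
  have y: "?y \<ge> 1" by simp
  have w: "int_weight x > 0" using int_weight_ge_1[of x] by linarith
  have B0: "B \<ge> 0" unfolding B_def by (intro mult_nonneg_nonneg) auto
  let ?f' = "\<lambda>t. (2 * of_int a * (of_int x + t) + of_int b * ?y) *\<^sub>R (- s * of_real (u (of_int x + t) ?y) powr (- s - 1))"
  have der: "((\<lambda>t. f s (of_int x + t) ?y) has_vector_derivative ?f' t) (at t within {0..1})" for t
  proof -
    have "((\<lambda>v. of_real v powr (- s)) \<circ> (\<lambda>t. u (of_int x + t) ?y) has_vector_derivative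
        (2 * of_int a * (of_int x + t) + of_int b * ?y) *\<^sub>R (- s * of_real (u (of_int x + t) ?y) powr (- s - 1))) (at t within {0..1})"
    proof (rule vector_diff_chain_within)
      show "((\<lambda>t. u (of_int x + t) ?y) has_vector_derivative 2 * of_int a * (of_int x + t) + of_int b * ?y) (at t within {0..1})"
        unfolding u_def has_real_derivative_iff_has_vector_derivative[symmetric]
        by (auto intro!: derivative_eq_intros simp: algebra_simps)
      show "((\<lambda>v. of_real v powr (- s)) has_vector_derivative (- s * of_real (u (of_int x + t) ?y) powr (- s - 1)))
          (at (u (of_int x + t) ?y) within (\<lambda>t. u (of_int x + t) ?y) ` {0..1})"
        by (rule powr_vector_derivative) (rule u_pos[OF y])
    qed
    then show ?thesis by (simp add: o_def f_def)
  qed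
  have bound: "norm (?f' t) \<le> B" if t: "t \<in> {0..1}" for t
  proof -
    let ?u = "u (of_int x + t) ?y"
    have u1: "?u \<ge> 1" by (rule u_ge_1[OF y])
    have "real_of_int b ^ 2 \<le> of_int a ^ 2" using reals by (simp add: abs_le_square_iff[symmetric])
    also have "\<dots> \<le> 4 * of_int a * of_int c" unfolding power2_eq_square using reals
      by (intro mult_mono) auto
    finally have disc: "0 \<le> (4 * of_int a * of_int c - real_of_int b ^ 2) * ?y ^ 2" by (intro mult_nonneg_nonneg) auto
    \<comment> \<open>Completing the square: the derivative of the form is controlled by the form,
      since the discriminant is not positive.\<close>
    have "(2 * of_int a * (of_int x + t) + of_int b * ?y) ^ 2 = 4 * of_int a * ?u - (4 * of_int a * of_int c - of_int b ^ 2) * ?y ^ 2"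
      unfolding u_def by (simp add: algebra_simps power2_eq_square)
    then have "(2 * of_int a * (of_int x + t) + of_int b * ?y) ^ 2 \<le> 4 * of_int a * ?u" using disc by linarith
    then have "\<bar>2 * of_int a * (of_int x + t) + of_int b * ?y\<bar> \<le> sqrt (4 * of_int a * ?u)"
      by (metis real_sqrt_abs real_sqrt_le_mono)
    also have "\<dots> = 2 * of_int a powr (1 / 2) * ?u powr (1 / 2)"
      using reals u1 by (simp add: real_sqrt_mult powr_half_sqrt)
    finally have lin: "\<bar>2 * of_int a * (of_int x + t) + of_int b * ?y\<bar> \<le> 2 * of_int a powr (1 / 2) * ?u powr (1 / 2)" .
    have "norm (?f' t) = \<bar>2 * of_int a * (of_int x + t) + of_int b * ?y\<bar> * (norm s * ?u powr (- Re s - 1))"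
      using u1 by (simp add: norm_mult norm_of_real_powr)
    also have "\<dots> \<le> (2 * of_int a powr (1 / 2) * ?u powr (1 / 2)) * (norm s * ?u powr (- Re s - 1))"
      by (intro mult_right_mono lin) auto
    also have "\<dots> = 2 * norm s * of_int a powr (1 / 2) * ?u powr (- Re s - 1 / 2)"
    proof -
      have "?u powr (1 / 2) * ?u powr (- Re s - 1) = ?u powr (1 / 2 + (- Re s - 1))" by (rule powr_add[symmetric])
      also have "1 / 2 + (- Re s - 1) = - Re s - 1 / 2" by simp
      finally show ?thesis by (simp only: mult_ac)
    qed
    also have "\<dots> \<le> 2 * norm s * of_int a powr (1 / 2) * ?u powr (- ((1 + d) / 2 + (1 + d) / 2))"
      using s u1 by (intro mult_left_mono powr_mono) (auto simp: field_simps)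
    also have "\<dots> \<le> 2 * norm s * of_int a powr (1 / 2) *
        (16 * ((of_int a * int_weight x ^ 2) powr (- ((1 + d) / 2)) * (of_int c * ?y ^ 2) powr (- ((1 + d) / 2))))"
      by (intro mult_left_mono u_powr_bound t y) (use d in auto)
    also have "\<dots> = 32 * norm s * (of_int a powr (1 / 2) * of_int a powr (- ((1 + d) / 2))) *
        of_int c powr (- ((1 + d) / 2)) * (int_weight x powr (- 1 - d) * ?y powr (- 1 - d))"
    proof -
      have "(of_int a * int_weight x ^ 2) powr (- ((1 + d) / 2)) = of_int a powr (- ((1 + d) / 2)) * int_weight x powr (- 1 - d)"
        using reals w by (intro mult_sq_powr) auto
      moreover have "(of_int c * ?y ^ 2) powr (- ((1 + d) / 2)) = of_int c powr (- ((1 + d) / 2)) * ?y powr (- 1 - d)"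
        using reals by (intro mult_sq_powr) auto
      ultimately show ?thesis by (simp add: mult_ac)
    qed
    \<comment> \<open>The factor \<open>a powr (1 / 2)\<close> from the derivative is absorbed by
      the decay in \<open>a\<close>, so that no power of \<open>a\<close> remains.\<close>
    also have "\<dots> \<le> 32 * norm s * 1 * of_int c powr (- (1 / 2)) * (int_weight x powr (- 1 - d) * ?y powr (- 1 - d))"
    proof (intro mult_right_mono mult_mono mult_left_mono)
      have "of_int a powr (1 / 2) * of_int a powr (- ((1 + d) / 2)) = of_int a powr (- (d / 2))"
        by (simp add: powr_add[symmetric] field_simps)
      also have "\<dots> \<le> of_int a powr 0" using reals d by (intro powr_mono) auto
      finally show "of_int a powr (1 / 2) * of_int a powr (- ((1 + d) / 2)) \<le> 1" using reals by simp
      show "real_of_int c powr (- ((1 + d) / 2)) \<le> of_int c powr (- (1 / 2))"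
        using reals d by (intro powr_mono) (auto simp: field_simps)
    qed auto
    finally show ?thesis by (simp add: B_def)
  qed
  have integ: "(\<lambda>t. f s (of_int x + t) ?y) integrable_on {0..1}"
    by (intro integrable_continuous_real f_cont y)
  have "defect x n s = integral {0..1} (\<lambda>t. f s (of_int x) ?y - f s (of_int x + t) ?y)"
    unfolding defect_def cell_def using integ by (subst integral_diff) auto
  also have "norm \<dots> \<le> integral {0..1::real} (\<lambda>t. B)"
  proof (rule Henstock_Kurzweil_Integration.integral_norm_bound_integral)
    show "(\<lambda>t. f s (of_int x) ?y - f s (of_int x + t) ?y) integrable_on {0..1}"
      by (intro integrable_diff integ) auto
    fix t :: real assume t: "t \<in> {0..1}"
    have "norm (f s (of_int x + 0) ?y - f s (of_int x + t) ?y) \<le> B * \<bar>0 - t\<bar>"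
      by (rule vector_derivative_bound[OF der bound]) (use t in auto)
    also have "\<dots> \<le> B * 1" using t B0 by (intro mult_left_mono) auto
    finally show "norm (f s (of_int x) ?y - f s (of_int x + t) ?y) \<le> B" by simp
  qed auto
  finally show ?thesis by (simp add: B_def)
qed

text \<open>Only the first row is needed, because the others are rescalings of it. The excess
  \<open>d / 2\<close> beyond summability in \<open>x\<close> is spent on \<open>c\<close>.\<close>

lemma cell_bound:
  assumes d: "0 < d" "d \<le> 1" and s: "Re s \<ge> 1 / 2 + d"
  shows "norm (cell x 0 s) \<le> 16 * of_int c powr (- (d / 2)) * int_weight x powr (- 1 - d)"
proof -
  have w: "int_weight x > 0" using int_weight_ge_1[of x] by linarith
  have "norm (cell x 0 s) \<le> integral {0..1::real} (\<lambda>t. 16 * of_int c powr (- (d / 2)) * int_weight x powr (- 1 - d))"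
    unfolding cell_def
  proof (rule Henstock_Kurzweil_Integration.integral_norm_bound_integral)
    show "(\<lambda>t. f s (of_int x + t) (real (Suc 0))) integrable_on {0..1}"
      by (intro integrable_continuous_real f_cont) simp
    fix t :: real assume t: "t \<in> {0..1}"
    let ?u = "u (of_int x + t) 1"
    have u1: "?u \<ge> 1" by (rule u_ge_1) simp
    have "norm (f s (of_int x + t) (real (Suc 0))) = ?u powr (- Re s)" by (simp add: norm_f)
    also have "\<dots> \<le> ?u powr (- ((1 + d) / 2 + d / 2))" using s u1 by (intro powr_mono) (auto simp: field_simps)
    also have "\<dots> \<le> 16 * ((of_int a * int_weight x ^ 2) powr (- ((1 + d) / 2)) * (of_int c * 1 ^ 2) powr (- (d / 2)))"
      by (intro u_powr_bound t) (use d in \<open>auto simp: field_simps\<close>)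
    also have "\<dots> \<le> 16 * (int_weight x powr (- 1 - d) * of_int c powr (- (d / 2)))"
    proof -
      have "(of_int a * int_weight x ^ 2) powr (- ((1 + d) / 2)) \<le> (1 * int_weight x ^ 2) powr (- ((1 + d) / 2))"
        using reals w d by (intro powr_mono2' mult_right_mono) auto
      also have "\<dots> = int_weight x powr (- 1 - d)"
        using mult_sq_powr[of 1 "int_weight x" d] w by simp
      finally show ?thesis by (intro mult_left_mono mult_mono) auto
    qed
    finally show "norm (f s (of_int x + t) (real (Suc 0))) \<le> 16 * of_int c powr (- (d / 2)) * int_weight x powr (- 1 - d)"
      by (simp add: mult_ac)
  qed auto
  then show ?thesis by simp
qed

lemma f_scale:
  assumes y: "y \<ge> 1"
  shows "f s x y = of_real y powr (- (2 * s)) * f s (x / y) 1"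
proof -
  have y0: "y > 0" using y by simp
  have "u x y = y * (y * u (x / y) 1)" using y0 by (simp add: u_def field_simps power2_eq_square)
  moreover have "u (x / y) 1 > 0" by (rule u_pos) simp
  ultimately have "f s x y = of_real y powr (- s) * (of_real y powr (- s) * of_real (u (x / y) 1) powr (- s))"
    unfolding f_def using y0
    by (simp add: powr_times_real)
  also have "of_real y powr (- s) * (of_real y powr (- s) * of_real (u (x / y) 1) powr (- s)) =
      (of_real y powr (- s) * of_real y powr (- s)) * f s (x / y) 1" by (simp add: f_def)
  also have "of_real y powr (- s) * of_real y powr (- s) = of_real y powr (- (2 * s))"
    by (simp add: powr_add[symmetric])
  finally show ?thesis .
qed

text \<open>Cutting the unit interval from \<open>k\<close> to \<open>k + 1\<close> into \<open>y\<close> equal pieces, rescaled by \<open>y\<close>, gives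
  \<open>y\<close> consecutive cells of row \<open>y\<close>.\<close>

lemma sum_cells_row:
  "(\<Sum>r<Suc n. cell (k * int (Suc n) + int r) n s) = of_nat (Suc n) powr (1 - 2 * s) * cell k 0 s"
proof -
  define y where "y = real (Suc n)"
  have y: "y \<ge> 1" "y > 0" by (auto simp: y_def)
  obtain g where g: "\<And>\<tau>. \<tau> \<in> {of_int k..of_int k + 1} \<Longrightarrow>
      (g has_vector_derivative f s (\<tau> + 0) 1) (at \<tau> within {of_int k..of_int k + 1})"
    using antiderivative_continuous[of "of_int k" "of_int k + 1" "\<lambda>\<tau>. f s (\<tau> + 0) 1"] f_cont[of 1]
    by (metis (no_types, lifting) continuous_on_cong add.commute order_refl)
  have piece: "cell (k * int (Suc n) + int r) n s =
      of_real y powr (- (2 * s)) * (of_real y * (g (of_int k + real (Suc r) / y) - g (of_int k + real r / y)))"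
    if r: "r < Suc n" for r
  proof -
    let ?h = "\<lambda>t. of_int k + (real r + t) / y"
    have range: "?h t \<in> {of_int k..of_int k + 1}" if "t \<in> {0..1}" for t
    proof -
      have "real r + t \<le> y" using r that by (auto simp: y_def)
      then show ?thesis using y that by (auto simp: field_simps)
    qed
    have "((\<lambda>t. y *\<^sub>R g (?h t)) has_vector_derivative y *\<^sub>R ((1 / y) *\<^sub>R f s (?h t + 0) 1)) (at t within {0..1})"
      if t: "t \<in> {0..1}" for t
    proof -
      have h: "(?h has_vector_derivative 1 / y) (at t within {0..1})"
        unfolding has_real_derivative_iff_has_vector_derivative[symmetric]
        using y by (auto intro!: derivative_eq_intros)
      have "(g has_vector_derivative f s (?h t + 0) 1) (at (?h t) within ?h ` {0..1})"
        by (rule has_vector_derivative_within_subset[OF g[OF range[OF t]]]) (use range in auto)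
      from vector_diff_chain_within[OF h this]
      have "(g \<circ> ?h has_vector_derivative (1 / y) *\<^sub>R f s (?h t + 0) 1) (at t within {0..1})" .
      then show ?thesis by (intro bounded_linear.has_vector_derivative[OF bounded_linear_scaleR_right]) (simp add: o_def)
    qed
    then have "((\<lambda>t. y *\<^sub>R ((1 / y) *\<^sub>R f s (?h t + 0) 1)) has_integral (y *\<^sub>R g (?h 1) - y *\<^sub>R g (?h 0))) {0..1}"
      by (intro fundamental_theorem_of_calculus) auto
    then have "((\<lambda>t. of_real y powr (- (2 * s)) * f s (?h t) 1) has_integral
        of_real y powr (- (2 * s)) * (y *\<^sub>R g (?h 1) - y *\<^sub>R g (?h 0))) {0..1}"
      using y by (intro has_integral_mult_right) simp
    moreover have "of_real y powr (- (2 * s)) * f s (?h t) 1 = f s (of_int (k * int (Suc n) + int r) + t) y" for t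
    proof -
      have "(of_int (k * int (Suc n) + int r) + t) / y = ?h t" using y by (simp add: y_def field_simps)
      then show ?thesis using f_scale[OF y(1), of s "of_int (k * int (Suc n) + int r) + t"] by (simp only:)
    qed
    ultimately have "((\<lambda>t. f s (of_int (k * int (Suc n) + int r) + t) y) has_integral
        of_real y powr (- (2 * s)) * (y *\<^sub>R g (?h 1) - y *\<^sub>R g (?h 0))) {0..1}" by (simp only:)
    then show ?thesis unfolding cell_def y_def[symmetric]
      by (simp add: integral_unique scaleR_conv_of_real right_diff_distrib add.commute)
  qed
  have "((\<lambda>t. f s (of_int k + t) 1) has_integral (g (of_int k + 1) - g (of_int k + 0))) {0..1}"
  proof (rule fundamental_theorem_of_calculus)
    fix t :: real assume t: "t \<in> {0..1}"
    have h: "((\<lambda>t. of_int k + t) has_vector_derivative 1) (at t within {0..1})"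
      unfolding has_real_derivative_iff_has_vector_derivative[symmetric] by (auto intro!: derivative_eq_intros)
    have "(g has_vector_derivative f s (of_int k + t + 0) 1) (at (of_int k + t) within (\<lambda>t. of_int k + t) ` {0..1})"
      by (rule has_vector_derivative_within_subset[OF g]) (use t in auto)
    from vector_diff_chain_within[OF h this]
    show "((\<lambda>t. g (of_int k + t)) has_vector_derivative f s (of_int k + t) 1) (at t within {0..1})"
      by (simp add: o_def)
  qed simp
  then have "cell k 0 s = g (of_int k + 1) - g (of_int k)" by (simp add: cell_def integral_unique)
  moreover have "(\<Sum>r<Suc n. cell (k * int (Suc n) + int r) n s) =
      of_real y powr (- (2 * s)) * (of_real y * (\<Sum>r<Suc n. g (of_int k + real (Suc r) / y) - g (of_int k + real r / y)))"
    unfolding sum_distrib_left by (intro sum.cong refl piece) simp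
  moreover have "(\<Sum>r<Suc n. g (of_int k + real (Suc r) / y) - g (of_int k + real r / y)) = g (of_int k + 1) - g (of_int k)"
    using y(2) sum_lessThan_telescope[of "\<lambda>r. g (of_int k + real r / y)" "Suc n"]
    by (simp add: y_def[symmetric] del: of_nat_Suc sum.lessThan_Suc)
  moreover have "of_real y powr (- (2 * s)) * of_real y = of_nat (Suc n) powr (1 - 2 * s)"
  proof -
    have "of_real y powr (- (2 * s)) * of_real y powr 1 = of_real y powr (- (2 * s) + 1)" by (rule powr_add[symmetric])
    then show ?thesis using y by (simp add: y_def add.commute del: of_nat_Suc)
  qed
  ultimately show ?thesis by (simp add: mult.assoc[symmetric] del: sum.lessThan_Suc of_nat_Suc)
qed

text \<open>The integral of \<open>f s x 1\<close> over the whole real line. By homogeneity the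
  integral over row \<open>y\<close> is \<open>y\<close> to the power \<open>1 - 2 * s\<close> times
  this, so all rows together give zeta(2s - 1) times \<open>W s\<close>, a product that makes sense
  beyond \<open>Re s > 1\<close>.\<close>

definition W :: "complex \<Rightarrow> complex" where "W s = (\<Sum>\<^sub>\<infinity>x. cell x 0 s)"

lemma W_summable:
  assumes d: "0 < d" "d \<le> 1" and s: "Re s \<ge> 1 / 2 + d"
  shows "(\<lambda>x. norm (cell x 0 s)) summable_on UNIV"
    and "norm (W s) \<le> 16 * of_int c powr (- (d / 2)) * (4 + 2 / d)"
proof -
  let ?M = "\<lambda>x. 16 * of_int c powr (- (d / 2)) * int_weight x powr (- 1 - d)"
  have M: "?M summable_on UNIV" by (intro summable_on_cmult_right int_weight_sum d)
  show sm: "(\<lambda>x. norm (cell x 0 s)) summable_on UNIV"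
    by (rule Infinite_Sum.abs_summable_on_comparison_test'[OF M]) (rule cell_bound[OF d s])
  have "norm (W s) \<le> (\<Sum>\<^sub>\<infinity>x. norm (cell x 0 s))" unfolding W_def by (rule norm_infsum_bound[OF sm])
  also have "\<dots> \<le> (\<Sum>\<^sub>\<infinity>x. ?M x)" by (intro infsum_mono sm M cell_bound d s)
  also have "\<dots> = 16 * of_int c powr (- (d / 2)) * (\<Sum>\<^sub>\<infinity>x. int_weight x powr (- 1 - d))"
    by (rule infsum_cmult_right')
  also have "\<dots> \<le> 16 * of_int c powr (- (d / 2)) * (4 + 2 / d)"
    using d by (intro mult_left_mono int_weight_sum) auto
  finally show "norm (W s) \<le> 16 * of_int c powr (- (d / 2)) * (4 + 2 / d)" .
qed

definition defect_sum :: "complex \<Rightarrow> complex" where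
  "defect_sum s = (\<Sum>\<^sub>\<infinity>(x, n)\<in>UNIV. defect x n s)"

lemma weight_product_sum:
  assumes d: "(d::real) > 0"
  shows "(\<lambda>(x, n). int_weight x powr (- 1 - d) * real (Suc n) powr (- 1 - d)) summable_on UNIV"
    and "(\<Sum>\<^sub>\<infinity>(x, n)\<in>UNIV. int_weight x powr (- 1 - d) * real (Suc n) powr (- 1 - d)) \<le> (4 + 2 / d) * (1 + 1 / d)"
proof -
  have "((\<lambda>(x, n). int_weight x powr (- 1 - d) * real (Suc n) powr (- 1 - d)) has_sum
      ((\<Sum>\<^sub>\<infinity>x. int_weight x powr (- 1 - d)) * (\<Sum>\<^sub>\<infinity>n. real (Suc n) powr (- 1 - d)))) (UNIV \<times> UNIV)"
    using int_weight_sum(1)[OF d] sum_powr_has_sum(1)[OF d]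
    by (intro has_sum_product has_sum_infsum) auto
  then have hs: "((\<lambda>(x, n). int_weight x powr (- 1 - d) * real (Suc n) powr (- 1 - d)) has_sum
      ((\<Sum>\<^sub>\<infinity>x. int_weight x powr (- 1 - d)) * (\<Sum>\<^sub>\<infinity>n. real (Suc n) powr (- 1 - d)))) UNIV" by simp
  then show "(\<lambda>(x, n). int_weight x powr (- 1 - d) * real (Suc n) powr (- 1 - d)) summable_on UNIV"
    by (rule has_sum_imp_summable)
  have "(\<Sum>\<^sub>\<infinity>x. int_weight x powr (- 1 - d)) * (\<Sum>\<^sub>\<infinity>n. real (Suc n) powr (- 1 - d)) \<le> (4 + 2 / d) * (1 + 1 / d)"
    using d by (intro mult_mono int_weight_sum sum_powr_has_sum infsum_nonneg) auto
  then show "(\<Sum>\<^sub>\<infinity>(x, n)\<in>UNIV. int_weight x powr (- 1 - d) * real (Suc n) powr (- 1 - d)) \<le> (4 + 2 / d) * (1 + 1 / d)"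
    using infsumI[OF hs] by simp
qed

lemma defect_summable:
  assumes d: "0 < d" "d \<le> 1" and s: "Re s \<ge> 1 / 2 + d"
  shows "(\<lambda>(x, n). norm (defect x n s)) summable_on UNIV"
    and "norm (defect_sum s) \<le> 32 * norm s * of_int c powr (- (1 / 2)) * ((4 + 2 / d) * (1 + 1 / d))"
proof -
  define K where "K = 32 * norm s * of_int c powr (- (1 / 2))"
  define M where "M = (\<lambda>(x, n). int_weight x powr (- 1 - d) * real (Suc n) powr (- 1 - d))"
  have M: "(\<lambda>p. K * M p) summable_on UNIV"
    using weight_product_sum(1)[OF d(1)] unfolding M_def by (rule summable_on_cmult_right)
  define D where "D = (\<lambda>(x, n). defect x n s)"
  have le: "norm (D p) \<le> K * M p" for p
    using defect_bound[OF d s] by (auto simp: D_def M_def K_def split: prod.splits)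
  have sm: "(\<lambda>p. norm (D p)) summable_on UNIV"
    by (rule Infinite_Sum.abs_summable_on_comparison_test'[OF M]) (rule le)
  then show "(\<lambda>(x, n). norm (defect x n s)) summable_on UNIV" by (simp add: D_def case_prod_unfold)
  have "norm (\<Sum>\<^sub>\<infinity>p. D p) \<le> (\<Sum>\<^sub>\<infinity>p. norm (D p))" by (rule norm_infsum_bound[OF sm])
  also have "\<dots> \<le> (\<Sum>\<^sub>\<infinity>p. K * M p)" by (intro infsum_mono sm M le)
  also have "\<dots> = K * (\<Sum>\<^sub>\<infinity>p. M p)" by (rule infsum_cmult_right')
  also have "\<dots> \<le> K * ((4 + 2 / d) * (1 + 1 / d))"
    using weight_product_sum(2)[OF d(1)] unfolding M_def K_def by (intro mult_left_mono) auto
  finally show "norm (defect_sum s) \<le> 32 * norm s * of_int c powr (- (1 / 2)) * ((4 + 2 / d) * (1 + 1 / d))"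
    by (simp add: defect_sum_def D_def K_def)
qed

lemma half_plane_neighbourhood:
  fixes z :: complex
  assumes "Re z > 1 / 2"
  obtains V d where "open V" "z \<in> V" "0 < d" "d \<le> 1" "\<And>w. w \<in> V \<Longrightarrow> Re w \<ge> 1 / 2 + d" "\<And>w. w \<in> V \<Longrightarrow> norm w \<le> norm z + 1"
proof -
  obtain V e where V: "open V" "z \<in> V" "e > 0" "\<And>w. w \<in> V \<Longrightarrow> Re w > 1 / 2 + e" "\<And>w. w \<in> V \<Longrightarrow> norm w \<le> norm z + 1"
    using bounded_neighbourhood[OF assms] by blast
  show thesis
  proof (rule that[of V "min e 1"])
    show "Re w \<ge> 1 / 2 + min e 1" if "w \<in> V" for w using V(4)[OF that] by linarith
  qed (use V in auto)
qed

lemma W_holomorphic: "W holomorphic_on {s. Re s > 1 / 2}"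
  unfolding W_def
proof (rule holomorphic_infsum)
  show "open {s. Re s > 1 / 2}" by (rule open_halfspace_Re_gt)
  show "cell x 0 holomorphic_on {s. Re s > 1 / 2}" for x
    using cell_holomorphic by (rule holomorphic_on_subset) simp
  fix z :: complex assume "z \<in> {s. Re s > 1 / 2}"
  then obtain V d where V: "open V" "z \<in> V" "0 < d" "d \<le> 1" "\<And>w. w \<in> V \<Longrightarrow> Re w \<ge> 1 / 2 + d"
    using half_plane_neighbourhood[of z] by (metis mem_Collect_eq)
  show "\<exists>V M. open V \<and> z \<in> V \<and> M summable_on UNIV \<and> (\<forall>x\<in>UNIV. \<forall>w\<in>V. norm (cell x 0 w) \<le> M x)"
    using V cell_bound[OF V(3,4) V(5)]
    by (intro exI[of _ V] exI[of _ "\<lambda>x. 16 * of_int c powr (- (d / 2)) * int_weight x powr (- 1 - d)"] conjI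
        summable_on_cmult_right int_weight_sum) auto
qed

lemma defect_sum_holomorphic: "defect_sum holomorphic_on {s. Re s > 1 / 2}"
proof -
  have "(\<lambda>s. \<Sum>\<^sub>\<infinity>p\<in>UNIV. (\<lambda>p s. defect (fst p) (snd p) s) p s) holomorphic_on {s. Re s > 1 / 2}"
  proof (rule holomorphic_infsum)
    show "open {s. Re s > 1 / 2}" by (rule open_halfspace_Re_gt)
    have "u (of_int x) (real (Suc n)) > 0" for x n by (rule u_pos) simp
    then have "(\<lambda>s. f s (of_int x) (real (Suc n))) holomorphic_on UNIV" for x n
      unfolding f_def by (intro holomorphic_intros)
    then show "(\<lambda>s. defect (fst p) (snd p) s) holomorphic_on {s. Re s > 1 / 2}" for p
      unfolding defect_def
      by (intro holomorphic_on_diff holomorphic_on_subset[OF cell_holomorphic]) (auto intro: holomorphic_on_subset)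
    fix z :: complex assume "z \<in> {s. Re s > 1 / 2}"
    then obtain V d where V: "open V" "z \<in> V" "0 < d" "d \<le> 1" "\<And>w. w \<in> V \<Longrightarrow> Re w \<ge> 1 / 2 + d" "\<And>w. w \<in> V \<Longrightarrow> norm w \<le> norm z + 1"
      using half_plane_neighbourhood[of z] by (metis mem_Collect_eq)
    define M where "M = (\<lambda>(x, n). int_weight x powr (- 1 - d) * real (Suc n) powr (- 1 - d))"
    have "norm (defect (fst p) (snd p) w) \<le> 32 * (norm z + 1) * of_int c powr (- (1 / 2)) * M p" if w: "w \<in> V" for p w
    proof -
      have "norm (defect (fst p) (snd p) w) \<le> 32 * norm w * of_int c powr (- (1 / 2)) * M p"
        using defect_bound[OF V(3,4) V(5)[OF w], of "fst p" "snd p"] by (simp add: M_def case_prod_unfold)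
      also have "\<dots> \<le> 32 * (norm z + 1) * of_int c powr (- (1 / 2)) * M p"
        using V(6)[OF w] by (intro mult_right_mono mult_left_mono) (auto simp: M_def split: prod.splits)
      finally show ?thesis .
    qed
    moreover have "(\<lambda>p. 32 * (norm z + 1) * of_int c powr (- (1 / 2)) * M p) summable_on UNIV"
      using weight_product_sum(1)[OF V(3)] unfolding M_def by (rule summable_on_cmult_right)
    ultimately show "\<exists>V M. open V \<and> z \<in> V \<and> M summable_on UNIV \<and> (\<forall>p\<in>UNIV. \<forall>w\<in>V. norm (defect (fst p) (snd p) w) \<le> M p)"
      using V by (intro exI[of _ V] exI[of _ "\<lambda>p. 32 * (norm z + 1) * of_int c powr (- (1 / 2)) * M p"]) auto
  qed
  then show ?thesis unfolding defect_sum_def by (simp add: case_prod_unfold)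
qed

lemma row_cells_has_sum:
  assumes s: "Re s > 1" and summ: "(\<lambda>x. cell x n s) summable_on UNIV"
  shows "((\<lambda>x. cell x n s) has_sum (of_nat (Suc n) powr (- (2 * s - 1)) * W s)) UNIV"
proof -
  define S where "S = (\<Sum>\<^sub>\<infinity>x. cell x n s)"
  have hs: "((\<lambda>x. cell x n s) has_sum S) UNIV" unfolding S_def by (rule has_sum_infsum[OF summ])
  let ?y = "int (Suc n)"
  \<comment> \<open>Division with remainder by \<open>n + 1\<close> groups the cells of a row into
    blocks that rescale to single cells of the first row.\<close>
  have bij: "bij_betw (\<lambda>(k, r). k * ?y + int r) (UNIV \<times> {..<Suc n}) UNIV"
  proof (rule bij_betwI[of _ _ _ "\<lambda>x. (x div ?y, nat (x mod ?y))"])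
    show "(\<lambda>x. (x div ?y, nat (x mod ?y))) \<in> UNIV \<rightarrow> UNIV \<times> {..<Suc n}"
      by (auto simp: nat_less_iff)
    show "(\<lambda>(k, r). k * ?y + int r) (x div ?y, nat (x mod ?y)) = x" for x
      by (simp only: prod.case) (simp add: div_mult_mod_eq del: of_nat_Suc)
    show "(\<lambda>x. (x div ?y, nat (x mod ?y))) ((\<lambda>(k, r). k * ?y + int r) p) = p" if p: "p \<in> UNIV \<times> {..<Suc n}" for p
    proof -
      obtain k r where kr: "p = (k, r)" "r < Suc n" using p by auto
      then have "(k * ?y + int r) div ?y = k" "(k * ?y + int r) mod ?y = int r" by (auto simp del: of_nat_Suc)
      then show ?thesis using kr by simp
    qed
  qed simp
  have "((\<lambda>p. cell ((\<lambda>(k, r). k * ?y + int r) p) n s) has_sum S) (UNIV \<times> {..<Suc n})"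
    using has_sum_reindex_bij_betw[OF bij, of "\<lambda>x. cell x n s" S] hs by simp
  then have "((\<lambda>k. \<Sum>r<Suc n. cell (k * ?y + int r) n s) has_sum S) UNIV"
    by (rule has_sum_SigmaD) (auto intro!: has_sum_finiteI)
  then have "((\<lambda>k. of_nat (Suc n) powr (1 - 2 * s) * cell k 0 s) has_sum S) UNIV"
    unfolding sum_cells_row .
  moreover have "((\<lambda>k. of_nat (Suc n) powr (1 - 2 * s) * cell k 0 s) has_sum (of_nat (Suc n) powr (1 - 2 * s) * W s)) UNIV"
    unfolding W_def using s W_summable(1)[of "1/2" s]
    by (intro has_sum_cmult_right has_sum_infsum) (auto intro: abs_summable_summable)
  ultimately have "S = of_nat (Suc n) powr (1 - 2 * s) * W s" by (rule has_sum_unique)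
  then show ?thesis using hs by simp
qed

text \<open>Each value is its defect plus its cell. The defects converge as a double sum, and the
  cells are summed row by row.\<close>

lemma upper_half_plane_sum:
  assumes s: "Re s > 1"
    and hs: "((\<lambda>(x, n). f s (of_int x) (real (Suc n))) has_sum V) UNIV"
  shows "V = defect_sum s + zeta_fun (2 * s - 1) * W s"
proof -
  have half: "0 < (1/2::real)" "1/2 \<le> (1::real)" "Re s \<ge> 1 / 2 + 1 / 2" using s by auto
  have D: "((\<lambda>(x, n). defect x n s) has_sum defect_sum s) UNIV"
    unfolding defect_sum_def using defect_summable(1)[OF half]
    by (intro has_sum_infsum abs_summable_summable[of "\<lambda>(x, n). defect x n s"]) (simp add: case_prod_unfold)
  have "((\<lambda>p. (\<lambda>(x, n). f s (of_int x) (real (Suc n))) p + - (\<lambda>(x, n). defect x n s) p) has_sum (V + - defect_sum s)) UNIV"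
    by (intro has_sum_add hs has_sum_uminusI D)
  \<comment> \<open>Joint summability of the cells is inherited from that of the values and of the
    defects, which permits interchanging the order.\<close>
  then have C: "((\<lambda>(x, n). cell x n s) has_sum (V - defect_sum s)) (UNIV \<times> UNIV)"
    by (simp add: defect_def case_prod_unfold)
  then have C': "((\<lambda>(n, x). cell x n s) has_sum (V - defect_sum s)) (UNIV \<times> UNIV)"
    by (subst (asm) has_sum_swap) (simp add: case_prod_unfold)
  have "((\<lambda>n. of_nat (Suc n) powr (- (2 * s - 1)) * W s) has_sum (V - defect_sum s)) UNIV"
  proof (rule has_sum_SigmaD[OF C'])
    fix n :: nat
    have "(\<lambda>x. cell x n s) summable_on UNIV"
      using summable_on_SigmaD1[OF has_sum_imp_summable[OF C'], of n] by simp
    from row_cells_has_sum[OF s this]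
    show "((\<lambda>x. (\<lambda>(n, x). cell x n s) (n, x)) has_sum of_nat (Suc n) powr (- (2 * s - 1)) * W s) UNIV" by simp
  qed
  moreover have "Re (2 * s - 1) > 1" using s by simp
  then have "((\<lambda>n. of_nat (Suc n) powr (- (2 * s - 1)) * W s) has_sum (zeta_fun (2 * s - 1) * W s)) UNIV"
    by (intro has_sum_cmult_left zeta_fun_has_sum)
  ultimately have "V - defect_sum s = zeta_fun (2 * s - 1) * W s" by (rule has_sum_unique)
  then show ?thesis by (simp add: algebra_simps)
qed

text \<open>The Epstein zeta function of the form over half of the lattice, in a shape valid for
  \<open>Re s > 1/2\<close> away from 1: the axis \<open>y = 0\<close>, then the defects, then the
  integrals.\<close>

definition form_sum :: "complex \<Rightarrow> complex" where
  "form_sum s = of_int a powr (- s) * zeta_fun (2 * s) + (defect_sum s + zeta_fun (2 * s - 1) * W s)"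

lemma half_plane_sum:
  assumes s: "Re s > 1"
    and hs: "((\<lambda>p. f s (of_int (fst p)) (of_int (snd p))) has_sum V) half_plane"
  shows "V = form_sum s"
proof -
  let ?F = "\<lambda>p. f s (of_int (fst p)) (of_int (snd p))"
  let ?i = "\<lambda>n. (int (Suc n), 0 :: int)" and ?j = "\<lambda>p. (fst p :: int, int (Suc (snd p)))"
  have split: "half_plane = range ?i \<union> range ?j"
  proof (intro equalityI subsetI)
    fix p assume p: "p \<in> half_plane"
    obtain x y where xy: "p = (x, y)" by (cases p)
    show "p \<in> range ?i \<union> range ?j"
    proof (cases "y > 0")
      case True
      then have "p = ?j (x, nat (y - 1))" by (simp add: xy)
      then show ?thesis by blast
    next
      case False
      then have "p = ?i (nat (x - 1))" using p by (auto simp: xy half_plane_def)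
      then show ?thesis by blast
    qed
  qed (auto simp: half_plane_def)
  have disj: "range ?i \<inter> range ?j = {}" by auto
  have i: "inj ?i" by (auto simp: inj_def)
  have j: "inj ?j" by (auto simp: inj_def prod_eq_iff)
  have real_axis: "(?F has_sum (of_int a powr (- s) * zeta_fun (2 * s))) (range ?i)"
  proof -
    have "((\<lambda>n. of_int a powr (- s) * of_nat (Suc n) powr (- (2 * s))) has_sum (of_int a powr (- s) * zeta_fun (2 * s))) UNIV"
      using s by (intro has_sum_cmult_right zeta_fun_has_sum) simp
    moreover have "of_int a powr (- s) * of_nat (Suc n) powr (- (2 * s)) = ?F (?i n)" for n
    proof -
      have "f s (real (Suc n)) 0 = of_real (of_int a * (real (Suc n) * real (Suc n))) powr (- s)"
        by (simp add: f_def u_def power2_eq_square)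
      also have "\<dots> = of_real (of_int a) powr (- s) * (of_real (real (Suc n)) powr (- s) * of_real (real (Suc n)) powr (- s))"
        using reals by (simp add: powr_times_real del: of_nat_Suc)
      also have "of_real (real (Suc n)) powr (- s) * of_real (real (Suc n)) powr (- s) = of_nat (Suc n) powr (- (2 * s))"
        by (simp add: powr_add[symmetric] del: of_nat_Suc)
      finally show ?thesis by (simp del: of_nat_Suc)
    qed
    ultimately have "((\<lambda>n. ?F (?i n)) has_sum (of_int a powr (- s) * zeta_fun (2 * s))) UNIV" by (simp only:)
    then show ?thesis using has_sum_reindex[OF i, of ?F] by (simp only: o_def)
  qed
  have "?F summable_on range ?j"
    using has_sum_imp_summable[OF hs] by (rule summable_on_subset_banach) (simp add: split)
  then obtain V' where V': "(?F has_sum V') (range ?j)" unfolding summable_on_def by blast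
  then have "((\<lambda>p. ?F (?j p)) has_sum V') UNIV" using has_sum_reindex[OF j, of ?F] by (simp only: o_def)
  then have "((\<lambda>(x, n). f s (of_int x) (real (Suc n))) has_sum V') UNIV"
    by (simp add: case_prod_unfold del: of_nat_Suc)
  then have "V' = defect_sum s + zeta_fun (2 * s - 1) * W s" by (rule upper_half_plane_sum[OF s])
  moreover have "(?F has_sum (of_int a powr (- s) * zeta_fun (2 * s) + V')) half_plane"
    unfolding split by (rule has_sum_Un_disjoint[OF real_axis V' disj])
  ultimately show ?thesis unfolding form_sum_def using has_sum_unique[OF hs] by blast
qed

lemma form_sum_holomorphic: "form_sum holomorphic_on {s. Re s > 1 / 2} - {1}"
proof -
  have "(\<lambda>s. zeta_fun (2 * s)) holomorphic_on {s. Re s > 1 / 2} - {1}"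
  proof -
    have "(\<lambda>s. 2 * s) holomorphic_on {s. Re s > 1 / 2} - {1}" by (intro holomorphic_intros)
    moreover have "(\<lambda>s. 2 * s) ` ({s. Re s > 1 / 2} - {1}) \<subseteq> {s. Re s > 0} - {1}" by (auto simp: complex_eq_iff)
    ultimately show ?thesis using holomorphic_on_compose_gen[OF _ zeta_fun_holomorphic] unfolding o_def by blast
  qed
  moreover have "(\<lambda>s. zeta_fun (2 * s - 1)) holomorphic_on {s. Re s > 1 / 2} - {1}"
  proof -
    have "(\<lambda>s. 2 * s - 1) holomorphic_on {s. Re s > 1 / 2} - {1}" by (intro holomorphic_intros)
    moreover have "(\<lambda>s. 2 * s - 1) ` ({s. Re s > 1 / 2} - {1}) \<subseteq> {s. Re s > 0} - {1}" by (auto simp: complex_eq_iff)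
    ultimately show ?thesis using holomorphic_on_compose_gen[OF _ zeta_fun_holomorphic] unfolding o_def by blast
  qed
  ultimately show ?thesis unfolding form_sum_def using reals
    by (intro holomorphic_intros holomorphic_on_subset[OF W_holomorphic] holomorphic_on_subset[OF defect_sum_holomorphic]) auto
qed

text \<open>Everything but the axis carries a negative power of \<open>c\<close>. The parameter
  \<open>m\<close> lets all forms be bounded by one common lower bound for their coefficients
  \<open>c\<close>.\<close>

lemma form_sum_bound:
  assumes d: "0 < d" "d \<le> 1" and s: "Re s \<ge> 1 / 2 + d" "s \<noteq> 1"
    and m: "1 \<le> m" "m \<le> of_int c"
  shows "norm (form_sum s - zeta_fun (2 * s) * of_int a powr (- s)) \<le>
    1000 * m powr (- (d / 2)) / d ^ 2 * (norm s + 1 / norm (s - 1))"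
proof -
  define k where "k = m powr (- (d / 2))"
  have k0: "k \<ge> 0" by (simp add: k_def)
  have ck: "of_int c powr (- (d / 2)) \<le> k"
    unfolding k_def using m d by (intro powr_mono2') auto
  have "of_int c powr (- (1 / 2)) \<le> of_int c powr (- (d / 2))"
    using reals d by (intro powr_mono) auto
  then have ck': "of_int c powr (- (1 / 2)) \<le> k" using ck by linarith
  have d6: "4 + 2 / d \<le> 6 / d" "1 + 1 / d \<le> 2 / d" "1 + 1 / (2 * d) \<le> 3 / (2 * d)" using d by (auto simp: field_simps)
  define N where "N = norm s"
  have "N \<ge> Re s" unfolding N_def by (rule complex_Re_le_cmod)
  then have N: "N \<ge> 1 / 2" using s d by linarith
  have D: "norm (defect_sum s) \<le> 32 * N * k * ((6 / d) * (2 / d))"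
  proof -
    have "norm (defect_sum s) \<le> 32 * N * of_int c powr (- (1 / 2)) * ((4 + 2 / d) * (1 + 1 / d))"
      unfolding N_def by (rule defect_summable(2)[OF d s(1)])
    also have "\<dots> \<le> 32 * N * k * ((6 / d) * (2 / d))"
      using d N k0 by (intro mult_mono ck' d6) (auto simp: add_nonneg_nonneg)
    finally show ?thesis .
  qed
  have W: "norm (W s) \<le> 16 * k * (6 / d)"
  proof -
    have "norm (W s) \<le> 16 * of_int c powr (- (d / 2)) * (4 + 2 / d)" by (rule W_summable(2)[OF d s(1)])
    also have "\<dots> \<le> 16 * k * (6 / d)"
      using d k0 by (intro mult_mono ck d6) (auto simp: add_nonneg_nonneg)
    finally show ?thesis .
  qed
  have Z: "norm (zeta_fun (2 * s - 1)) \<le> 1 / (2 * norm (s - 1)) + 4 * N * (3 / (2 * d))"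
  proof -
    have "2 * s - 1 - 1 = 2 * (s - 1)" by simp
    then have n1: "norm (2 * s - 1 - 1) = 2 * norm (s - 1)" by (metis norm_mult norm_numeral)
    have n2: "norm (2 * s - 1) \<le> 4 * N"
      using norm_triangle_ineq4[of "2 * s" 1] N by (simp add: norm_mult N_def)
    have r: "Re (2 * s - 1) \<ge> 2 * d" using s by simp
    have "norm (zeta_fun (2 * s - 1)) \<le> 1 / norm (2 * s - 1 - 1) + norm (2 * s - 1) * (1 + 1 / Re (2 * s - 1))"
      using r d s by (intro zeta_fun_bound) auto
    also have "\<dots> \<le> 1 / (2 * norm (s - 1)) + 4 * N * (1 + 1 / (2 * d))"
      unfolding n1 using r d N by (intro add_mono mult_mono n2 order_refl divide_left_mono) (auto intro!: add_nonneg_nonneg mult_pos_pos)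
    also have "\<dots> \<le> 1 / (2 * norm (s - 1)) + 4 * N * (3 / (2 * d))"
      using N by (intro add_left_mono mult_left_mono d6) auto
    finally show ?thesis .
  qed
  have "form_sum s - zeta_fun (2 * s) * of_int a powr (- s) = defect_sum s + zeta_fun (2 * s - 1) * W s"
    by (simp add: form_sum_def)
  also have "norm \<dots> \<le> norm (defect_sum s) + norm (zeta_fun (2 * s - 1)) * norm (W s)"
    using norm_triangle_ineq by (metis norm_mult)
  also have "\<dots> \<le> 32 * N * k * ((6 / d) * (2 / d)) + (1 / (2 * norm (s - 1)) + 4 * N * (3 / (2 * d))) * (16 * k * (6 / d))"
    using d k0 N by (intro add_mono D mult_mono Z W) auto
  \<comment> \<open>Here 960 is 384 from the defects plus 576 from zeta times \<open>W\<close>, and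
    48 comes from the pole of zeta at 1.\<close>
  also have "\<dots> = k / d ^ 2 * (960 * N + d * (48 / norm (s - 1)))"
    using d s by (simp add: field_simps power2_eq_square)
  also have "\<dots> \<le> k / d ^ 2 * (1000 * N + 1 * (1000 / norm (s - 1)))"
    using d k0 N by (intro mult_left_mono add_mono mult_mono divide_right_mono) auto
  also have "\<dots> = 1000 * k / d ^ 2 * (N + 1 / norm (s - 1))" by (simp add: field_simps)
  finally show ?thesis unfolding N_def k_def .
qed

end

section \<open>Summation over the classes\<close>

context odd_real_character
begin

lemma reduced_form_reps:
  assumes "(a, t) \<in> reps" and q: "q \<ge> 64"
  shows "reduced_form a (2 * t + eps) (nf t div a)" and "of_int (nf t div a) \<ge> sqrt q / 2"
proof -
  note r = reps_reduced[OF assms(1)]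
  let ?c = "nf t div a"
  have "a * ?c \<le> ?c * ?c" using r by (intro mult_right_mono) auto
  moreover have "4 * (a * ?c) \<ge> int q" using r(5) by (simp add: mult.assoc)
  ultimately have c2: "4 * (?c * ?c) \<ge> int q" by linarith
  have c0: "?c \<ge> 0" using r by linarith
  have "?c \<ge> 4"
  proof (rule ccontr)
    assume "\<not> ?c \<ge> 4"
    then have "?c * ?c \<le> 3 * 3" using c0 by (intro mult_mono) auto
    then show False using c2 q by linarith
  qed
  then show "reduced_form a (2 * t + eps) ?c" using r by unfold_locales auto
  have "int q \<le> (2 * ?c) ^ 2" using c2 by (simp add: power2_eq_square)
  then have "real_of_int (int q) \<le> of_int ((2 * ?c) ^ 2)" by (simp only: of_int_le_iff)
  then have "real q \<le> (2 * of_int ?c) ^ 2" by simp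
  then have "sqrt q \<le> 2 * of_int ?c" using c0 by (intro real_le_lsqrt) auto
  then show "of_int ?c \<ge> sqrt q / 2" by simp
qed

text \<open>The identity is the enumeration of ideals by class where \<open>Re s > 1\<close>; it
  persists by analytic continuation in the half-plane \<open>Re s > 1/2\<close> without 1, which is
  connected.\<close>

lemma zeta_L_form_sums:
  assumes q: "q \<ge> 64" and s: "Re s > 1 / 2" "s \<noteq> 1"
  shows "zeta_fun s * L_fun s = (\<Sum>p\<in>reps. reduced_form.form_sum (fst p) (2 * snd p + eps) (nf (snd p) div fst p) s)"
    (is "_ = ?R s")
proof -
  define S where "S = {s. Re s > 1 / 2} - {1::complex}"
  have oS: "open S" unfolding S_def by (intro open_Diff open_halfspace_Re_gt) auto
  have cS: "connected S"
    unfolding S_def by (intro connected_open_delete open_halfspace_Re_gt convex_connected convex_halfspace_Re_gt) auto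
  show ?thesis
  proof (rule analytic_continuation_open[of "{s. Re s > 1}" S "\<lambda>s. zeta_fun s * L_fun s" ?R])
    show "open {s. Re s > 1}" by (rule open_halfspace_Re_gt)
    show "open S" "connected S" by fact+
    have "2 \<in> {s::complex. Re s > 1}" by simp
    then show "{s::complex. Re s > 1} \<noteq> {}" by blast
    show "{s. Re s > 1} \<subseteq> S" by (auto simp: S_def)
    show "s \<in> S" using s by (simp add: S_def)
    show "(\<lambda>s. zeta_fun s * L_fun s) holomorphic_on S"
      by (intro holomorphic_on_mult holomorphic_on_subset[OF zeta_fun_holomorphic] holomorphic_on_subset[OF L_fun_holomorphic])
        (auto simp: S_def)
    show "?R holomorphic_on S" unfolding S_def
      using reduced_form.form_sum_holomorphic[OF reduced_form_reps(1)[OF _ q]] by (intro holomorphic_on_sum) auto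
    fix z :: complex assume "z \<in> {s. Re s > 1}"
    then have z: "Re z > 1" by simp
    have q4: "q > 4" using q by simp
    let ?g = "\<lambda>p v. of_int (qform (fst p) (snd p) v) powr (- z) :: complex"
    have hs: "((\<lambda>(p, v). ?g p v) has_sum zeta_fun z * L_fun z) (reps \<times> half_plane)"
      using zeta_L_class_sum(1)[OF z q4] by (simp add: case_prod_unfold)
    have row: "(?g p has_sum reduced_form.form_sum (fst p) (2 * snd p + eps) (nf (snd p) div fst p) z) half_plane"
      if p: "p \<in> reps" for p
    proof -
      obtain a t where at: "p = (a, t)" by (cases p)
      interpret rf: reduced_form a "2 * t + eps" "nf t div a"
        by (rule reduced_form_reps(1)) (use p q at in auto)
      have "?g p summable_on half_plane"
        using summable_on_SigmaD1[OF has_sum_imp_summable[OF hs] p] by simp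
      then obtain V where V: "(?g p has_sum V) half_plane" unfolding summable_on_def by blast
      have "?g p v = rf.f z (of_int (fst v)) (of_int (snd v))" for v
        by (simp add: rf.f_def rf.u_def qform_def at)
      then have "((\<lambda>v. rf.f z (of_int (fst v)) (of_int (snd v))) has_sum V) half_plane" using V by (simp only:)
      from rf.half_plane_sum[OF z this] show ?thesis using V by (simp add: at)
    qed
    have "((\<lambda>p. reduced_form.form_sum (fst p) (2 * snd p + eps) (nf (snd p) div fst p) z) has_sum zeta_fun z * L_fun z) reps"
      by (rule has_sum_SigmaD[OF hs]) (use row in auto)
    then show "zeta_fun z * L_fun z = ?R z"
      using has_sum_finite[OF finite_reps] has_sum_unique by blast
  qed
qed

definition class_sum :: "complex \<Rightarrow> complex" where
  "class_sum s = (\<Sum>p\<in>reps. of_int (fst p) powr (- s))"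

lemma zeta_L_approx:
  assumes q: "q \<ge> 64" and d: "0 < d" "d \<le> 1" and s: "Re s \<ge> 1 / 2 + d" "s \<noteq> 1"
  shows "norm (zeta_fun s * L_fun s - zeta_fun (2 * s) * class_sum s) \<le>
    card reps * (1000 * (sqrt q / 2) powr (- (d / 2)) / d ^ 2 * (norm s + 1 / norm (s - 1)))"
proof -
  have "zeta_fun s * L_fun s - zeta_fun (2 * s) * class_sum s =
      (\<Sum>p\<in>reps. reduced_form.form_sum (fst p) (2 * snd p + eps) (nf (snd p) div fst p) s - zeta_fun (2 * s) * of_int (fst p) powr (- s))"
    using d s by (subst zeta_L_form_sums[OF q]) (simp_all add: class_sum_def sum_subtractf sum_distrib_left)
  also have "norm \<dots> \<le> of_nat (card reps) * (1000 * (sqrt q / 2) powr (- (d / 2)) / d ^ 2 * (norm s + 1 / norm (s - 1)))"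
  proof (rule sum_norm_bound)
    fix p assume p: "p \<in> reps"
    obtain a t where at: "p = (a, t)" by (cases p)
    have "sqrt 64 \<le> sqrt q" using q by (intro real_sqrt_le_mono) simp
    moreover have "sqrt (64::real) = 8" by (rule real_sqrt_unique) auto
    ultimately have "sqrt q / 2 \<ge> 1" by simp
    then show "norm (reduced_form.form_sum (fst p) (2 * snd p + eps) (nf (snd p) div fst p) s - zeta_fun (2 * s) * of_int (fst p) powr (- s)) \<le>
        1000 * (sqrt q / 2) powr (- (d / 2)) / d ^ 2 * (norm s + 1 / norm (s - 1))"
      using reduced_form.form_sum_bound[OF reduced_form_reps(1)[of a t] d s, of "sqrt q / 2"]
        reduced_form_reps(2)[of a t] p q by (simp add: at)
  qed
  finally show ?thesis .
qed

end

section \<open>A lower bound for the zeta function\<close>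

lemma prime_factors_prod_primes:
  fixes A :: "nat set"
  assumes "finite A" "\<forall>p\<in>A. prime p"
  shows "prime_factors (\<Prod>A) = A"
proof -
  have "0 \<notin> (\<lambda>x. x) ` A" using assms by auto
  then have "prime_factors (\<Prod>A) = (\<Union>p\<in>A. prime_factors p)"
    using prime_factors_prod[OF assms(1), of "\<lambda>x. x"] by simp
  also have "\<dots> = (\<Union>p\<in>A. {p})" using assms by (intro SUP_cong refl) (auto simp: prime_prime_factors)
  finally show ?thesis by simp
qed

lemma powr_of_nat_mult:
  "of_nat (m * n) powr (z::complex) = of_nat m powr z * of_nat n powr z"
  using powr_times_real[of "of_nat m" "of_nat n" z] by simp

lemma powr_of_nat_prod:
  fixes A :: "nat set"
  assumes "finite A"
  shows "of_nat (\<Prod>A) powr (z::complex) = (\<Prod>p\<in>A. of_nat p powr z)"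
  using assms by induction (simp_all add: powr_of_nat_mult del: of_nat_mult of_nat_prod)

text \<open>The sieve of Eratosthenes: the multiples of a further prime \<open>p\<close> in the
  current set form the set scaled by \<open>p\<close>, so removing them multiplies the sum by one
  more factor.\<close>

lemma sieve:
  assumes w: "Re w > 1" and S: "finite S" "\<forall>p\<in>S. prime (p::nat)"
  shows "((\<lambda>n. of_nat n powr (- w)) has_sum (zeta_fun w * (\<Prod>p\<in>S. 1 - of_nat p powr (- w))))
    {n. n > 0 \<and> (\<forall>p\<in>S. \<not> p dvd n)}"
  using S
proof (induction S)
  case empty
  have "inj_on Suc UNIV" by simp
  from has_sum_reindex[OF this, of "\<lambda>n. of_nat n powr (- w)" "zeta_fun w"] zeta_fun_has_sum[OF w]
  have "((\<lambda>n. of_nat n powr (- w)) has_sum zeta_fun w) (range Suc)" by (simp add: o_def del: of_nat_Suc)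
  moreover have "range Suc = {n. n > 0}" using gr0_conv_Suc by auto
  ultimately show ?case by simp
next
  case (insert p S)
  let ?A = "{n. n > 0 \<and> (\<forall>p\<in>S. \<not> p dvd n)}" and ?z = "zeta_fun w * (\<Prod>p\<in>S. 1 - of_nat p powr (- w))"
  have p: "prime p" and S: "\<forall>r\<in>S. prime r" using insert by auto
  have A: "((\<lambda>n. of_nat n powr (- w)) has_sum ?z) ?A" using insert by simp
  have inj: "inj_on ((*) p) ?A" using p by (intro inj_onI) (simp add: prime_gt_0_nat)
  have "((\<lambda>n. of_nat p powr (- w) * of_nat n powr (- w)) has_sum (of_nat p powr (- w) * ?z)) ?A"
    by (rule has_sum_cmult_right[OF A])
  then have B: "((\<lambda>n. of_nat n powr (- w)) has_sum (of_nat p powr (- w) * ?z)) ((*) p ` ?A)"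
    using has_sum_reindex[OF inj, of "\<lambda>n. of_nat n powr (- w)"] by (simp add: o_def powr_of_nat_mult del: of_nat_mult)
  have img: "(*) p ` ?A = {n \<in> ?A. p dvd n}"
  proof (intro equalityI subsetI)
    fix n assume "n \<in> (*) p ` ?A"
    then obtain m where m: "m \<in> ?A" "n = p * m" by blast
    have "\<not> r dvd p * m" if r: "r \<in> S" for r
    proof
      assume "r dvd p * m"
      then have "r dvd p \<or> r dvd m" using S r by (simp add: prime_dvd_mult_iff)
      then have "r = p" using S r m p by (auto simp: primes_dvd_imp_eq)
      then show False using r insert by simp
    qed
    then show "n \<in> {n \<in> ?A. p dvd n}" using m p by (auto simp: prime_gt_0_nat)
  next
    fix n assume "n \<in> {n \<in> ?A. p dvd n}"
    then obtain m where "n = p * m" "n \<in> ?A" by (auto elim: dvdE)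
    moreover from this have "m \<in> ?A" by (auto dest: dvd_mult)
    ultimately show "n \<in> (*) p ` ?A" by blast
  qed
  have "((\<lambda>n. of_nat n powr (- w)) has_sum (?z - of_nat p powr (- w) * ?z)) (?A - (*) p ` ?A)"
    using img by (intro has_sum_Diff[OF A B]) auto
  moreover have "?A - (*) p ` ?A = {n. n > 0 \<and> (\<forall>p\<in>insert p S. \<not> p dvd n)}" unfolding img by auto
  moreover have "?z - of_nat p powr (- w) * ?z = zeta_fun w * (\<Prod>p\<in>insert p S. 1 - of_nat p powr (- w))"
    using insert by (simp add: algebra_simps)
  ultimately show ?case by simp
qed

lemma powr_has_sum_pos:
  assumes "(d::real) > 0"
  shows "(\<lambda>n. real n powr (- 1 - d)) summable_on {n. n > 0}"
    and "(\<Sum>\<^sub>\<infinity>n\<in>{n. n > 0}. real n powr (- 1 - d)) \<le> 1 + 1 / d"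
proof -
  have r: "range Suc = {n. n > 0}" using gr0_conv_Suc by auto
  have i: "inj_on Suc UNIV" by simp
  show "(\<lambda>n. real n powr (- 1 - d)) summable_on {n. n > 0}"
    using summable_on_reindex[OF i, of "\<lambda>n. real n powr (- 1 - d)"] sum_powr_has_sum(1)[OF assms]
    by (simp add: o_def r del: of_nat_Suc)
  show "(\<Sum>\<^sub>\<infinity>n\<in>{n. n > 0}. real n powr (- 1 - d)) \<le> 1 + 1 / d"
    using infsum_reindex[OF i, of "\<lambda>n. real n powr (- 1 - d)"] sum_powr_has_sum(2)[OF assms]
    by (simp add: o_def r del: of_nat_Suc)
qed

text \<open>Expanded, the product is a sum over distinct squarefree integers, hence part of the full
  series.\<close>

lemma prod_primes_le:
  assumes d: "(d::real) > 0" and S: "finite S" "\<forall>p\<in>S. prime (p::nat)"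
  shows "(\<Prod>p\<in>S. 1 + real p powr (- 1 - d)) \<le> 1 + 1 / d"
proof -
  have inj: "inj_on (\<lambda>A. \<Prod>A) (Pow S)"
    using S by (intro inj_on_inverseI[of _ prime_factors] prime_factors_prod_primes) (auto intro: finite_subset)
  have "(\<Prod>p\<in>S. 1 + real p powr (- 1 - d)) = (\<Prod>p\<in>S. real p powr (- 1 - d) + 1)" by (simp add: add.commute)
  also have "\<dots> = (\<Sum>A\<in>Pow S. \<Prod>p\<in>A. real p powr (- 1 - d))" by (subst prod_add[OF S(1)]) simp
  also have "\<dots> = (\<Sum>A\<in>Pow S. real (\<Prod>A) powr (- 1 - d))" by (simp add: prod_powr_distrib)
  also have "\<dots> = (\<Sum>n\<in>(\<lambda>A. \<Prod>A) ` Pow S. real n powr (- 1 - d))" by (simp add: sum.reindex[OF inj] o_def)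
  also have "\<dots> \<le> (\<Sum>\<^sub>\<infinity>n\<in>{n. n > 0}. real n powr (- 1 - d))"
  proof (rule finite_sum_le_infsum[OF powr_has_sum_pos(1)[OF d]])
    have "\<Prod>A > 0" if "A \<subseteq> S" for A using S that by (intro prod_pos) (auto intro: prime_gt_0_nat)
    then show "(\<lambda>A. \<Prod>A) ` Pow S \<subseteq> {n. n > 0}" by blast
  qed (use S in auto)
  also have "\<dots> \<le> 1 + 1 / d" by (rule powr_has_sum_pos(2)[OF d])
  finally show ?thesis .
qed

text \<open>Sieving by all primes up to \<open>N\<close> leaves only the term \<open>1\<close> and terms with \<open>n > N\<close>.\<close>

lemma zeta_fun_lower_bound:
  assumes w: "Re w > 1"
  shows "norm (zeta_fun w) * (1 + 1 / (Re w - 1)) \<ge> 1"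
proof -
  \<comment> \<open>One half of the excess over 1 gives decay in \<open>N\<close>, the other half
    keeps the tail summable.\<close>
  define e where "e = (Re w - 1) / 2"
  have e: "e > 0" "Re w = 1 + 2 * e" using w by (auto simp: e_def field_simps)
  have bound: "1 - real N powr (- e) * (1 + 1 / e) \<le> norm (zeta_fun w) * (1 + 1 / (Re w - 1))" if N: "N > 0" for N :: nat
  proof -
    define S where "S = {p. prime p \<and> p \<le> N}"
    have S: "finite S" "\<forall>p\<in>S. prime p" by (auto simp: S_def)
    define A where "A = {n. n > 0 \<and> (\<forall>p\<in>S. \<not> p dvd n)}"
    define Z where "Z = zeta_fun w * (\<Prod>p\<in>S. 1 - of_nat p powr (- w))"
    have A: "((\<lambda>n. of_nat n powr (- w)) has_sum Z) A" unfolding A_def Z_def by (rule sieve[OF w S])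
    have "1 \<in> A" by (auto simp: A_def S_def)
    moreover have "((\<lambda>n. of_nat n powr (- w)) has_sum (1::complex)) {1::nat}" by (rule has_sum_finiteI) auto
    ultimately have A': "((\<lambda>n. of_nat n powr (- w)) has_sum (Z - 1)) (A - {1})" by (intro has_sum_Diff[OF A]) auto
    have le: "norm (of_nat n powr (- w)) \<le> real N powr (- e) * real n powr (- 1 - e)" if n: "n \<in> A - {1}" for n
    proof -
      have "n \<noteq> 1" "n > 0" using n by (auto simp: A_def)
      then obtain p where p: "prime p" "p dvd n" using prime_factor_nat by blast
      then have "p > N" using n by (auto simp: A_def S_def)
      then have nN: "n > N" using dvd_imp_le[OF p(2)] \<open>n > 0\<close> by simp
      have "norm (of_nat n powr (- w)) = real n powr (- e) * real n powr (- 1 - e)"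
        unfolding norm_of_nat_powr powr_add[symmetric] using e by (simp add: algebra_simps)
      also have "\<dots> \<le> real N powr (- e) * real n powr (- 1 - e)"
        using nN N e by (intro mult_right_mono powr_mono2') auto
      finally show ?thesis .
    qed
    have sm: "(\<lambda>n. real N powr (- e) * real n powr (- 1 - e)) summable_on {n. n > 0}"
      by (intro summable_on_cmult_right powr_has_sum_pos e)
    have sm': "(\<lambda>n. real N powr (- e) * real n powr (- 1 - e)) summable_on (A - {1})"
      using sm by (rule summable_on_subset_banach) (auto simp: A_def)
    have nsm: "(\<lambda>n. norm (of_nat n powr (- w))) summable_on (A - {1})"
      by (rule Infinite_Sum.abs_summable_on_comparison_test'[OF sm' le])
    have "norm (Z - 1) = norm (\<Sum>\<^sub>\<infinity>n\<in>A - {1}. of_nat n powr (- w))" using infsumI[OF A'] by simp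
    also have "\<dots> \<le> (\<Sum>\<^sub>\<infinity>n\<in>A - {1}. norm (of_nat n powr (- w)))" by (rule norm_infsum_bound[OF nsm])
    also have "\<dots> \<le> (\<Sum>\<^sub>\<infinity>n\<in>{n. n > 0}. real N powr (- e) * real n powr (- 1 - e))"
      by (rule infsum_mono_neutral[OF nsm sm]) (use le in \<open>auto simp: A_def\<close>)
    also have "\<dots> = real N powr (- e) * (\<Sum>\<^sub>\<infinity>n\<in>{n. n > 0}. real n powr (- 1 - e))" by (rule infsum_cmult_right')
    also have "\<dots> \<le> real N powr (- e) * (1 + 1 / e)" by (intro mult_left_mono powr_has_sum_pos e) simp
    finally have "norm (Z - 1) \<le> real N powr (- e) * (1 + 1 / e)" .
    moreover have "1 - norm (Z - 1) \<le> norm Z" using norm_triangle_ineq2[of 1 "1 - Z"] by (simp add: norm_minus_commute)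
    \<comment> \<open>Each sieving factor is at most one plus the norm of the power, so the product
      of all factors stays bounded independently of \<open>N\<close>. This turns \<open>Z\<close>
      close to 1 into a lower bound for zeta.\<close>
    moreover have "norm Z \<le> norm (zeta_fun w) * (1 + 1 / (Re w - 1))"
    proof -
      have "norm (\<Prod>p\<in>S. 1 - of_nat p powr (- w)) = (\<Prod>p\<in>S. norm (1 - of_nat p powr (- w)))" by (simp add: prod_norm)
      also have "\<dots> \<le> (\<Prod>p\<in>S. 1 + real p powr (- 1 - (Re w - 1)))"
      proof (intro prod_mono conjI norm_ge_zero)
        fix p
        show "norm (1 - of_nat p powr (- w)) \<le> 1 + real p powr (- 1 - (Re w - 1))"
          using norm_triangle_ineq4[of 1 "of_nat p powr (- w)"] norm_of_nat_powr[of p "- w"] by simp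
      qed
      also have "\<dots> \<le> 1 + 1 / (Re w - 1)" using w by (intro prod_primes_le S) auto
      finally show ?thesis unfolding Z_def norm_mult by (intro mult_left_mono) auto
    qed
    ultimately show ?thesis by linarith
  qed
  have "(\<lambda>N. 1 - real N powr (- e) * (1 + 1 / e)) \<longlonglongrightarrow> 1 - 0 * (1 + 1 / e)"
    using e by (intro tendsto_intros tendsto_neg_powr filterlim_real_sequentially) auto
  moreover have "\<forall>\<^sub>F N in sequentially. 1 - real N powr (- e) * (1 + 1 / e) \<le> norm (zeta_fun w) * (1 + 1 / (Re w - 1))"
    using eventually_gt_at_top[of 0] by eventually_elim (rule bound)
  ultimately show ?thesis using tendsto_upperbound[OF _ _ sequentially_bot] by fastforce
qed

section \<open>The class sum and the Euler product over ramified primes\<close>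

context odd_real_character
begin

section \<open>Ideals composed of ramified primes\<close>

lemma small_ideals_iff_roots:
  "(a, t) \<in> small_ideals \<longleftrightarrow> a > 0 \<and> t \<in> roots (nat a) \<and> 4 * a ^ 2 < int q"
  by (auto simp: small_ideals_def roots_def)

lemma X_ramified: "prime p \<Longrightarrow> p dvd q \<Longrightarrow> X (int p) = 0"
  by (metis X_eq_0_iff coprime_absorb_left coprime_int_iff not_prime_unit)

lemma rho_prod_ramified:
  assumes "finite A" "\<forall>p\<in>A. prime p \<and> p dvd q"
  shows "rho (\<Prod>A) = 1"
  using assms
proof (induction A)
  case (insert p A)
  have p: "prime p" "p dvd q" and A: "\<forall>p\<in>A. prime p" using insert by auto
  have "coprime p (\<Prod>A)"
    using insert p A by (intro prod_coprime_right) (metis primes_coprime)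
  moreover have "\<Prod>A > 0" using A by (intro prod_pos) (auto intro: prime_gt_0_nat)
  moreover have "rho p = 1" using rho_prime[OF p(1)] X_ramified[OF p] by simp
  ultimately show ?case using insert p by (simp add: rho_mult prime_gt_0_nat)
qed simp

definition ramified_ideals :: "(int \<times> int) set" where
  "ramified_ideals = {p \<in> small_ideals. prime_factors (nat (fst p)) \<subseteq> prime_factors q}"

text \<open>The norm is squarefree, since the square of a ramified prime has no root of
  \<open>nf\<close>.\<close>

lemma ramified_eq_prod:
  assumes "(a, t) \<in> ramified_ideals"
  shows "nat a = \<Prod>(prime_factors (nat a))"
proof -
  have at: "a > 0" "t \<in> roots (nat a)" and pf: "prime_factors (nat a) \<subseteq> prime_factors q"
    using assms by (auto simp: ramified_ideals_def small_ideals_iff_roots)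
  have "multiplicity p (nat a) = 1" if p: "p \<in> prime_factors (nat a)" for p
  proof (rule ccontr)
    assume "multiplicity p (nat a) \<noteq> 1"
    moreover have "multiplicity p (nat a) > 0" using p by (simp add: prime_factors_multiplicity)
    ultimately have "p ^ 2 dvd nat a" by (intro multiplicity_dvd') simp
    then have "int (p ^ 2) dvd int (nat a)" by (simp only: of_nat_dvd_iff)
    also have "int (nat a) dvd nf t" using at by (simp add: roots_def)
    finally have "int (p ^ 2) dvd nf t" .
    moreover have pp: "prime p" "p dvd q" using p pf by auto
    moreover have "p ^ 2 > 0" using pp by (simp add: prime_gt_0_nat)
    ultimately have "t mod int (p ^ 2) \<in> roots (p ^ 2)" by (intro mod_mem_roots)
    moreover have "card (roots (p ^ 2)) = 0" using rho_ramified[OF pp, of 2] by (simp add: rho_def)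
    ultimately show False by simp
  qed
  then have "(\<Prod>p\<in>prime_factors (nat a). p ^ multiplicity p (nat a)) = \<Prod>(prime_factors (nat a))"
    by (intro prod.cong) auto
  then show ?thesis using prime_factorization_nat[of "nat a"] at by simp
qed

definition small_products :: "nat set set" where
  "small_products = {A. A \<subseteq> prime_factors q \<and> 4 * (\<Prod>A) ^ 2 < q}"

lemma finite_small_products: "finite small_products"
  by (rule finite_subset[of _ "Pow (prime_factors q)"]) (auto simp: small_products_def)

text \<open>A product of distinct ramified primes has exactly one root, so it is the norm of exactly
  one primitive ideal; the set of primes can be read off from the norm.\<close>

lemma bij_ramified: "bij_betw (\<lambda>p. prime_factors (nat (fst p))) ramified_ideals small_products"
  unfolding bij_betw_def
proof (intro conjI inj_onI equalityI subsetI)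
  fix p p' assume p: "p \<in> ramified_ideals" "p' \<in> ramified_ideals"
    and eq: "prime_factors (nat (fst p)) = prime_factors (nat (fst p'))"
  obtain a t a' t' where at: "p = (a, t)" "p' = (a', t')" by (cases p, cases p')
  have "nat a = nat a'" using ramified_eq_prod[of a t] ramified_eq_prod[of a' t'] p eq by (simp add: at)
  moreover have r: "a > 0" "a' > 0" "t \<in> roots (nat a)" "t' \<in> roots (nat a')"
    using p by (auto simp: ramified_ideals_def small_ideals_iff_roots at)
  ultimately have a: "a = a'" by simp
  have "finite (prime_factors (nat a))" by simp
  then have "rho (nat a) = 1" using ramified_eq_prod[of a t] p(1) rho_prod_ramified[of "prime_factors (nat a)"]
    by (auto simp: at ramified_ideals_def)
  then have "t = t'" using r(3,4) unfolding a rho_def by (metis card_1_singletonE singletonD)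
  then show "p = p'" by (simp add: at a)
next
  fix A assume "A \<in> (\<lambda>p. prime_factors (nat (fst p))) ` ramified_ideals"
  then obtain a t where at: "(a, t) \<in> ramified_ideals" "A = prime_factors (nat a)" by force
  have "4 * a ^ 2 < int q" "a > 0" using at by (auto simp: ramified_ideals_def small_ideals_iff_roots)
  then have "int (4 * nat a ^ 2) < int q" by simp
  then have "4 * (\<Prod>A) ^ 2 < q" using ramified_eq_prod[OF at(1)] at(2) by (simp only: of_nat_less_iff)
  then show "A \<in> small_products" using at by (auto simp: small_products_def ramified_ideals_def)
next
  fix A assume A: "A \<in> small_products"
  then have fA: "finite A" and pA: "\<forall>p\<in>A. prime p \<and> p dvd q"
    by (auto simp: small_products_def intro: finite_subset)
  have "rho (\<Prod>A) = 1" by (rule rho_prod_ramified[OF fA pA])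
  then obtain t where t: "t \<in> roots (\<Prod>A)" unfolding rho_def by (metis card_1_singletonE singletonI)
  have pf: "prime_factors (\<Prod>A) = A" using prime_factors_prod_primes[OF fA] pA by blast
  have pos: "\<Prod>A > 0" using pA by (intro prod_pos) (auto intro: prime_gt_0_nat)
  have "4 * (\<Prod>A) ^ 2 < q" using A by (simp add: small_products_def)
  then have "int (4 * (\<Prod>A) ^ 2) < int q" by (simp only: of_nat_less_iff)
  then have "4 * int (\<Prod>A) ^ 2 < int q" by (simp del: of_nat_prod)
  then have "(int (\<Prod>A), t) \<in> ramified_ideals"
    using t pos A by (simp add: ramified_ideals_def small_ideals_iff_roots pf small_products_def del: of_nat_prod)
  then show "A \<in> (\<lambda>p. prime_factors (nat (fst p))) ` ramified_ideals"
    using pf by (intro image_eqI[where x = "(int (\<Prod>A), t)"]) (simp_all del: of_nat_prod)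
qed

section \<open>Consequences of a small class number\<close>

lemma class_number_pos:
  assumes "q > 4" shows "class_number K \<ge> 1"
proof -
  have "(1, 0) \<in> small_ideals" using assms by (simp add: small_ideals_def)
  then have "card small_ideals \<noteq> 0" using finite_small_ideals by auto
  then show ?thesis using card_small_ideals by linarith
qed

lemma card_small_products: "card small_products \<le> class_number K"
proof -
  have "card small_products = card ramified_ideals" using bij_betw_same_card[OF bij_ramified] by simp
  also have "\<dots> \<le> card small_ideals" by (intro card_mono finite_small_ideals) (auto simp: ramified_ideals_def)
  also have "\<dots> \<le> class_number K" by (rule card_small_ideals)
  finally show ?thesis .
qed

text \<open>Two primes are set aside so that a subset of the remaining ones or its complement has a
  product below half the square root of \<open>q\<close>.\<close>

lemma two_power_omega_le:
  assumes q: "q > 4"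
  shows "2 ^ card (prime_factors q) \<le> 8 * class_number K"
proof (cases "card (prime_factors q) \<le> 3")
  case True
  then have "2 ^ card (prime_factors q) \<le> (2::nat) ^ 3" by (intro power_increasing) auto
  then show ?thesis using class_number_pos[OF q] by simp
next
  case False
  have "prime_factors q \<noteq> {}" using False by auto
  then obtain p1 where p1: "p1 \<in> prime_factors q" by blast
  have "card (prime_factors q - {p1}) \<noteq> 0" using False p1 by (subst card_Diff_singleton) auto
  then have "prime_factors q - {p1} \<noteq> {}" by (metis card.empty)
  then obtain p2 where p2: "p2 \<in> prime_factors q" "p2 \<noteq> p1" by blast
  define T where "T = prime_factors q - {p1, p2}"
  have fT: "finite T" by (simp add: T_def)
  have pf: "prime_factors q = insert p1 (insert p2 T)" using p1 p2 by (auto simp: T_def)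
  have cT: "card (prime_factors q) = card T + 2"
    unfolding pf using p2 fT by (simp add: T_def)
  have pr: "prime p1" "prime p2" "\<forall>p\<in>T. prime p" using p1 p2 by (auto simp: T_def)
  have "p1 \<ge> 2" "p2 \<ge> 2" using pr prime_ge_2_nat by blast+
  then have "p1 * p2 > 4"
  proof (cases "p1 = 2")
    case True
    then show ?thesis using p2 \<open>p2 \<ge> 2\<close> by simp
  next
    case False
    then have "3 * 2 \<le> p1 * p2" using \<open>p1 \<ge> 2\<close> \<open>p2 \<ge> 2\<close> by (intro mult_le_mono) auto
    then show ?thesis by simp
  qed
  have "\<Prod>(prime_factors q) dvd q"
  proof -
    have "(\<Prod>p\<in>prime_factors q. p) dvd (\<Prod>p\<in>prime_factors q. p ^ multiplicity p q)"
      by (rule prod_dvd_prod) (auto simp: prime_factors_multiplicity intro: dvd_power)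
    then show ?thesis using prime_factorization_nat[of q] q by simp
  qed
  then have "\<Prod>(prime_factors q) \<le> q" using q by (intro dvd_imp_le) auto
  moreover have "\<Prod>(prime_factors q) = p1 * p2 * \<Prod>T"
    unfolding pf using p2 fT by (simp add: T_def mult.assoc)
  ultimately have pT: "p1 * p2 * \<Prod>T \<le> q" by simp
  have "Pow T \<subseteq> small_products \<union> (\<lambda>A. T - A) ` small_products"
  proof
    fix A assume "A \<in> Pow T"
    then have A: "A \<subseteq> T" by simp
    have split: "\<Prod>T = \<Prod>A * \<Prod>(T - A)" using prod.subset_diff[OF A fT, of "\<lambda>x. x"] by (simp add: mult.commute)
    have pos: "\<Prod>B > 0" if "B \<subseteq> T" for B using pr that by (intro prod_pos) (auto intro: prime_gt_0_nat)
    \<comment> \<open>The square of the smaller of two complementary products is at most the product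
      over \<open>T\<close>, and \<open>p1 * p2 > 4\<close> absorbs the factor 4. Hence
      \<open>Pow T\<close> is covered by two copies of \<open>small_products\<close>.\<close>
    have key: "4 * \<Prod>B ^ 2 < q" if B: "B \<subseteq> T" "C \<subseteq> T" "\<Prod>T = \<Prod>B * \<Prod>C" "\<Prod>B \<le> \<Prod>C" for B C
    proof -
      have "4 * \<Prod>B ^ 2 \<le> 4 * (\<Prod>B * \<Prod>C)" using B by (simp add: power2_eq_square)
      also have "\<dots> < p1 * p2 * (\<Prod>B * \<Prod>C)" using \<open>p1 * p2 > 4\<close> pos B by (intro mult_strict_right_mono) auto
      finally show ?thesis using pT B by simp
    qed
    have TP: "T \<subseteq> prime_factors q" by (auto simp: T_def)
    show "A \<in> small_products \<union> (\<lambda>A. T - A) ` small_products"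
    proof (cases "\<Prod>A \<le> \<Prod>(T - A)")
      case True
      then have "A \<in> small_products" using key[OF A _ split] A TP by (auto simp: small_products_def)
      then show ?thesis by blast
    next
      case False
      then have "T - A \<in> small_products"
        using key[of "T - A" A] A TP split by (auto simp: small_products_def mult.commute)
      moreover have "A = T - (T - A)" using A by blast
      ultimately show ?thesis by blast
    qed
  qed
  then have "card (Pow T) \<le> card (small_products \<union> (\<lambda>A. T - A) ` small_products)"
    by (intro card_mono) (auto simp: finite_small_products)
  also have "\<dots> \<le> card small_products + card ((\<lambda>A. T - A) ` small_products)" by (rule card_Un_le)
  also have "\<dots> \<le> class_number K + class_number K"
    using card_image_le[OF finite_small_products, of "\<lambda>A. T - A"] card_small_products by (intro add_mono) auto
  finally have "2 ^ card T \<le> 2 * class_number K" by (simp add: card_Pow[OF fT])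
  then show ?thesis by (simp add: cT)
qed

text \<open>An unramified prime dividing the norm of a primitive ideal has a root, so it splits, and
  then all its powers have roots too. If it were small, its powers would give too many small
  ideals.\<close>

lemma unramified_prime_large:
  assumes "(a, t) \<in> small_ideals" "(a, t) \<notin> ramified_ideals"
  obtains p where "prime p" "int p \<le> a" "q \<le> 4 * p ^ (2 * class_number K)"
proof -
  have at: "a > 0" "t \<in> roots (nat a)" using assms by (auto simp: small_ideals_iff_roots)
  obtain p where p: "p \<in> prime_factors (nat a)" "p \<notin> prime_factors q"
    using assms by (auto simp: ramified_ideals_def)
  have pp: "prime p" "p dvd nat a" using p by auto
  have nq: "\<not> p dvd q" using p pp q_pos by (auto simp: prime_factors_dvd)
  have "X (int p) \<noteq> 0"
    using X_eq_0_iff[of "int p"] prime_imp_coprime[OF pp(1) nq] by simp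
  moreover have "X (int p) \<noteq> - 1"
  proof
    assume "X (int p) = - 1"
    then have "card (roots p) = 0" using rho_prime[OF pp(1)] by (simp add: rho_def)
    then have e: "roots p = {}" by simp
    have "int p dvd int (nat a)" using pp by (simp only: of_nat_dvd_iff)
    also have "int (nat a) dvd nf t" using at by (simp add: roots_def)
    finally have "t mod int p \<in> roots p" using pp by (intro mod_mem_roots) (simp_all add: prime_gt_0_nat)
    then show False using e by simp
  qed
  ultimately have X1: "X (int p) = 1"
    using X_cases[of "int p"] prime_imp_coprime[OF pp(1) nq] by auto
  have "rho (p ^ k) \<noteq> 0" for k
  proof (cases k)
    case (Suc j)
    have "int (rho (p ^ k)) = 2" unfolding Suc rho_prime_power[OF pp(1)] by (simp add: X1)
    then show ?thesis by simp
  qed simp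
  then have "\<exists>t. t \<in> roots (p ^ k)" for k unfolding rho_def by (metis card.empty equals0I)
  then obtain r where r: "\<And>k. r k \<in> roots (p ^ k)" by metis
  have "q \<le> 4 * p ^ (2 * class_number K)"
  proof (rule ccontr)
    assume "\<not> q \<le> 4 * p ^ (2 * class_number K)"
    then have lt: "4 * p ^ (2 * class_number K) < q" by simp
    \<comment> \<open>The exponents from 0 to the class number give one more ideal than there are
      classes.\<close>
    have sub: "(\<lambda>k. (int (p ^ k), r k)) ` {..class_number K} \<subseteq> small_ideals"
    proof
      fix v assume "v \<in> (\<lambda>k. (int (p ^ k), r k)) ` {..class_number K}"
      then obtain k where k: "v = (int (p ^ k), r k)" "k \<le> class_number K" by auto
      have "p ^ (2 * k) \<le> p ^ (2 * class_number K)" using k prime_ge_1_nat[OF pp(1)] by (intro power_increasing) auto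
      then have "4 * (p ^ k) ^ 2 < q" using lt by (simp add: power_mult[symmetric] mult.commute)
      then have "int (4 * (p ^ k) ^ 2) < int q" by (simp only: of_nat_less_iff)
      then have "4 * int (p ^ k) ^ 2 < int q" by simp
      then show "v \<in> small_ideals" using r[of k] pp by (simp add: k small_ideals_iff_roots prime_gt_0_nat nat_power_eq)
    qed
    have inj: "inj_on (\<lambda>k. (int (p ^ k), r k)) {..class_number K}"
      using prime_gt_1_nat[OF pp(1)] by (intro inj_onI) simp
    have "Suc (class_number K) = card ((\<lambda>k. (int (p ^ k), r k)) ` {..class_number K})" using card_image[OF inj] by simp
    also have "\<dots> \<le> card small_ideals" by (intro card_mono finite_small_ideals sub)
    also have "\<dots> \<le> class_number K" by (rule card_small_ideals)
    finally show False by simp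
  qed
  moreover have "int p \<le> a" using dvd_imp_le[OF pp(2)] at by simp
  ultimately show ?thesis using that pp by blast
qed

definition euler_factor :: "complex \<Rightarrow> complex" where
  "euler_factor s = (\<Prod>p\<in>prime_factors q. 1 + of_nat p powr (- s))"

lemma euler_factor_eq_sum: "euler_factor s = (\<Sum>A\<in>Pow (prime_factors q). of_nat (\<Prod>A) powr (- s))"
proof -
  have "euler_factor s = (\<Prod>p\<in>prime_factors q. of_nat p powr (- s) + 1)" by (simp add: euler_factor_def add.commute)
  also have "\<dots> = (\<Sum>A\<in>Pow (prime_factors q). \<Prod>p\<in>A. of_nat p powr (- s))" by (subst prod_add) simp_all
  also have "\<dots> = (\<Sum>A\<in>Pow (prime_factors q). of_nat (\<Prod>A) powr (- s))"
    by (intro sum.cong refl powr_of_nat_prod[symmetric]) (auto intro: finite_subset)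
  finally show ?thesis .
qed

text \<open>Each factor has modulus at least one minus 1/sqrt(2), hence at least 1/4, and 4 to the
  number of ramified primes is the square of a quantity that \<open>two_power_omega_le\<close>
  bounds by 8 times the class number.\<close>

lemma euler_factor_lower_bound:
  assumes q: "q > 4" and s: "Re s \<ge> 1 / 2"
  shows "1 \<le> norm (euler_factor s) * (64 * real (class_number K) ^ 2)"
proof -
  have "1 / 4 \<le> norm (1 + of_nat p powr (- s))" if p: "p \<in> prime_factors q" for p :: nat
  proof -
    have "p \<ge> 2" using p prime_ge_2_nat by blast
    then have p2: "real p \<ge> 2" by simp
    have "norm (of_nat p powr (- s)) = real p powr (- Re s)" by (simp add: norm_of_nat_powr)
    also have "\<dots> \<le> real p powr (- (1 / 2))" using s p2 by (intro powr_mono) auto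
    also have "\<dots> \<le> 2 powr (- (1 / 2))" using p2 by (intro powr_mono2') auto
    also have "\<dots> \<le> 3 / 4"
    proof -
      have "sqrt 2 \<ge> 4 / (3::real)" by (rule real_le_rsqrt) (simp add: power2_eq_square)
      then show ?thesis by (simp add: powr_minus powr_half_sqrt field_simps)
    qed
    finally have "norm (of_nat p powr (- s)) \<le> 3 / 4" .
    moreover have "1 - norm (of_nat p powr (- s)) \<le> norm (1 + of_nat p powr (- s))"
      using norm_triangle_ineq2[of 1 "- (of_nat p powr (- s))"] by simp
    ultimately show ?thesis by linarith
  qed
  then have "(\<Prod>p\<in>prime_factors q. 1 / 4 :: real) \<le> (\<Prod>p\<in>prime_factors q. norm (1 + of_nat p powr (- s)))"
    by (intro prod_mono) auto
  then have low: "(1 / 4) ^ card (prime_factors q) \<le> norm (euler_factor s)"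
    by (simp add: euler_factor_def prod_norm)
  have "real (2 ^ card (prime_factors q)) \<le> real (8 * class_number K)"
    using two_power_omega_le[OF q] by (simp only: of_nat_le_iff)
  then have "(2 ^ card (prime_factors q)) ^ 2 \<le> (8 * real (class_number K)) ^ 2" by (intro power_mono) auto
  moreover have "(2 ^ n) ^ 2 = (4::real) ^ n" for n by (simp add: power2_eq_square power_mult_distrib[symmetric])
  ultimately have "4 ^ card (prime_factors q) \<le> 64 * real (class_number K) ^ 2" by (simp add: power_mult_distrib)
  then have "(1 / 4) ^ card (prime_factors q) * 4 ^ card (prime_factors q) \<le> norm (euler_factor s) * (64 * real (class_number K) ^ 2)"
    by (intro mult_mono low) auto
  then show ?thesis by (simp add: power_mult_distrib[symmetric])
qed

text \<open>After matching ramified ideals with small products, three kinds of terms remain: small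
  ideals with a split prime, classes with large \<open>a\<close>, and subsets with large product.
  Each such term is small, and their number is at most 9 times the class number.\<close>

lemma class_sum_euler_factor:
  assumes q: "q > 4" and s: "Re s \<ge> 1 / 2"
  shows "norm (class_sum s - euler_factor s) \<le>
    9 * real (class_number K) * (real q / 4) powr (- (1 / (4 * real (class_number K))))"
proof -
  define h where "h = real (class_number K)"
  have h: "h \<ge> 1" using class_number_pos[OF q] by (simp add: h_def)
  \<comment> \<open>A base of size at least \<open>q / 4\<close> to the power
    \<open>1 / (2 * h)\<close>, raised to a real exponent of at most -1/2.\<close>
  define M where "M = (real q / 4) powr (- (1 / (4 * h)))"
  have q1: "real q / 4 \<ge> 1" using q by simp
  have large: "norm (of_real x powr (- s)) \<le> M" if x: "x > 0" "real q / 4 \<le> x powr (2 * h)" for x :: real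
  proof -
    have x1: "x \<ge> 1"
    proof (rule ccontr)
      assume "\<not> x \<ge> 1"
      then have "x powr (2 * h) < 1 powr (2 * h)" using x h by (intro powr_less_mono2) auto
      then show False using x q1 by simp
    qed
    have "norm (of_real x powr (- s)) = x powr (- Re s)" using x by (subst norm_of_real_powr) auto
    also have "\<dots> \<le> x powr (2 * h * (- (1 / (4 * h))))" using x1 s h by (intro powr_mono) auto
    also have "\<dots> = (x powr (2 * h)) powr (- (1 / (4 * h)))" by (rule powr_powr[symmetric])
    also have "\<dots> \<le> M" unfolding M_def using x q1 h by (intro powr_mono2') auto
    finally show ?thesis .
  qed
  \<comment> \<open>Bases above half the square root of \<open>q\<close> are larger still, because
    \<open>h \<ge> 1\<close>.\<close>
  have large2: "norm (of_real x powr (- s)) \<le> M" if x: "x > 0" "real q \<le> 4 * x ^ 2" for x :: real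
  proof (rule large[OF x(1)])
    have "x ^ 2 \<ge> 1 ^ 2" using x q1 by simp
    then have "x \<ge> 1" using x by (metis power2_le_imp_le less_imp_le)
    then have "x powr 2 \<le> x powr (2 * h)" using h by (intro powr_mono) auto
    then show "real q / 4 \<le> x powr (2 * h)" using x by simp
  qed
  let ?S = "{p \<in> reps. 4 * fst p ^ 2 < int q}" and ?B = "{p \<in> reps. \<not> 4 * fst p ^ 2 < int q}"
  let ?g = "\<lambda>p. of_int (fst p) powr (- s) :: complex"
  let ?U = "small_ideals - ramified_ideals" and ?L = "Pow (prime_factors q) - small_products"
  let ?e = "\<lambda>A. of_nat (\<Prod>A) powr (- s) :: complex"
  have ram: "ramified_ideals \<subseteq> small_ideals" by (auto simp: ramified_ideals_def)
  have "class_sum s = (\<Sum>p\<in>?S. ?g p) + (\<Sum>p\<in>?B. ?g p)"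
  proof -
    have "reps = ?S \<union> ?B" by blast
    then have "class_sum s = sum ?g (?S \<union> ?B)" by (simp only: class_sum_def)
    also have "\<dots> = sum ?g ?S + sum ?g ?B" by (intro sum.union_disjoint) (use finite_reps in auto)
    finally show ?thesis .
  qed
  moreover have "(\<Sum>p\<in>?S. ?g p) = (\<Sum>p\<in>small_ideals. ?g p)"
    using sum.reindex_bij_betw[OF bij_small_ideals, of ?g] by (simp add: case_prod_unfold)
  moreover have "\<dots> = (\<Sum>p\<in>?U. ?g p) + (\<Sum>p\<in>ramified_ideals. ?g p)"
    by (rule sum.subset_diff[OF ram finite_small_ideals])
  moreover have "(\<Sum>p\<in>ramified_ideals. ?g p) = (\<Sum>A\<in>small_products. ?e A)"
  proof -
    have "(\<Sum>p\<in>ramified_ideals. ?g p) = (\<Sum>p\<in>ramified_ideals. ?e (prime_factors (nat (fst p))))"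
    proof (intro sum.cong refl)
      fix p assume p: "p \<in> ramified_ideals"
      obtain a t where at: "p = (a, t)" by (cases p)
      have "a > 0" using p by (simp add: at ramified_ideals_def small_ideals_iff_roots)
      then have "of_int a = (of_nat (nat a) :: complex)" by simp
      then show "?g p = ?e (prime_factors (nat (fst p)))"
        using ramified_eq_prod[of a t] p by (simp add: at del: of_nat_prod)
    qed
    also have "\<dots> = (\<Sum>A\<in>small_products. ?e A)" by (rule sum.reindex_bij_betw[OF bij_ramified])
    finally show ?thesis .
  qed
  moreover have "euler_factor s = (\<Sum>A\<in>?L. ?e A) + (\<Sum>A\<in>small_products. ?e A)"
    unfolding euler_factor_eq_sum by (rule sum.subset_diff) (auto simp: small_products_def)
  ultimately have "class_sum s - euler_factor s = (\<Sum>p\<in>?U. ?g p) + (\<Sum>p\<in>?B. ?g p) - (\<Sum>A\<in>?L. ?e A)" by simp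
  also have "norm \<dots> \<le> (norm (\<Sum>p\<in>?U. ?g p) + norm (\<Sum>p\<in>?B. ?g p)) + norm (\<Sum>A\<in>?L. ?e A)"
    by (intro order_trans[OF norm_triangle_ineq4] add_mono norm_triangle_ineq order_refl)
  also have "\<dots> \<le> (of_nat (card ?U) * M + of_nat (card ?B) * M) + of_nat (card ?L) * M"
  proof (intro add_mono sum_norm_bound)
    fix p assume p: "p \<in> ?U"
    obtain a t where at: "p = (a, t)" by (cases p)
    obtain r where r: "prime r" "int r \<le> a" "q \<le> 4 * r ^ (2 * class_number K)"
      using unramified_prime_large[of a t] p at by auto
    have "real q \<le> real (4 * r ^ (2 * class_number K))" using r by (simp only: of_nat_le_iff)
    then have "real q / 4 \<le> real r ^ (2 * class_number K)" by simp
    also have "\<dots> = real r powr (2 * h)"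
      using r by (simp add: h_def powr_realpow[symmetric] prime_gt_0_nat)
    also have "\<dots> \<le> of_int a powr (2 * h)" using r h by (intro powr_mono2) auto
    finally show "norm (?g p) \<le> M" using large[of "of_int a"] p by (simp add: at small_ideals_def)
  next
    fix p assume p: "p \<in> ?B"
    obtain a t where at: "p = (a, t)" by (cases p)
    have "int q \<le> 4 * a ^ 2" using p by (simp add: at)
    then have "real_of_int (int q) \<le> of_int (4 * a ^ 2)" by (simp only: of_int_le_iff)
    then show "norm (?g p) \<le> M" using large2[of "of_int a"] reps_reduced(1)[of a t] p by (simp add: at)
  next
    fix A assume A: "A \<in> ?L"
    then have "q \<le> 4 * \<Prod>A ^ 2" by (auto simp: small_products_def)
    then have "real q \<le> real (4 * \<Prod>A ^ 2)" by (simp only: of_nat_le_iff)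
    moreover have "\<Prod>A > 0" using A by (intro prod_pos) (auto intro: prime_gt_0_nat)
    ultimately show "norm (?e A) \<le> M" using large2[of "real (\<Prod>A)"] by (simp del: of_nat_prod)
  qed
  also have "\<dots> = (real (card ?U) + real (card ?B) + real (card ?L)) * M" by (simp add: algebra_simps)
  \<comment> \<open>The unmatched small ideals and the large classes together number at most
    \<open>h\<close>; the subsets of the ramified primes number at most
    \<open>8 * h\<close>.\<close>
  also have "\<dots> \<le> 9 * h * M"
  proof (intro mult_right_mono)
    have "card ?U \<le> card small_ideals" by (intro card_mono finite_small_ideals) auto
    also have "\<dots> = card ?S" using bij_betw_same_card[OF bij_small_ideals] by simp
    finally have "card ?U + card ?B \<le> card ?S + card ?B" by simp
    also have "\<dots> = card (?S \<union> ?B)" by (intro card_Un_disjoint[symmetric]) (use finite_reps in auto)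
    also have "?S \<union> ?B = reps" by blast
    finally have "card ?U + card ?B \<le> class_number K" by (simp add: card_reps)
    moreover have "card ?L \<le> card (Pow (prime_factors q))" by (intro card_mono) auto
    then have "card ?L \<le> 8 * class_number K" using two_power_omega_le[OF q] by (simp add: card_Pow)
    ultimately have "card ?U + card ?B + card ?L \<le> 9 * class_number K" by simp
    then have "real (card ?U + card ?B + card ?L) \<le> real (9 * class_number K)" by (simp only: of_nat_le_iff)
    then show "real (card ?U) + real (card ?B) + real (card ?L) \<le> 9 * h" by (simp add: h_def)
  qed (simp add: M_def)
  finally show ?thesis by (simp add: M_def h_def)
qed

end

section \<open>The final estimate\<close>

context odd_real_character
begin

text \<open>The absolute errors are divided by zeta(2s) and the ramified product, whose inverses are
  at most \<open>2 / d\<close> and \<open>64 * h ^ 2\<close>. Hence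
  \<open>512000 = 4000 * 2 * 64\<close> and \<open>576 = 9 * 64\<close>.\<close>

lemma zeta_L_estimate:
  assumes q: "q \<ge> 64" and d: "0 < d" "d \<le> 1" and s: "Re s \<ge> 1 / 2 + d"
    and s1: "ln q powr (- 4) \<le> norm (1 - s)" and sq: "norm s \<le> q powr (d / 10)"
  defines "h \<equiv> real (class_number K)"
  obtains E where "norm E \<le> 512000 * h ^ 3 * ln q ^ 4 / d ^ 3 * q powr (- (3 * d / 20)) +
      576 * h ^ 3 * (q / 4) powr (- (1 / (4 * h)))"
    and "zeta_fun s * L_fun s = zeta_fun (2 * s) * euler_factor s * (1 + E)"
    and "s \<noteq> 1"
proof -
  define L where "L = ln (real q)"
  define Z where "Z = zeta_fun (2 * s)"
  define P where "P = euler_factor s"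
  define D where "D = zeta_fun s * L_fun s - Z * class_sum s"
  have h: "h \<ge> 1" using class_number_pos q by (simp add: h_def)
  have "exp 1 \<le> real q" using exp_le q by linarith
  then have L: "L \<ge> 1" unfolding L_def using q by (subst ln_ge_iff) auto
  have L4: "L powr (- 4) = 1 / L ^ 4" using L by (simp add: powr_minus powr_numeral field_simps)
  have n1: "norm (s - 1) \<ge> 1 / L ^ 4" using s1 L4 by (simp add: L_def norm_minus_commute)
  have L40: "L ^ 4 \<ge> 1" using L by simp
  have s_ne: "s \<noteq> 1" using n1 L40 by auto
  have inv: "1 / norm (s - 1) \<le> L ^ 4"
  proof -
    have "1 / norm (s - 1) \<le> 1 / (1 / L ^ 4)"
      using n1 L40 s_ne by (intro divide_left_mono) (auto intro!: divide_pos_pos)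
    then show ?thesis by simp
  qed
  have qd: "real q powr (d / 10) \<ge> 1" using q d by (intro ge_one_powr_ge_zero) auto
  have sum: "norm s + 1 / norm (s - 1) \<le> 2 * (L ^ 4 * real q powr (d / 10))"
  proof -
    have "1 * real q powr (d / 10) \<le> L ^ 4 * real q powr (d / 10)" using L40 by (intro mult_right_mono) auto
    moreover have "L ^ 4 * 1 \<le> L ^ 4 * real q powr (d / 10)" using L40 qd by (intro mult_left_mono) auto
    ultimately show ?thesis using sq inv by linarith
  qed
  have kappa: "(sqrt q / 2) powr (- (d / 2)) \<le> 2 * real q powr (- (d / 4))"
  proof -
    have "(sqrt q / 2) powr (- (d / 2)) = sqrt q powr (- (d / 2)) * (1 / 2) powr (- (d / 2))"
      using powr_mult[of "sqrt q" "1 / 2" "- (d / 2)"] by simp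
    also have "sqrt q powr (- (d / 2)) = real q powr (- (d / 4))"
      by (simp add: powr_half_sqrt[symmetric] powr_powr)
    also have "(1 / 2) powr (- (d / 2)) = 2 powr (d / 2)" by (simp add: powr_minus powr_divide)
    finally have "(sqrt q / 2) powr (- (d / 2)) = 2 powr (d / 2) * real q powr (- (d / 4))" by (simp add: mult.commute)
    also have "\<dots> \<le> 2 powr 1 * real q powr (- (d / 4))" using d by (intro mult_right_mono powr_mono) auto
    finally show ?thesis by simp
  qed
  have "norm D \<le> card reps * (1000 * (sqrt q / 2) powr (- (d / 2)) / d ^ 2 * (norm s + 1 / norm (s - 1)))"
    unfolding D_def Z_def by (rule zeta_L_approx[OF q d s s_ne])
  also have "\<dots> \<le> card reps * (1000 * (2 * real q powr (- (d / 4))) / d ^ 2 * (2 * (L ^ 4 * real q powr (d / 10))))"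
    by (intro mult_left_mono mult_mono divide_right_mono kappa sum) (auto intro!: add_nonneg_nonneg)
  also have "\<dots> = 4000 * h * L ^ 4 / d ^ 2 * (real q powr (- (d / 4)) * real q powr (d / 10))"
    using d by (simp add: card_reps h_def field_simps)
  \<comment> \<open>The saving \<open>d / 4\<close> comes from the size of \<open>c\<close>, the
    loss \<open>d / 10\<close> from the size allowed for \<open>s\<close>.\<close>
  also have "real q powr (- (d / 4)) * real q powr (d / 10) = real q powr (- (3 * d / 20))"
    by (simp add: powr_add[symmetric])
  finally have D: "norm D \<le> 4000 * h * L ^ 4 / d ^ 2 * real q powr (- (3 * d / 20))" .
  have Z: "1 \<le> norm Z * (2 / d)"
  proof -
    have r: "Re (2 * s) - 1 \<ge> 2 * d" using s by simp
    have "1 \<le> norm Z * (1 + 1 / (Re (2 * s) - 1))" unfolding Z_def using r d by (intro zeta_fun_lower_bound) auto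
    also have "\<dots> \<le> norm Z * (2 / d)"
    proof (rule mult_left_mono)
      have "1 / (Re (2 * s) - 1) \<le> 1 / (2 * d)" using r d by (intro divide_left_mono) auto
      moreover have "1 + 1 / (2 * d) \<le> 2 / d" using d by (simp add: field_simps)
      ultimately show "1 + 1 / (Re (2 * s) - 1) \<le> 2 / d" by linarith
    qed simp
    finally show ?thesis .
  qed
  have P: "1 \<le> norm P * (64 * h ^ 2)"
    unfolding P_def h_def using q d s by (intro euler_factor_lower_bound) auto
  have G: "norm (class_sum s - P) \<le> 9 * h * (real q / 4) powr (- (1 / (4 * h)))"
    unfolding P_def h_def using q d s by (intro class_sum_euler_factor) auto
  have nz: "Z \<noteq> 0" "P \<noteq> 0" using Z P by auto
  define E where "E = D / (Z * P) + (class_sum s - P) / P"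
  have iZ: "1 / norm Z \<le> 2 / d" using Z nz by (simp add: field_simps)
  have iP: "1 / norm P \<le> 64 * h ^ 2" using P nz by (simp add: field_simps)
  have "norm E \<le> norm D * ((1 / norm Z) * (1 / norm P)) + norm (class_sum s - P) * (1 / norm P)"
    unfolding E_def using norm_triangle_ineq[of "D / (Z * P)" "(class_sum s - P) / P"] by (simp add: norm_mult norm_divide)
  also have "\<dots> \<le> (4000 * h * L ^ 4 / d ^ 2 * real q powr (- (3 * d / 20))) * ((2 / d) * (64 * h ^ 2)) +
      (9 * h * (real q / 4) powr (- (1 / (4 * h)))) * (64 * h ^ 2)"
    using h d L40 by (intro add_mono mult_mono D G iZ iP) auto
  also have "\<dots> = 512000 * h ^ 3 * L ^ 4 / d ^ 3 * real q powr (- (3 * d / 20)) +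
      576 * h ^ 3 * (real q / 4) powr (- (1 / (4 * h)))"
    using d by (simp add: power2_eq_square power3_eq_cube mult.assoc)
  finally show ?thesis
  proof (rule that[unfolded L_def[symmetric]])
    show "zeta_fun s * L_fun s = zeta_fun (2 * s) * euler_factor s * (1 + E)"
      unfolding Z_def[symmetric] P_def[symmetric] E_def using nz by (simp add: D_def field_simps)
  qed (rule s_ne)
qed

text \<open>With a relative error below 1 the right side is not 0, so \<open>zeta s\<close> cannot
  vanish and may be divided out. The bound on \<open>b\<close> serves exactly this.\<close>

lemma dirichlet_L_approximation:
  assumes q: "q \<ge> 64" and d: "0 < d" "d \<le> 1" and s: "Re s \<ge> 1 / 2 + d"
    and s1: "ln q powr (- 4) \<le> norm (1 - s)" and sq: "norm s \<le> q powr (d / 10)"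
    and b: "512000 * real (class_number K) ^ 3 * ln q ^ 4 / d ^ 3 * q powr (- (3 * d / 20)) +
      576 * real (class_number K) ^ 3 * (q / 4) powr (- (1 / (4 * real (class_number K)))) \<le> b" "b < 1"
  shows "zeta s \<noteq> 0 \<and> (\<exists>E. norm E \<le> b \<and> dirichlet_L q chi s =
    zeta (2 * s) / zeta s * (\<Prod>p\<in>prime_factors q. 1 + 1 / of_nat p powr s) * (1 + E))"
proof -
  obtain E where E: "norm E \<le> b" "zeta_fun s * L_fun s = zeta_fun (2 * s) * euler_factor s * (1 + E)" "s \<noteq> 1"
    by (rule zeta_L_estimate[OF q d s s1 sq]) (use b(1) in \<open>blast intro: order_trans\<close>)
  have "1 \<le> norm (euler_factor s) * (64 * real (class_number K) ^ 2)"
    using q d s by (intro euler_factor_lower_bound) auto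
  then have "euler_factor s \<noteq> 0" by auto
  moreover have "1 \<le> norm (zeta_fun (2 * s)) * (1 + 1 / (Re (2 * s) - 1))"
    using s d by (intro zeta_fun_lower_bound) auto
  then have "zeta_fun (2 * s) \<noteq> 0" by auto
  moreover have "1 + E \<noteq> 0"
  proof
    assume "1 + E = 0"
    then have "E = - 1" by (simp add: add_eq_0_iff)
    then show False using E(1) b(2) by simp
  qed
  ultimately have nz: "zeta_fun s \<noteq> 0" using E(2) by auto
  have "zeta s = zeta_fun s" "zeta (2 * s) = zeta_fun (2 * s)" "dirichlet_L q chi s = L_fun s"
    using s d E(3) by (auto intro!: zeta_eq dirichlet_L_eq dest: arg_cong[of _ _ Re])
  moreover have "(\<Prod>p\<in>prime_factors q. 1 + 1 / of_nat p powr s) = euler_factor s"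
    by (simp add: euler_factor_def powr_minus_divide)
  moreover have "L_fun s = zeta_fun (2 * s) / zeta_fun s * euler_factor s * (1 + E)"
    using nz E(2) by (simp add: field_simps)
  ultimately show ?thesis using nz E(1) by auto
qed

end

section \<open>Growth comparisons in terms of the iterated logarithm\<close>

lemma eventually_dominated:
  fixes a b c :: real
  assumes "c > 0"
  shows "\<forall>\<^sub>F x in at_top. a * x powr b \<le> c * exp x"
  using assms by real_asymp

text \<open>Here \<open>x\<close> stands for \<open>ln (ln q)\<close>, so \<open>exp x\<close> is
  \<open>ln q\<close> and bounds the class number; the seventh power collects its cube and the
  factor \<open>ln q ^ 4\<close>. As \<open>\<eta> > 1\<close>, the exponent
  \<open>x powr \<eta>\<close> outgrows the \<open>3 * x\<close> stemming from the cube.\<close>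

lemma eventually_error_bound:
  fixes \<eta> \<mu> :: real
  assumes "\<eta> > 1" "\<mu> > 0"
  shows "\<forall>\<^sub>F x in at_top. 512000 * exp x ^ 7 / (x powr (- \<mu>)) ^ 3 * exp (- (3 / 20 * (exp x * x powr (- \<mu>)))) +
    576 * exp x ^ 3 * exp (- (x powr \<eta> / 8)) \<le> 1 / 2 * exp (- (1 / 3) * x powr (\<eta> - \<mu>))"
proof -
  \<comment> \<open>The factor 4 in each logarithm leaves 1/4 of the target for each of the two
    errors.\<close>
  define K1 where "K1 = ln (4 * 512000 :: real)"
  define K2 where "K2 = ln (4 * 576 :: real)"
  have "\<forall>\<^sub>F x in at_top. 7 * x powr (1 + \<mu>) \<le> (1 / 40) * exp x"
    "\<forall>\<^sub>F x in at_top. (3 * \<mu>) * x powr (1 + \<mu>) \<le> (1 / 40) * exp x"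
    "\<forall>\<^sub>F x in at_top. K1 * x powr \<mu> \<le> (1 / 40) * exp x"
    "\<forall>\<^sub>F x in at_top. (1 / 3) * x powr \<eta> \<le> (1 / 40) * exp x"
    by (rule eventually_dominated, simp)+
  moreover have "\<forall>\<^sub>F x in at_top. x powr \<mu> \<ge> 16" "\<forall>\<^sub>F x in at_top. x powr (\<eta> - 1) \<ge> 72"
    "\<forall>\<^sub>F x in at_top. x powr \<eta> \<ge> 24 * K2"
    using assms by real_asymp+
  moreover have "\<forall>\<^sub>F x::real in at_top. x \<ge> 1" by (rule eventually_ge_at_top)
  ultimately show ?thesis
  proof eventually_elim
    case (elim x)
    have x: "x > 0" using elim by simp
    define m where "m = x powr \<mu>"
    have m: "m > 0" "x powr (- \<mu>) = 1 / m" using x by (auto simp: m_def powr_minus field_simps)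
    define Y where "Y = exp x / m"
    have t1: "7 * x \<le> Y / 40" using elim(1) x m unfolding Y_def by (simp add: powr_add m_def[symmetric] field_simps)
    have "ln x \<le> x" using ln_le_minus_one[OF x] by linarith
    then have "3 * \<mu> * ln x \<le> 3 * \<mu> * x" using assms by (intro mult_left_mono) auto
    moreover have "3 * \<mu> * x \<le> Y / 40" using elim(2) x m unfolding Y_def by (simp add: powr_add m_def[symmetric] field_simps)
    ultimately have t2: "3 * \<mu> * ln x \<le> Y / 40" by linarith
    have t3: "K1 \<le> Y / 40" using elim(3) m unfolding Y_def by (simp add: m_def[symmetric] field_simps)
    have e: "x powr (\<eta> - \<mu>) = x powr \<eta> / m" by (simp add: powr_diff m_def)
    have t4: "1 / 3 * x powr (\<eta> - \<mu>) \<le> Y / 40" using elim(4) m unfolding Y_def e by (simp add: field_simps)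
    have Y0: "Y \<ge> 0" using m by (simp add: Y_def)
    have first: "512000 * exp x ^ 7 / (x powr (- \<mu>)) ^ 3 * exp (- (3 / 20 * (exp x * x powr (- \<mu>)))) \<le>
        1 / 4 * exp (- (1 / 3) * x powr (\<eta> - \<mu>))"
    proof -
      have em: "m = exp (\<mu> * ln x)" using x by (simp add: m_def powr_def)
      have "512000 * exp x ^ 7 / (x powr (- \<mu>)) ^ 3 * exp (- (3 / 20 * (exp x * x powr (- \<mu>)))) =
          1 / 4 * (exp K1 * exp (7 * x) * exp (3 * (\<mu> * ln x)) * exp (- (3 / 20 * Y)))"
        unfolding m(2) Y_def exp_of_nat_mult[of 7 x, simplified] exp_of_nat_mult[of 3 "\<mu> * ln x", simplified] em[symmetric]
        by (simp add: K1_def power_divide)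
      also have "\<dots> = 1 / 4 * exp (K1 + 7 * x + 3 * (\<mu> * ln x) + - (3 / 20 * Y))" by (simp only: exp_add)
      \<comment> \<open>Three positive terms and the target exponent each take at most
        \<open>Y / 40\<close>, in total \<open>Y / 10\<close>, below the available
        \<open>3 * Y / 20\<close>.\<close>
      also have "\<dots> \<le> 1 / 4 * exp (- (1 / 3) * x powr (\<eta> - \<mu>))" using t1 t2 t3 t4 Y0 by simp
      finally show ?thesis .
    qed
    have "x powr \<eta> = x powr (\<eta> - 1) * x" using x powr_add[of x "\<eta> - 1" 1] by simp
    then have u1: "3 * x \<le> x powr \<eta> / 24" using mult_right_mono[OF elim(6), of x] x by simp
    have "x powr \<eta> / m \<le> x powr \<eta> / 16" using elim(5) by (intro divide_left_mono) (auto simp: m_def)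
    then have u2: "1 / 3 * x powr (\<eta> - \<mu>) \<le> x powr \<eta> / 48" unfolding e by linarith
    have u4: "x powr \<eta> \<ge> 0" by simp
    have u3: "K2 \<le> x powr \<eta> / 24" using elim(7) by simp
    have second: "576 * exp x ^ 3 * exp (- (x powr \<eta> / 8)) \<le> 1 / 4 * exp (- (1 / 3) * x powr (\<eta> - \<mu>))"
    proof -
      have "576 * exp x ^ 3 * exp (- (x powr \<eta> / 8)) = 1 / 4 * (exp K2 * exp (3 * x) * exp (- (x powr \<eta> / 8)))"
        unfolding exp_of_nat_mult[of 3 x, simplified] by (simp add: K2_def)
      also have "\<dots> = 1 / 4 * exp (K2 + 3 * x + - (x powr \<eta> / 8))" by (simp only: exp_add)
      also have "\<dots> \<le> 1 / 4 * exp (- (1 / 3) * x powr (\<eta> - \<mu>))" 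
      proof (intro mult_left_mono exp_le_cancel_iff[THEN iffD2])
        \<comment> \<open>Of the available \<open>x powr \<eta> / 8\<close>, the shares 1/24, 1/24
          and 1/48 are used.\<close>
        show "K2 + 3 * x + - (x powr \<eta> / 8) \<le> - (1 / 3) * x powr (\<eta> - \<mu>)" using u1 u2 u3 u4 by linarith
      qed simp
      finally show ?thesis .
    qed
    show ?case using add_mono[OF first second] by simp
  qed
qed

theorem theorem1:
  fixes \<eta> \<mu> :: real
  assumes "\<eta> > 0" and "\<mu> > 0" and "\<eta> > max \<mu> 1"
  shows "\<exists>(C::real) (Q::nat). \<forall>(q::nat) (chi :: int \<Rightarrow> complex).
           q \<ge> Q \<longrightarrow>
           primitive_character q chi \<longrightarrow> real_character chi \<longrightarrow> chi (-1) = -1 \<longrightarrow>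
           real (class_number (imaginary_quadratic_field q))
             \<le> ln (real q) / ln (ln (real q)) powr \<eta> \<longrightarrow>
           (\<forall>s \<in> region_H (ell \<mu> q) q.
              zeta s \<noteq> 0 \<and>
              (\<exists>E::complex.
                 cmod E \<le> C * exp (- (1 / 3) * ln (ln (real q)) powr (\<eta> - \<mu>)) \<and>
                 dirichlet_L q chi s =
                   zeta (2 * s) / zeta s *
                   (\<Prod>p\<in>prime_factors q. 1 + 1 / of_nat p powr s) * (1 + E)))"
proof -
  obtain X0 where X0: "512000 * exp x ^ 7 / (x powr (- \<mu>)) ^ 3 * exp (- (3 / 20 * (exp x * x powr (- \<mu>)))) +
    576 * exp x ^ 3 * exp (- (x powr \<eta> / 8)) \<le> 1 / 2 * exp (- (1 / 3) * x powr (\<eta> - \<mu>))" if "x \<ge> X0" for x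
    using eventually_error_bound[of \<eta> \<mu>] assms unfolding eventually_at_top_linorder by auto
  define X1 where "X1 = max 1 X0"
  define Q where "Q = max 64 (nat \<lceil>exp (exp X1)\<rceil>)"
  show ?thesis
  \<comment> \<open>The constant 1/2 keeps the error below 1, as needed for dividing by
    \<open>zeta s\<close>; \<open>Q\<close> ensures \<open>q \<ge> 64\<close> and a large iterated
    logarithm.\<close>
  proof (intro exI[of _ "1 / 2"] exI[of _ Q] allI impI ballI)
    fix q chi s
    assume q: "q \<ge> Q" and chi: "primitive_character q chi" "real_character chi" "chi (-1) = -1"
      and hle: "real (class_number (imaginary_quadratic_field q)) \<le> ln (real q) / ln (ln (real q)) powr \<eta>"
      and s: "s \<in> region_H (ell \<mu> q) q"
    interpret odd_real_character q chi using chi by unfold_locales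
    have q64: "q \<ge> 64" using q by (simp add: Q_def)
    have "nat \<lceil>exp (exp X1)\<rceil> \<le> q" using q by (simp add: Q_def)
    then have "exp (exp X1) \<le> real q" by linarith
    then have "exp X1 \<le> ln (real q)" using q64 by (simp add: ln_ge_iff)
    moreover from this have L0: "ln (real q) > 0" by (rule less_le_trans[OF exp_gt_zero])
    ultimately have X1: "X1 \<le> ln (ln (real q))" by (simp add: ln_ge_iff)
    define x where "x = ln (ln (real q))"
    define L where "L = ln (real q)"
    define h where "h = real (class_number K)"
    have Lx: "L = exp x" using L0 by (simp add: L_def x_def)
    have x: "x \<ge> 1" "x \<ge> X0" using X1 by (auto simp: X1_def x_def)
    define d where "d = ell \<mu> q"
    have dx: "d = x powr (- \<mu>)" by (simp add: d_def ell_def x_def)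
    have d: "0 < d" "d \<le> 1" using x assms powr_mono2'[of "- \<mu>" 1 x] by (auto simp: dx)
    have h1: "h \<ge> 1" using class_number_pos q64 by (simp add: h_def)
    have hL: "h \<le> L / x powr \<eta>" using hle by (simp add: h_def L_def x_def)
    have xe: "x powr \<eta> \<ge> 1" using x assms by (intro ge_one_powr_ge_zero) auto
    have "L / x powr \<eta> \<le> L / 1" using xe L0 by (intro divide_left_mono) (auto simp: L_def)
    then have "h \<le> L" using hL by simp
    then have h3: "h ^ 3 \<le> L ^ 3" using h1 by (intro power_mono) auto
    have qe: "real q = exp L" using q64 by (simp add: L_def)
    have A: "512000 * h ^ 3 * L ^ 4 / d ^ 3 * q powr (- (3 * d / 20)) \<le>
        512000 * exp x ^ 7 / (x powr (- \<mu>)) ^ 3 * exp (- (3 / 20 * (exp x * x powr (- \<mu>))))"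
    proof -
      have "512000 * h ^ 3 * L ^ 4 / d ^ 3 * q powr (- (3 * d / 20)) \<le> 512000 * L ^ 3 * L ^ 4 / d ^ 3 * q powr (- (3 * d / 20))"
        using h3 d L0 by (intro mult_right_mono divide_right_mono mult_left_mono) (auto simp: L_def)
      also have "\<dots> = 512000 * exp x ^ 7 / (x powr (- \<mu>)) ^ 3 * exp (- (3 / 20 * (exp x * x powr (- \<mu>))))"
        unfolding qe Lx[symmetric] dx[symmetric]
        by (simp add: powr_def power_numeral_reduce mult_ac)
      finally show ?thesis .
    qed
    have B: "576 * h ^ 3 * (q / 4) powr (- (1 / (4 * h))) \<le> 576 * exp x ^ 3 * exp (- (x powr \<eta> / 8))"
    proof -
      \<comment> \<open>Discarding the 4 costs half of the logarithm, so the exponent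
        \<open>1 / (4 * h)\<close> yields \<open>L / (8 * h)\<close>, at least
        \<open>x powr \<eta> / 8\<close> by the class number bound.\<close>
      have "ln (real q / 4) \<ge> L / 2"
      proof -
        have "4 \<le> sqrt (real q)" using q64 by (intro real_le_rsqrt) simp
        then have "sqrt (real q) \<le> real q / 4"
          using mult_right_mono[of 4 "sqrt q" "sqrt q"] by simp
        then have "ln (sqrt (real q)) \<le> ln (real q / 4)" using q64 by (subst ln_le_cancel_iff) auto
        then show ?thesis using q64 by (simp add: ln_sqrt L_def)
      qed
      moreover have "x powr \<eta> * h \<le> L" using hL x by (simp add: pos_le_divide_eq mult.commute)
      ultimately have "x powr \<eta> / 8 \<le> ln (real q / 4) / (4 * h)" using h1 by (simp add: field_simps)
      then have "(real q / 4) powr (- (1 / (4 * h))) \<le> exp (- (x powr \<eta> / 8))"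
        using q64 by (simp add: powr_def)
      then show ?thesis using h3 h1 unfolding Lx by (intro mult_mono) auto
    qed
    show "zeta s \<noteq> 0 \<and> (\<exists>E. cmod E \<le> 1 / 2 * exp (- (1 / 3) * ln (ln (real q)) powr (\<eta> - \<mu>)) \<and>
        dirichlet_L q chi s = zeta (2 * s) / zeta s * (\<Prod>p\<in>prime_factors q. 1 + 1 / of_nat p powr s) * (1 + E))"
    proof (rule dirichlet_L_approximation[OF q64 d])
      show "Re s \<ge> 1 / 2 + d" "ln q powr (- 4) \<le> norm (1 - s)" "norm s \<le> q powr (d / 10)"
        using s by (auto simp: region_H_def d_def)
      show "512000 * real (class_number K) ^ 3 * ln q ^ 4 / d ^ 3 * q powr (- (3 * d / 20)) +
        576 * real (class_number K) ^ 3 * (q / 4) powr (- (1 / (4 * real (class_number K)))) \<le>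
        1 / 2 * exp (- (1 / 3) * ln (ln (real q)) powr (\<eta> - \<mu>))"
        using A B X0[OF x(2)] by (simp add: h_def L_def x_def)
      have "exp (- (1 / 3) * ln (ln (real q)) powr (\<eta> - \<mu>)) \<le> 1" by simp
      then show "1 / 2 * exp (- (1 / 3) * ln (ln (real q)) powr (\<eta> - \<mu>)) < 1" by linarith
    qed
  qed
qed

end
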